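(* Let $\mu$ be an admissible even probability measure on $\mathbb{R}$ that satisfies the $\Lambda^{\ast}$-condition. Then for any $\delta\in\left(0,\tfrac12\right)$ and $\epsilon\in(0,1)$ there exists $n_0(\mu,\delta,\epsilon)$ such that $$\varrho_2(\mu_n,\delta)\le(1+\epsilon)\,\mathbb{E}_\mu(\Lambda_\mu^{\ast})$$ for all $n\ge n_0(\mu,\delta,\epsilon)$.
   Context: Let $X$ have distribution $\mu$. Write $x^{\ast}=\sup\{x\in\mathbb{R}:\mu([x,\infty))>0\}$ (possibly $+\infty$), $\Lambda_\mu(t)=\ln\int e^{tx}\,d\mu(x)$, $\Lambda_\mu^{\ast}(x)=\sup_{t\in\mathbb{R}}\{tx-\Lambda_\mu(t)\}$, $\mathbb{E}_\mu(\Lambda_\mu^\ast)=\int\Lambda_\mu^\ast\,d\mu$. The measure $\mu$ is admissible if: $\mathrm{Var}(X)>0$; there is $r>0$ with $\mathbb{E}e^{tX}<\infty$ for $t\in(-r,r)$; if $x^{\ast}<\infty$ then $\mu(\{x^{\ast}\})=0$; and one of: (1) $x^{\ast}<\infty$, (2) $x^{\ast}=+\infty$ and $\{\Lambda_\mu<\infty\}=\mathbb{R}$, (3) $x^{\ast}=+\infty$, $\{\Lambda_\mu<\infty\}$ bounded and $\mu$ log-concave. It satisfies the $\Lambda^{\ast}$-condition if $\lim_{x\uparrow x^{\ast}}\frac{-\ln\mu([x,\infty))}{\Lambda_\mu^{\ast}(x)}=1$. Let $\mu_n=\mu^{\otimes n}$. For $N>n$ let $\vec X_1,\dots,\vec X_N$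 be i.i.d. random vectors in $\mathbb{R}^n$ with distribution $\mu_n$ (joint law $\mu_n^N$) and $K_N=\mathrm{conv}\{\vec X_1,\dots,\vec X_N\}$. For $\delta\in(0,\tfrac12)$, $\varrho_2(\mu_n,\delta)=\inf\{\varrho_2:\inf\{\mathbb{E}_{\mu_n^N}[\mu_n(K_N)]:N\ge\exp(\varrho_2 n)\}\ge1-\delta\}$. *)

theory Defs
  imports "HOL-Probability.Probability"
begin

definition xstar :: "real measure \<Rightarrow> ereal" where
  "xstar \<mu> = Sup {ereal x | x. measure \<mu> {x..} > 0}"

definition mgf :: "real measure \<Rightarrow> real \<Rightarrow> ennreal" where
  "mgf \<mu> t = (\<integral>\<^sup>+ x. ennreal (exp (t * x)) \<partial>\<mu>)"

definition Lambda :: "real measure \<Rightarrow> real \<Rightarrow> ereal" where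
  "Lambda \<mu> t = (if mgf \<mu> t = \<infinity> then \<infinity> else ereal (ln (enn2real (mgf \<mu> t))))"

definition Lambda_star :: "real measure \<Rightarrow> real \<Rightarrow> ereal" where
  "Lambda_star \<mu> x = (SUP t. ereal (t * x) - Lambda \<mu> t)"

(* E_mu(Lambda^*_mu) = int Lambda^*_mu d mu (Lambda^* >= 0, so a nonnegative integral) *)
definition E_Lambda_star :: "real measure \<Rightarrow> ennreal" where
  "E_Lambda_star \<mu> = (\<integral>\<^sup>+ x. e2ennreal (Lambda_star \<mu> x) \<partial>\<mu>)"

definition log_concave_measure :: "real measure \<Rightarrow> bool" where
  "log_concave_measure \<mu> \<longleftrightarrow>
     (\<forall>A B l. compact A \<longrightarrow> compact B \<longrightarrow> 0 < l \<longrightarrow> l < 1 \<longrightarrow>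
        measure \<mu> {l * a + (1 - l) * b | a b. a \<in> A \<and> b \<in> B}
          \<ge> measure \<mu> A powr l * measure \<mu> B powr (1 - l))"

definition admissible :: "real measure \<Rightarrow> bool" where
  "admissible \<mu> \<longleftrightarrow>
     prob_space.variance \<mu> (\<lambda>x. x) > 0 \<and>
     (\<exists>r>0. \<forall>t. - r < t \<and> t < r \<longrightarrow> integrable \<mu> (\<lambda>x. exp (t * x))) \<and>
     (xstar \<mu> < \<infinity> \<longrightarrow> measure \<mu> {real_of_ereal (xstar \<mu>)} = 0) \<and>
     (xstar \<mu> < \<infinity>
      \<or> (xstar \<mu> = \<infinity> \<and> (\<forall>t. Lambda \<mu> t < \<infinity>))
      \<or> (xstar \<mu> = \<infinity> \<and> bounded {t. Lambda \<mu> t < \<infinity>} \<and> log_concave_measure \<mu>))"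

definition Lambda_star_condition :: "real measure \<Rightarrow> bool" where
  "Lambda_star_condition \<mu> \<longleftrightarrow>
     ((\<lambda>x. - ln (measure \<mu> {x..}) / real_of_ereal (Lambda_star \<mu> x)) \<longlongrightarrow> 1)
       (if xstar \<mu> = \<infinity> then at_top else at_left (real_of_ereal (xstar \<mu>)))"

definition mu_n :: "real measure \<Rightarrow> nat \<Rightarrow> (nat \<Rightarrow> real) measure" where
  "mu_n \<mu> n = PiM {..<n} (\<lambda>_. \<mu>)"

definition K_N :: "nat \<Rightarrow> nat \<Rightarrow> (nat \<Rightarrow> nat \<Rightarrow> real) \<Rightarrow> (nat \<Rightarrow> real) set" where
  "K_N n N X = {y \<in> PiE {..<n} (\<lambda>_. UNIV). \<exists>c :: nat \<Rightarrow> real.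
      (\<forall>j<N. c j \<ge> 0) \<and> (\<Sum>j<N. c j) = 1 \<and> (\<forall>i<n. y i = (\<Sum>j<N. c j * X j i))}"

definition expected_hull_measure :: "real measure \<Rightarrow> nat \<Rightarrow> nat \<Rightarrow> real" where
  "expected_hull_measure \<mu> n N =
     (\<integral>X. measure (mu_n \<mu> n) (K_N n N X) \<partial>(PiM {..<N} (\<lambda>_. mu_n \<mu> n)))"

definition rho2 :: "real measure \<Rightarrow> nat \<Rightarrow> real \<Rightarrow> ereal" where
  "rho2 \<mu> n \<delta> = Inf {ereal r | r. \<forall>N. n < N \<and> real N \<ge> exp (r * real n) \<longrightarrow>
                                    expected_hull_measure \<mu> n N \<ge> 1 - \<delta>}"

end

theory Submission
  imports Defs "HOL-Real_Asymp.Real_Asymp"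
begin

text \<open>
  A point \<open>y\<close> outside the hull of \<open>N\<close> samples is strictly separated from it by the point of the hull
  closest to \<open>y\<close>, and by Caratheodory this point is already determined by \<open>n + 1\<close> of the samples.
  A union bound over these samples gives failure probability at most
  \<open>(N choose (n + 1)) * (1 - q) ^ (N - n - 1)\<close>, where \<open>q\<close> is the half-space depth of \<open>y\<close>.

  By the weak law of large numbers, most \<open>y\<close> have \<open>\<Sum>i<n. \<Lambda>*(y i)\<close> at most about \<open>n * E \<Lambda>*\<close>, so
  it suffices to bound the depth below by \<open>exp (- (1 + \<eta>) * (\<Sum>i<n. \<Lambda>*(y i)) - \<eta> * n)\<close>. Change the
  measure coordinatewise: where \<open>\<bar>y i\<bar>\<close> is close to the end of the support, condition on exceeding
  \<open>\<bar>y i\<bar>\<close>, at a cost given by the \<open>\<Lambda>*\<close>-condition; elsewhere truncate and tilt exponentially to mean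
  \<open>\<bar>y i\<bar>\<close>. Under the new product measure the half-space has probability bounded below by a constant
  (a fourth moment argument, uniform in the half-space), and the density is controlled by Chebyshev.
\<close>

subsection \<open>Weights of minimal norm\<close>

text \<open>The bound on \<open>n\<close> must depend neither on \<open>y\<close> nor on the
  direction \<open>u\<close> nor on \<open>N\<close>, and this uniformity shapes every step.
  Directions form a continuum, so no union bound over half-spaces is possible. The union runs over
  index sets instead: once the samples of the set are fixed, so is the separating half-space, and
  the other samples are independent of it. The coefficients \<open>u i\<close> are arbitrary and one
  of them may dominate, so a normal approximation of \<open>\<Sum>i<n. u i * (x i - y i)\<close> is
  out of reach. A bound \<open>K\<close> on the ratio of the fourth moment to the squared second
  moment is invariant under scaling and passes to independent centred sums, hence survives every
  choice of \<open>u\<close>. Exponential tilting has uniform constants only for means in a compact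
  interval \<open>{0..x0}\<close> inside the support, which is why conditioning on the tail takes
  over beyond \<open>x0\<close>. Since \<open>u i * (x i - y i)\<close> is at least
  \<open>\<bar>u i\<bar> * (\<sigma> * x i - \<bar>y i\<bar>)\<close> with \<open>\<sigma>\<close>
  the sign of \<open>u i\<close>, only \<open>\<bar>y i\<bar>\<close> matters, and evenness reduces
  \<open>\<sigma> = - 1\<close> to \<open>\<sigma> = 1\<close>.\<close>

lemma homogeneous_system_nontrivial_solution:
  fixes a :: "nat \<Rightarrow> 'j \<Rightarrow> real"
  assumes "finite J" "m < card J"
  shows "\<exists>d. (\<exists>j\<in>J. d j \<noteq> 0) \<and> (\<forall>i<m. (\<Sum>j\<in>J. a i j * d j) = 0)"
  using assms
proof (induction m arbitrary: J a)
  case 0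
  then show ?case by (intro exI[of _ "\<lambda>_. 1"]) (auto simp: card_gt_0_iff)
next
  case (Suc m)
  show ?case
  proof (cases "\<forall>j\<in>J. a m j = 0")
    case True
    from Suc.IH[OF Suc.prems(1), of a] Suc.prems(2) obtain d where
      d: "\<exists>j\<in>J. d j \<noteq> 0" "\<forall>i<m. (\<Sum>j\<in>J. a i j * d j) = 0" by auto
    show ?thesis using d True by (intro exI[of _ d]) (auto simp: less_Suc_eq)
  next
    case False
    then obtain k where k: "k \<in> J" "a m k \<noteq> 0" by blast
    \<comment> \<open>Gaussian elimination: equation \<open>m\<close> is solved for the unknown
      \<open>k\<close> and substituted into the others.\<close>
    let ?b = "\<lambda>i j. a i j - a i k * a m j / a m k"
    have "m < card (J - {k})" using Suc.prems k by simp
    from Suc.IH[of "J - {k}" ?b, OF _ this] Suc.prems(1) obtain d where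
      d: "\<exists>j\<in>J-{k}. d j \<noteq> 0" "\<forall>i<m. (\<Sum>j\<in>J-{k}. ?b i j * d j) = 0" by auto
    define s where "s = (\<Sum>j\<in>J-{k}. a m j * d j)"
    define e where "e j = (if j = k then - s / a m k else d j)" for j
    have split: "(\<Sum>j\<in>J. a i j * e j) = - a i k * s / a m k + (\<Sum>j\<in>J-{k}. a i j * d j)" for i
      using Suc.prems(1) k by (subst sum.remove[of _ k]) (auto simp: e_def intro!: sum.cong)
    have "(\<Sum>j\<in>J-{k}. ?b i j * d j) = (\<Sum>j\<in>J-{k}. a i j * d j) - a i k * s / a m k" for i
      by (simp add: s_def left_diff_distrib sum_subtractf sum_distrib_left sum_divide_distrib mult.assoc)
    then have "(\<Sum>j\<in>J. a i j * e j) = 0" if "i < m" for i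
      using d(2) that split[of i] by simp
    moreover have "(\<Sum>j\<in>J. a m j * e j) = 0" using split[of m] k by (simp add: s_def)
    moreover have "\<exists>j\<in>J. e j \<noteq> 0" using d(1) by (auto simp: e_def)
    ultimately show ?thesis by (intro exI[of _ e]) (auto simp: less_Suc_eq)
  qed
qed

text \<open>Weights are total functions that vanish off \<open>I\<close>. Simplices over different
  index sets then live in one type, and the one over a subset is a face of the one over the larger
  set.\<close>

definition simplex_on :: "'j set \<Rightarrow> ('j \<Rightarrow> real) set" where
  "simplex_on I = {c. (\<forall>j. 0 \<le> c j) \<and> (\<forall>j. j \<notin> I \<longrightarrow> c j = 0) \<and> sum c I = 1}"

definition comb_sq :: "nat \<Rightarrow> 'j set \<Rightarrow> ('j \<Rightarrow> nat \<Rightarrow> real) \<Rightarrow> ('j \<Rightarrow> real) \<Rightarrow> real" where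
  "comb_sq n I Z c = (\<Sum>i<n. (\<Sum>j\<in>I. c j * Z j i)\<^sup>2)"

text \<open>The squared distance from the origin to the convex hull of the points
  \<open>Z j\<close>, \<open>j \<in> I\<close>, in the first \<open>n\<close> coordinates. It is
  used with \<open>Z j i = X j i - y i\<close>, which makes it the squared distance from
  \<open>y\<close> to the hull of the samples.\<close>

definition hull_sq :: "nat \<Rightarrow> 'j set \<Rightarrow> ('j \<Rightarrow> nat \<Rightarrow> real) \<Rightarrow> real" where
  "hull_sq n I Z = (INF c\<in>simplex_on I. comb_sq n I Z c)"

lemma comb_sq_nonneg: "0 \<le> comb_sq n I Z c"
  by (auto simp: comb_sq_def intro!: sum_nonneg)

text \<open>The index type may be infinite, so compactness comes from Tychonoff: a product of
  intervals, degenerate off \<open>I\<close>, is cut by the closed condition on the sum.\<close>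

lemma compact_simplex_on:
  assumes "finite I" shows "compact (simplex_on I)"
proof -
  let ?P = "PiE UNIV (\<lambda>j. if j \<in> I then {0..1::real} else {0})"
  have "compactin (product_topology (\<lambda>_. euclidean) UNIV) ?P"
    by (subst compactin_PiE) auto
  then have P: "compact ?P"
    by (simp add: euclidean_product_topology[symmetric] flip: compactin_euclidean_iff)
  have cl: "closed {c::'a \<Rightarrow> real. sum c I = 1}"
    by (intro closed_Collect_eq continuous_intros continuous_on_product_coordinates)
  have "simplex_on I = ?P \<inter> {c. sum c I = 1}"
  proof (intro equalityI subsetI)
    fix c assume c: "c \<in> simplex_on I"
    then have "c j \<le> 1" if "j \<in> I" for j
      using member_le_sum[OF that, of c] assms by (auto simp: simplex_on_def)
    then show "c \<in> ?P \<inter> {c. sum c I = 1}" using c by (auto simp: simplex_on_def PiE_iff)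
  next
    fix c assume "c \<in> ?P \<inter> {c. sum c I = 1}"
    then have c: "\<forall>j. c j \<in> (if j \<in> I then {0..1::real} else {0})" "sum c I = 1"
      by (auto simp: PiE_iff)
    then have "0 \<le> c j" "j \<notin> I \<longrightarrow> c j = 0" for j
      using spec[OF c(1), of j] by (auto split: if_splits)
    then show "c \<in> simplex_on I" using c(2) by (auto simp: simplex_on_def)
  qed
  then show ?thesis using compact_Int_closed[OF P cl] by simp
qed

lemma vertex_in_simplex_on:
  assumes "finite I" "k \<in> I" shows "(\<lambda>j. if j = k then 1 else 0) \<in> simplex_on I"
  using assms by (auto simp: simplex_on_def)

lemma hull_sq_le: "c \<in> simplex_on I \<Longrightarrow> hull_sq n I Z \<le> comb_sq n I Z c"
  unfolding hull_sq_def by (intro cINF_lower bdd_belowI2[of _ 0] comb_sq_nonneg)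

lemma continuous_comb_sq: "continuous_on UNIV (comb_sq n I Z)"
  unfolding comb_sq_def
  by (intro continuous_intros continuous_on_product_coordinates)

lemma hull_sq_attained:
  assumes "finite I" "I \<noteq> {}"
  obtains c where "c \<in> simplex_on I" "comb_sq n I Z c = hull_sq n I Z"
proof -
  obtain k where "k \<in> I" using assms(2) by blast
  then have ne: "simplex_on I \<noteq> {}" using vertex_in_simplex_on[OF assms(1)] by force
  obtain c where c: "c \<in> simplex_on I" "\<forall>d\<in>simplex_on I. comb_sq n I Z c \<le> comb_sq n I Z d"
    using continuous_attains_inf[OF compact_simplex_on[OF assms(1)] ne
      continuous_on_subset[OF continuous_comb_sq[of n I Z] subset_UNIV]] by auto
  then have "comb_sq n I Z c \<le> hull_sq n I Z"
    unfolding hull_sq_def using ne by (intro cINF_greatest) auto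
  with hull_sq_le[OF c(1), of n Z] have "comb_sq n I Z c = hull_sq n I Z" by simp
  with c(1) show thesis by (rule that)
qed

lemma comb_sq_mono_support:
  assumes "finite I" "J \<subseteq> I" "c \<in> simplex_on J"
  shows "c \<in> simplex_on I" "comb_sq n I Z c = comb_sq n J Z c"
proof -
  have z: "c j = 0" if "j \<in> I - J" for j using assms that by (auto simp: simplex_on_def)
  have "sum c J = sum c I" using assms z by (intro sum.mono_neutral_left) auto
  then show "c \<in> simplex_on I" using assms by (auto simp: simplex_on_def)
  have "(\<Sum>j\<in>J. c j * Z j i) = (\<Sum>j\<in>I. c j * Z j i)" for i
    using assms z by (intro sum.mono_neutral_left) auto
  then show "comb_sq n I Z c = comb_sq n J Z c" by (simp add: comb_sq_def)
qed

text \<open>Moving weights along a nontrivial affine dependence does not change the point and reaches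
  the boundary of the simplex.\<close>
lemma caratheodory_weights:
  fixes Z :: "'j \<Rightarrow> nat \<Rightarrow> real"
  assumes "finite I" "c \<in> simplex_on I"
  shows "\<exists>J d. J \<subseteq> I \<and> card J \<le> Suc n \<and> d \<in> simplex_on J \<and>
    (\<forall>i<n. (\<Sum>j\<in>J. d j * Z j i) = (\<Sum>j\<in>I. c j * Z j i))"
  using assms
proof (induction "card I" arbitrary: I c rule: less_induct)
  case less
  show ?case
  proof (cases "card I \<le> Suc n")
    case True then show ?thesis using less by blast
  next
    case False
    \<comment> \<open>Rows \<open>i < n\<close> keep the point fixed and the extra row of ones keeps
      the total weight fixed, hence the threshold \<open>Suc n\<close>.\<close>
    from homogeneous_system_nontrivial_solution[of I "Suc n" "\<lambda>i j. if i < n then Z j i else 1"]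
      False less(2) obtain d0 where
      d0: "\<exists>j\<in>I. d0 j \<noteq> 0"
        "\<forall>i<Suc n. (\<Sum>j\<in>I. (if i < n then Z j i else 1) * d0 j) = 0" by auto
    have d0s: "sum d0 I = 0" using d0(2)[rule_format, of n] by simp
    have d0z: "(\<Sum>j\<in>I. d0 j * Z j i) = 0" if "i < n" for i
      using d0(2)[rule_format, of i] that by (simp add: mult.commute)
    have "\<exists>j\<in>I. 0 < d0 j"
    proof (rule ccontr)
      assume "\<not> ?thesis"
      then have neg: "\<And>j. j \<in> I \<Longrightarrow> 0 \<le> - d0 j" by force
      have "(\<Sum>j\<in>I. - d0 j) = 0" using d0s by (simp add: sum_negf)
      then have "\<forall>j\<in>I. - d0 j = 0" using sum_nonneg_eq_0_iff[OF less(2), of "\<lambda>j. - d0 j"] neg by blast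
      then show False using d0(1) by auto
    qed
    then have ne: "(\<lambda>j. c j / d0 j) ` {j\<in>I. 0 < d0 j} \<noteq> {}" by auto
    \<comment> \<open>The largest step along \<open>- d0\<close> that keeps all weights nonnegative;
      the weight of the minimising index \<open>k\<close> drops to 0.\<close>
    define s where "s = Min ((\<lambda>j. c j / d0 j) ` {j\<in>I. 0 < d0 j})"
    have "s \<in> (\<lambda>j. c j / d0 j) ` {j\<in>I. 0 < d0 j}"
      unfolding s_def using ne less(2) by (intro Min_in) auto
    then obtain k where k: "k \<in> I" "0 < d0 k" "s = c k / d0 k" by auto
    have smin: "s \<le> c j / d0 j" if "j \<in> I" "0 < d0 j" for j
      unfolding s_def using that less(2) by (intro Min_le) auto
    have c: "\<And>j. 0 \<le> c j" "\<And>j. j \<notin> I \<Longrightarrow> c j = 0" "sum c I = 1"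
      using less(3) by (auto simp: simplex_on_def)
    have s0: "0 \<le> s" using k c by simp
    define e where "e j = (if j \<in> I then c j - s * d0 j else 0)" for j
    have ek: "e k = 0" using k by (simp add: e_def)
    have e0: "0 \<le> e j" for j
    proof (cases "j \<in> I \<and> 0 < d0 j")
      case True
      then show ?thesis using smin[of j] by (simp add: e_def field_simps)
    next
      case False
      then show ?thesis using s0 c(1)[of j] mult_nonneg_nonpos[of s "d0 j"] by (auto simp: e_def)
    qed
    have es: "sum e I = 1"
      using c(3) d0s by (simp add: e_def sum_subtractf flip: sum_distrib_left)
    have eZ: "(\<Sum>j\<in>I. e j * Z j i) = (\<Sum>j\<in>I. c j * Z j i)" if "i < n" for i
      using d0z[OF that]
      by (simp add: e_def left_diff_distrib sum_subtractf mult.assoc flip: sum_distrib_left)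
    have "e \<in> simplex_on (I - {k})"
      using e0 ek es less(2) k(1) by (auto simp: simplex_on_def e_def sum.remove[of I k])
    moreover have "card (I - {k}) < card I" using less(2) k(1) by (rule card_Diff1_less)
    ultimately obtain J d where J: "J \<subseteq> I - {k}" "card J \<le> Suc n" "d \<in> simplex_on J"
      "\<forall>i<n. (\<Sum>j\<in>J. d j * Z j i) = (\<Sum>j\<in>I-{k}. e j * Z j i)"
      using less(1)[of "I - {k}" e] less(2) by blast
    have "(\<Sum>j\<in>I-{k}. e j * Z j i) = (\<Sum>j\<in>I. e j * Z j i)" for i
      using less(2) k(1) ek by (simp add: sum.remove[of I k])
    then show ?thesis using J eZ by (intro exI[of _ J] exI[of _ d]) auto
  qed
qed

text \<open>Caratheodory applied to a closest point. The support is padded to exactly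
  \<open>n + 1\<close> indices so that the union bound runs over the subsets of one
  cardinality.\<close>

lemma hull_sq_small_support:
  fixes Z :: "'j \<Rightarrow> nat \<Rightarrow> real"
  assumes "finite I" "n < card I"
  shows "\<exists>J\<subseteq>I. card J = Suc n \<and> hull_sq n J Z = hull_sq n I Z"
proof -
  have "I \<noteq> {}" using assms by auto
  obtain c where c: "c \<in> simplex_on I" "comb_sq n I Z c = hull_sq n I Z"
    using hull_sq_attained[OF assms(1) \<open>I \<noteq> {}\<close>] .
  obtain J0 d where J0: "J0 \<subseteq> I" "card J0 \<le> Suc n" "d \<in> simplex_on J0"
    "\<forall>i<n. (\<Sum>j\<in>J0. d j * Z j i) = (\<Sum>j\<in>I. c j * Z j i)"
    using caratheodory_weights[OF assms(1) c(1)] by blast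
  obtain J where J: "J0 \<subseteq> J" "J \<subseteq> I" "card J = Suc n"
    using exists_subset_between[of J0 "Suc n" I] J0 assms by auto
  have fJ: "finite J" using J assms finite_subset by blast
  have dJ: "d \<in> simplex_on J" "comb_sq n J Z d = comb_sq n J0 Z d"
    using comb_sq_mono_support[OF fJ J(1) J0(3)] by blast+
  have "comb_sq n J0 Z d = comb_sq n I Z c" using J0(4) by (auto simp: comb_sq_def)
  then have "hull_sq n J Z \<le> hull_sq n I Z" using hull_sq_le[OF dJ(1), of n Z] dJ(2) c(2) by simp
  moreover have "hull_sq n I Z \<le> hull_sq n J Z"
  proof -
    have "J \<noteq> {}" using J by auto
    then obtain e where e: "e \<in> simplex_on J" "comb_sq n J Z e = hull_sq n J Z"
      using hull_sq_attained[OF fJ] by blast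
    then show ?thesis
      using comb_sq_mono_support[OF assms(1) J(2) e(1)] hull_sq_le by metis
  qed
  ultimately have "hull_sq n J Z = hull_sq n I Z" by simp
  then show ?thesis using J by blast
qed

text \<open>For small \<open>s\<close> the linear term decides the sign: if \<open>A < 0\<close>,
  the chosen \<open>s\<close> keeps \<open>s * B\<close> at most \<open>- A\<close>, and the whole
  expression is negative.\<close>

lemma nonneg_linear_if_quadratic_nonneg:
  fixes A B :: real
  assumes "\<And>s. 0 < s \<Longrightarrow> s \<le> 1 \<Longrightarrow> 0 \<le> 2 * s * A + s\<^sup>2 * B"
  shows "0 \<le> A"
proof (rule ccontr)
  assume "\<not> 0 \<le> A"
  then have A: "A < 0" by simp
  define s where "s = min 1 (- A / (\<bar>B\<bar> + 1))"
  have s: "0 < s" "s \<le> 1" "s \<le> - A / (\<bar>B\<bar> + 1)" using A by (auto simp: s_def divide_neg_pos)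
  have "s * B \<le> s * (\<bar>B\<bar> + 1)" using s by (intro mult_left_mono) auto
  also have "\<dots> \<le> - A" using s(3) by (simp add: field_simps)
  finally have "s * (2 * A + s * B) < 0" using s A by (intro mult_pos_neg) auto
  moreover have "0 \<le> s * (2 * A + s * B)"
    using assms[of s] s by (simp add: algebra_simps power2_eq_square)
  ultimately show False by simp
qed

text \<open>Moving from the closest point \<open>p\<close> towards \<open>Z k\<close> stays in the
  hull and cannot shorten the vector; the first-order term gives
  \<open>\<Sum>i<n. p i * (Z k i - p i) \<ge> 0\<close>. If the distance is positive, all points
  therefore lie in the open half-space given by \<open>p\<close>.\<close>

lemma min_norm_point_supports:
  fixes Z :: "'j \<Rightarrow> nat \<Rightarrow> real"
  assumes "finite I" "c \<in> simplex_on I" "comb_sq n I Z c = hull_sq n I Z" "k \<in> I"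
  shows "hull_sq n I Z \<le> (\<Sum>i<n. (\<Sum>j\<in>I. c j * Z j i) * Z k i)"
proof -
  define p where "p i = (\<Sum>j\<in>I. c j * Z j i)" for i
  define A where "A = (\<Sum>i<n. p i * (Z k i - p i))"
  define B where "B = (\<Sum>i<n. (Z k i - p i)\<^sup>2)"
  have pp: "hull_sq n I Z = (\<Sum>i<n. (p i)\<^sup>2)" using assms(3) by (simp add: comb_sq_def p_def)
  have "0 \<le> 2 * s * A + s\<^sup>2 * B" if s: "0 < s" "s \<le> 1" for s
  proof -
    define e where "e j = (1 - s) * c j + s * (if j = k then 1 else 0)" for j
    have "sum e I = (1 - s) * sum c I + s * (\<Sum>j\<in>I. if j = k then 1 else 0)"
      by (simp add: e_def sum.distrib sum_distrib_left)
    also have "\<dots> = 1" using assms by (simp add: simplex_on_def)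
    finally have "e \<in> simplex_on I"
      using assms s by (auto simp: simplex_on_def e_def)
    then have "hull_sq n I Z \<le> comb_sq n I Z e" by (rule hull_sq_le)
    also have "(\<Sum>j\<in>I. e j * Z j i) = p i + s * (Z k i - p i)" for i
    proof -
      have "(\<Sum>j\<in>I. e j * Z j i) = (1 - s) * p i + s * (\<Sum>j\<in>I. (if j = k then 1 else 0) * Z j i)"
        by (simp add: e_def p_def distrib_right sum.distrib sum_distrib_left mult.assoc)
      also have "(\<Sum>j\<in>I. (if j = k then 1 else 0) * Z j i) = (\<Sum>j\<in>I. if j = k then Z j i else 0)"
        by (intro sum.cong) auto
      also have "\<dots> = Z k i" using assms by simp
      finally show ?thesis by (simp add: algebra_simps)
    qed
    then have "comb_sq n I Z e = (\<Sum>i<n. (p i + s * (Z k i - p i))\<^sup>2)" by (simp add: comb_sq_def)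
    also have "\<dots> = (\<Sum>i<n. (p i)\<^sup>2 + (2 * s * (p i * (Z k i - p i)) + s\<^sup>2 * (Z k i - p i)\<^sup>2))"
      by (intro sum.cong) (auto simp: power2_eq_square algebra_simps)
    also have "\<dots> = hull_sq n I Z + (2 * s * A + s\<^sup>2 * B)"
      by (simp add: sum.distrib pp A_def B_def sum_distrib_left)
    finally show ?thesis by simp
  qed
  then have "0 \<le> A" by (rule nonneg_linear_if_quadratic_nonneg)
  also have "A = (\<Sum>i<n. p i * Z k i) - hull_sq n I Z"
    by (simp add: A_def pp right_diff_distrib sum_subtractf power2_eq_square)
  finally show ?thesis by (simp add: p_def)
qed

text \<open>Membership in the hull becomes an equation for a real function, which is what
  measurability needs. From right to left the infimum has to be attained.\<close>

lemma K_N_iff_hull_sq: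
  assumes "y \<in> PiE {..<n} (\<lambda>_. UNIV)" "0 < N"
  shows "y \<in> K_N n N X \<longleftrightarrow> hull_sq n {..<N} (\<lambda>j i. X j i - y i) = 0"
proof -
  have ident: "(\<Sum>j<N. c j * (X j i - y i)) = (\<Sum>j<N. c j * X j i) - y i"
    if "(\<Sum>j<N. c j) = 1" for c i
    using that by (simp add: right_diff_distrib sum_subtractf flip: sum_distrib_right)
  show ?thesis
  proof
    assume "y \<in> K_N n N X"
    then obtain c where c: "\<forall>j<N. c j \<ge> 0" "(\<Sum>j<N. c j) = 1" "\<forall>i<n. y i = (\<Sum>j<N. c j * X j i)"
      unfolding K_N_def by blast
    define d where "d j = (if j < N then c j else 0)" for j
    have d: "d \<in> simplex_on {..<N}" using c by (auto simp: simplex_on_def d_def)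
    have "(\<Sum>j<N. d j * (X j i - y i)) = 0" if "i < n" for i
      using ident[OF c(2), of i] c(3) that by (simp add: d_def)
    then have "comb_sq n {..<N} (\<lambda>j i. X j i - y i) d = 0" by (simp add: comb_sq_def)
    then have "hull_sq n {..<N} (\<lambda>j i. X j i - y i) \<le> 0" using hull_sq_le[OF d] by metis
    moreover have "0 \<le> hull_sq n {..<N} (\<lambda>j i. X j i - y i)"
      unfolding hull_sq_def using d by (intro cINF_greatest comb_sq_nonneg) auto
    ultimately show "hull_sq n {..<N} (\<lambda>j i. X j i - y i) = 0" by simp
  next
    assume h: "hull_sq n {..<N} (\<lambda>j i. X j i - y i) = 0"
    have "{..<N} \<noteq> {}" using assms by (simp add: lessThan_empty_iff)
    then obtain c where c: "c \<in> simplex_on {..<N}" "comb_sq n {..<N} (\<lambda>j i. X j i - y i) c = 0"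
      using hull_sq_attained[of "{..<N}" n "\<lambda>j i. X j i - y i"] h by auto
    have c1: "(\<Sum>j<N. c j) = 1" using c by (simp add: simplex_on_def)
    have "(\<Sum>j<N. c j * (X j i - y i)) = 0" if "i < n" for i
      using c(2) that unfolding comb_sq_def by (subst (asm) sum_nonneg_eq_0_iff) auto
    then have "\<forall>i<n. y i = (\<Sum>j<N. c j * X j i)" using ident[OF c1] by simp
    then show "y \<in> K_N n N X" using assms c c1 by (auto simp: K_N_def simplex_on_def)
  qed
qed

subsection \<open>Random hulls\<close>

lemma hull_sq_cong:
  assumes "\<And>j i. j \<in> I \<Longrightarrow> i < n \<Longrightarrow> Z j i = Z' j i"
  shows "hull_sq n I Z = hull_sq n I Z'"
  unfolding hull_sq_def comb_sq_def using assms
  by (intro INF_cong refl sum.cong arg_cong[where f = "\<lambda>x. x\<^sup>2"]) auto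

text \<open>The weights are not normalised: dividing by the sum only when they are used avoids
  approximation by rational points inside the hyperplane of total weight one. The extensional
  function space keeps the set countable.\<close>

definition rational_weights :: "'j set \<Rightarrow> ('j \<Rightarrow> real) set" where
  "rational_weights I = {q \<in> PiE I (\<lambda>_. \<rat>). (\<forall>j\<in>I. 0 \<le> q j) \<and> 0 < sum q I}"

lemma countable_rational_weights: "finite I \<Longrightarrow> countable (rational_weights I)"
  unfolding rational_weights_def
  by (rule countable_subset[of _ "PiE I (\<lambda>_. \<rat>)"]) (auto intro!: countable_PiE countable_rat)

text \<open>By continuity, rational weights come arbitrarily close to the optimal ones. A countable
  infimum of measurable functions is measurable, an uncountable one need not be.\<close>

lemma hull_sq_eq_countable_INF:
  fixes Z :: "'j \<Rightarrow> nat \<Rightarrow> real"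
  assumes "finite I" "I \<noteq> {}"
  shows "hull_sq n I Z = (INF q\<in>rational_weights I. comb_sq n I Z (\<lambda>j. q j / sum q I))"
proof (rule antisym)
  have "(\<lambda>j\<in>I. 1) \<in> rational_weights I"
    using assms by (auto simp: rational_weights_def card_gt_0_iff)
  then have ne: "rational_weights I \<noteq> {}" by blast
  show "hull_sq n I Z \<le> (INF q\<in>rational_weights I. comb_sq n I Z (\<lambda>j. q j / sum q I))"
  proof (rule cINF_greatest[OF ne])
    fix q assume q: "q \<in> rational_weights I"
    let ?c = "\<lambda>j. if j \<in> I then q j / sum q I else 0"
    have "?c \<in> simplex_on I"
      using q by (auto simp: simplex_on_def rational_weights_def simp flip: sum_divide_distrib)
    then have "hull_sq n I Z \<le> comb_sq n I Z ?c" by (rule hull_sq_le)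
    then show "hull_sq n I Z \<le> comb_sq n I Z (\<lambda>j. q j / sum q I)" by (simp add: comb_sq_def)
  qed
  obtain c where c: "c \<in> simplex_on I" "comb_sq n I Z c = hull_sq n I Z"
    using hull_sq_attained[OF assms] .
  \<comment> \<open>Approximation strictly from above makes the rational weights positive even where
    \<open>c j = 0\<close>, so their sum never vanishes.\<close>
  have "\<exists>r\<in>\<rat>. c j < r \<and> r < c j + 1 / real (Suc k)" for j k
    by (rule Rats_dense_in_real) simp
  then obtain r where r: "\<And>j k. r j k \<in> \<rat>" "\<And>j k. c j < r j k" "\<And>j k. r j k < c j + 1 / real (Suc k)"
    by metis
  have lim: "(\<lambda>k. r j k) \<longlonglongrightarrow> c j" for j
  proof (rule tendsto_sandwich[of "\<lambda>_. c j" _ _ "\<lambda>k. c j + 1 / real (Suc k)"])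
    show "(\<lambda>k. c j + 1 / real (Suc k)) \<longlonglongrightarrow> c j"
      using tendsto_add[OF tendsto_const[of "c j"] LIMSEQ_inverse_real_of_nat] by (simp add: field_simps)
  qed (auto simp del: of_nat_Suc intro!: always_eventually less_imp_le r)
  have rpos: "0 < r j k" for j k using r(2)[of j k] c(1) by (auto simp: simplex_on_def intro: le_less_trans)
  have rw: "(\<lambda>j\<in>I. r j k) \<in> rational_weights I" for k
    using r(1) less_imp_le[OF rpos] sum_pos[of I "\<lambda>j. r j k"] rpos assms
    by (auto simp: rational_weights_def)
  have "(\<lambda>k. comb_sq n I Z (\<lambda>j. r j k / (\<Sum>j\<in>I. r j k))) \<longlonglongrightarrow> comb_sq n I Z (\<lambda>j. c j / sum c I)"
    unfolding comb_sq_def using c(1)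
    by (intro tendsto_intros lim) (auto simp: simplex_on_def)
  also have "(\<lambda>j. c j / sum c I) = c" using c(1) by (auto simp: simplex_on_def)
  finally have lim2: "(\<lambda>k. comb_sq n I Z (\<lambda>j. r j k / (\<Sum>j\<in>I. r j k))) \<longlonglongrightarrow> hull_sq n I Z"
    using c(2) by simp
  have "(INF q\<in>rational_weights I. comb_sq n I Z (\<lambda>j. q j / sum q I))
      \<le> comb_sq n I Z (\<lambda>j. r j k / (\<Sum>j\<in>I. r j k))" for k
  proof -
    have "(INF q\<in>rational_weights I. comb_sq n I Z (\<lambda>j. q j / sum q I))
      \<le> comb_sq n I Z (\<lambda>j. (\<lambda>j\<in>I. r j k) j / sum (\<lambda>j\<in>I. r j k) I)"
      by (rule cINF_lower[OF _ rw]) (auto intro!: bdd_belowI2[of _ 0] comb_sq_nonneg)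
    then show ?thesis by (simp add: comb_sq_def)
  qed
  then show "(INF q\<in>rational_weights I. comb_sq n I Z (\<lambda>j. q j / sum q I)) \<le> hull_sq n I Z"
    using LIMSEQ_le_const[OF lim2] by blast
qed

lemma borel_measurable_hull_sq:
  fixes Z :: "'a \<Rightarrow> 'j \<Rightarrow> nat \<Rightarrow> real"
  assumes "finite I" "I \<noteq> {}"
    and [measurable]: "\<And>j i. j \<in> I \<Longrightarrow> i < n \<Longrightarrow> (\<lambda>\<omega>. Z \<omega> j i) \<in> borel_measurable M"
  shows "(\<lambda>\<omega>. hull_sq n I (Z \<omega>)) \<in> borel_measurable M"
  unfolding hull_sq_eq_countable_INF[OF assms(1,2)]
proof (rule borel_measurable_cINF)
  show "countable (rational_weights I)" by (rule countable_rational_weights[OF assms(1)])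
  show "(\<lambda>\<omega>. comb_sq n I (Z \<omega>) (\<lambda>j. q j / sum q I)) \<in> borel_measurable M" for q :: "'j \<Rightarrow> real"
    unfolding comb_sq_def by measurable
qed (auto intro!: bdd_belowI2[of _ 0] comb_sq_nonneg)

lemma sets_Collect_eq_and_pos:
  fixes f g :: "'a \<Rightarrow> real"
  assumes [measurable]: "f \<in> borel_measurable M" "g \<in> borel_measurable M"
  shows "{x\<in>space M. f x = g x \<and> 0 < g x} \<in> sets M"
  by measurable

text \<open>Fixing the samples in \<open>I\<close> fixes the closest point \<open>p\<close>, hence
  an open half-space \<open>H\<close> whose complement is a closed half-space with \<open>y\<close>
  on its boundary. On the event every other sample must fall into \<open>H\<close>, independently
  and each with probability at most \<open>1 - q\<close>.\<close>

lemma emeasure_min_norm_point_from_subset_le: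
  fixes P :: "(nat \<Rightarrow> real) measure"
  assumes P: "prob_space P" and [measurable]: "\<And>i. i < n \<Longrightarrow> (\<lambda>x. x i) \<in> borel_measurable P"
    and I: "I \<subseteq> {..<N}" "I \<noteq> {}"
    and q: "\<And>u. q \<le> measure P {x\<in>space P. (\<Sum>i<n. u i * (x i - y i)) \<le> 0}"
  shows "emeasure (PiM {..<N} (\<lambda>_. P)) {X\<in>space (PiM {..<N} (\<lambda>_. P)).
      hull_sq n I (\<lambda>j i. X j i - y i) = hull_sq n {..<N} (\<lambda>j i. X j i - y i) \<and>
      0 < hull_sq n {..<N} (\<lambda>j i. X j i - y i)} \<le> ennreal ((1 - q) ^ (N - card I))"
proof -
  interpret P: prob_space P by fact
  interpret pp: product_prob_space "\<lambda>_. P" "{..<N}" by standard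
  define J where "J = {..<N} - I"
  have IJ: "I \<inter> J = {}" "I \<union> J = {..<N}" "finite I" "finite J" "card J = N - card I"
    using I finite_subset[OF I(1)] by (auto simp: J_def card_Diff_subset)
  have Nne: "{..<N} \<noteq> {}" using I by auto
  define E where "E = {X\<in>space (PiM {..<N} (\<lambda>_. P)).
      hull_sq n I (\<lambda>j i. X j i - y i) = hull_sq n {..<N} (\<lambda>j i. X j i - y i) \<and>
      0 < hull_sq n {..<N} (\<lambda>j i. X j i - y i)}"
  have coord: "(\<lambda>X. X j i - y i) \<in> borel_measurable (PiM {..<N} (\<lambda>_. P))" if "j < N" "i < n" for j i
  proof -
    have "(\<lambda>X. (\<lambda>x. x i) (X j)) \<in> borel_measurable (PiM {..<N} (\<lambda>_. P))"
      using that by (intro measurable_compose[OF measurable_component_singleton]) auto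
    then show ?thesis by measurable
  qed
  have m1: "(\<lambda>X. hull_sq n A (\<lambda>j i. X j i - y i)) \<in> borel_measurable (PiM {..<N} (\<lambda>_. P))"
    if "A \<subseteq> {..<N}" "A \<noteq> {}" for A
    using that by (intro borel_measurable_hull_sq coord) (auto intro: finite_subset)
  have E: "E \<in> sets (PiM (I \<union> J) (\<lambda>_. P))"
  proof -
    show ?thesis unfolding E_def IJ(2)
      by (rule sets_Collect_eq_and_pos[OF m1[OF I] m1[OF subset_refl Nne]])
  qed
  have slice: "emeasure (PiM J (\<lambda>_. P)) ((\<lambda>w. merge I J (x, w)) -` E \<inter> space (PiM J (\<lambda>_. P)))
      \<le> ennreal ((1 - q) ^ card J)" for x
  proof -
    define Zx where "Zx = (\<lambda>j i. x j i - y i)"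
    \<comment> \<open>The weights are chosen after \<open>x\<close> is fixed and used on this slice
      only, so no measurable selection is needed.\<close>
    obtain c where c: "c \<in> simplex_on I" "comb_sq n I Zx c = hull_sq n I Zx"
      using hull_sq_attained[OF IJ(3) I(2)] .
    define p where "p i = (\<Sum>j\<in>I. c j * Zx j i)" for i
    define H where "H = {v\<in>space P. 0 < (\<Sum>i<n. p i * (v i - y i))}"
    have H: "H \<in> sets P" unfolding H_def by measurable
    have "(\<lambda>w. merge I J (x, w)) -` E \<inter> space (PiM J (\<lambda>_. P)) \<subseteq> PiE J (\<lambda>_. H)"
    proof
      fix w assume w: "w \<in> (\<lambda>w. merge I J (x, w)) -` E \<inter> space (PiM J (\<lambda>_. P))"
      define Z where "Z = (\<lambda>j i. merge I J (x, w) j i - y i)"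
      have EZ: "hull_sq n I Z = hull_sq n {..<N} Z" "0 < hull_sq n {..<N} Z"
        using w by (auto simp: E_def Z_def)
      have ZI: "Z j i = Zx j i" if "j \<in> I" for j i
        using that by (simp add: Z_def Zx_def merge_def)
      have ZJ: "Z j i = w j i - y i" if "j \<in> J" for j i
        using that IJ(1) by (auto simp: Z_def merge_def)
      have "comb_sq n I Z c = comb_sq n I Zx c" by (simp add: comb_sq_def ZI)
      also have "\<dots> = hull_sq n {..<N} Z" using c(2) EZ(1) hull_sq_cong[of I n Z Zx] ZI by simp
      finally have cI: "comb_sq n I Z c = hull_sq n {..<N} Z" .
      have cN: "c \<in> simplex_on {..<N}" "comb_sq n {..<N} Z c = comb_sq n I Z c"
        using comb_sq_mono_support[OF finite_lessThan I(1) c(1)] by auto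
      have pe: "(\<Sum>j<N. c j * Z j i) = p i" for i
      proof -
        have "(\<Sum>j<N. c j * Z j i) = (\<Sum>j\<in>I. c j * Z j i)"
          using I c(1) by (intro sum.mono_neutral_right) (auto simp: simplex_on_def)
        then show ?thesis by (simp add: p_def ZI)
      qed
      have "w j \<in> H" if j: "j \<in> J" for j
      proof -
        have "j \<in> {..<N}" using j by (auto simp: J_def)
        from min_norm_point_supports[OF finite_lessThan cN(1) _ this, of n Z] cI cN(2) EZ(2)
        have "0 < (\<Sum>i<n. p i * Z j i)" by (simp add: pe)
        moreover have "w j \<in> space P" using w j by (auto simp: space_PiM)
        ultimately show ?thesis using ZJ[OF j] by (simp add: H_def)
      qed
      then show "w \<in> PiE J (\<lambda>_. H)" using w by (auto simp: space_PiM PiE_iff)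
    qed
    then have "emeasure (PiM J (\<lambda>_. P)) ((\<lambda>w. merge I J (x, w)) -` E \<inter> space (PiM J (\<lambda>_. P)))
      \<le> emeasure (PiM J (\<lambda>_. P)) (PiE J (\<lambda>_. H))"
      using H IJ(4) by (intro emeasure_mono sets_PiM_I_finite) auto
    also have "\<dots> = (\<Prod>j\<in>J. emeasure P H)" using H IJ(4) by (intro pp.emeasure_PiM) auto
    also have "\<dots> = ennreal (measure P H ^ card J)"
      by (simp add: P.emeasure_eq_measure ennreal_power)
    also have "\<dots> \<le> ennreal ((1 - q) ^ card J)"
    proof (intro ennreal_leI power_mono measure_nonneg)
      have Heq: "{v\<in>space P. \<not> (\<Sum>i<n. p i * (v i - y i)) \<le> 0} = H"
        by (auto simp: H_def)
      have m: "{v\<in>space P. (\<Sum>i<n. p i * (v i - y i)) \<le> 0} \<in> P.events" by measurable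
      have "measure P H = 1 - measure P {v\<in>space P. (\<Sum>i<n. p i * (v i - y i)) \<le> 0}"
        using P.prob_neg[OF m] Heq by simp
      then show "measure P H \<le> 1 - q" using q[of p] by simp
    qed
    finally show ?thesis .
  qed
  have "emeasure (PiM (I \<union> J) (\<lambda>_. P)) E = (\<integral>\<^sup>+x. emeasure (PiM J (\<lambda>_. P))
      ((\<lambda>w. merge I J (x, w)) -` E \<inter> space (PiM J (\<lambda>_. P))) \<partial>PiM I (\<lambda>_. P))"
    by (rule pp.emeasure_fold_integral[OF IJ(1,3,4) E])
  also have "\<dots> \<le> (\<integral>\<^sup>+x. ennreal ((1 - q) ^ card J) \<partial>PiM I (\<lambda>_. P))"
    by (intro nn_integral_mono slice)
  also have "\<dots> = ennreal ((1 - q) ^ card J)"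
  proof -
    interpret pi: prob_space "PiM I (\<lambda>_. P)" by (intro prob_space_PiM P)
    show ?thesis by (simp add: pi.emeasure_space_1)
  qed
  finally show ?thesis unfolding IJ(2,5) E_def .
qed

section \<open>Failure probability of a fixed point and the expected measure of the hull\<close>

lemma borel_measurable_mu_n_coord:
  assumes "sets \<mu> = sets borel" "i < n"
  shows "(\<lambda>x. x i) \<in> borel_measurable (mu_n \<mu> n)"
  unfolding mu_n_def using assms
  by (auto intro: measurable_compose[OF measurable_component_singleton] simp: measurable_ident_sets)

lemma space_mu_n: "sets \<mu> = sets borel \<Longrightarrow> space (mu_n \<mu> n) = PiE {..<n} (\<lambda>_. UNIV)"
  by (auto dest: sets_eq_imp_space_eq simp: mu_n_def space_PiM)

lemma prob_space_mu_n: "prob_space \<mu> \<Longrightarrow> prob_space (mu_n \<mu> n)"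
  unfolding mu_n_def by (intro prob_space_PiM)

lemma prob_notin_K_N_le:
  assumes \<mu>: "prob_space \<mu>" "sets \<mu> = sets borel" and "n < N" and y: "y \<in> space (mu_n \<mu> n)"
    and q: "\<And>u. q \<le> measure (mu_n \<mu> n) {x\<in>space (mu_n \<mu> n). (\<Sum>i<n. u i * (x i - y i)) \<le> 0}"
  shows "measure (PiM {..<N} (\<lambda>_. mu_n \<mu> n)) {X\<in>space (PiM {..<N} (\<lambda>_. mu_n \<mu> n)). y \<notin> K_N n N X}
    \<le> real (N choose Suc n) * (1 - q) ^ (N - Suc n)"
proof -
  let ?Q = "PiM {..<N} (\<lambda>_. mu_n \<mu> n)"
  let ?h = "\<lambda>I X. hull_sq n I (\<lambda>j i. X j i - y i)"
  interpret P: prob_space "mu_n \<mu> n" by (rule prob_space_mu_n[OF \<mu>(1)])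
  interpret Q: prob_space ?Q by (intro prob_space_PiM P.prob_space_axioms)
  have q1: "q \<le> 1" using q[of "\<lambda>_. 0"] by (meson P.prob_le_1 order_trans)
  define \<I> where "\<I> = {I. I \<subseteq> {..<N} \<and> card I = Suc n}"
  \<comment> \<open>Positivity belongs to the event: at distance 0 the closest point gives no
    half-space and leaves the other samples unconstrained.\<close>
  define E where "E I = {X\<in>space ?Q. ?h I X = ?h {..<N} X \<and> 0 < ?h {..<N} X}" for I
  have yP: "y \<in> PiE {..<n} (\<lambda>_. UNIV)" using y space_mu_n[OF \<mu>(2)] by simp
  have "{X\<in>space ?Q. y \<notin> K_N n N X} \<subseteq> (\<Union>I\<in>\<I>. E I)"
  proof
    fix X assume X: "X \<in> {X\<in>space ?Q. y \<notin> K_N n N X}"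
    then have "?h {..<N} X \<noteq> 0" using K_N_iff_hull_sq[OF yP] assms(3) by auto
    moreover have "0 \<le> ?h {..<N} X"
    proof -
      have "{..<N} \<noteq> {}" using assms(3) by (auto simp: lessThan_empty_iff)
      then obtain c where "comb_sq n {..<N} (\<lambda>j i. X j i - y i) c = ?h {..<N} X"
        using hull_sq_attained[OF finite_lessThan] by blast
      then show ?thesis using comb_sq_nonneg by metis
    qed
    moreover obtain I where "I \<subseteq> {..<N}" "card I = Suc n" "?h I X = ?h {..<N} X"
      using hull_sq_small_support[of "{..<N}" n "\<lambda>j i. X j i - y i"] assms(3) by auto
    ultimately show "X \<in> (\<Union>I\<in>\<I>. E I)" using X by (auto simp: \<I>_def E_def)
  qed
  moreover have fin: "finite \<I>" unfolding \<I>_def by (rule finite_subset[of _ "Pow {..<N}"]) auto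
  have coord: "(\<lambda>X. X j i - y i) \<in> borel_measurable ?Q" if "j < N" "i < n" for j i
  proof -
    have "(\<lambda>X. (\<lambda>x. x i) (X j)) \<in> borel_measurable ?Q"
      using that borel_measurable_mu_n_coord[OF \<mu>(2)]
      by (intro measurable_compose[OF measurable_component_singleton]) auto
    then show ?thesis by measurable
  qed
  have Em: "E I \<in> sets ?Q" if "I \<in> \<I>" for I
  proof -
    have I: "I \<subseteq> {..<N}" "I \<noteq> {}" using that by (auto simp: \<I>_def)
    have m: "?h A \<in> borel_measurable ?Q" if "A \<subseteq> {..<N}" "A \<noteq> {}" for A
      using that by (intro borel_measurable_hull_sq coord) (auto intro: finite_subset)
    have "{..<N} \<noteq> {}" using I by auto
    show ?thesis unfolding E_def
      by (rule sets_Collect_eq_and_pos[OF m[OF I] m[OF subset_refl \<open>{..<N} \<noteq> {}\<close>]])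
  qed
  ultimately have "measure ?Q {X\<in>space ?Q. y \<notin> K_N n N X} \<le> measure ?Q (\<Union>I\<in>\<I>. E I)"
    using fin by (intro Q.finite_measure_mono sets.finite_UN) auto
  also have "\<dots> \<le> (\<Sum>I\<in>\<I>. measure ?Q (E I))"
    using fin Em by (intro Q.finite_measure_subadditive_finite) auto
  also have "\<dots> \<le> (\<Sum>I\<in>\<I>. (1 - q) ^ (N - Suc n))"
  proof (rule sum_mono)
    fix I assume I: "I \<in> \<I>"
    then have I': "I \<subseteq> {..<N}" "I \<noteq> {}" "card I = Suc n" by (auto simp: \<I>_def)
    have "emeasure ?Q (E I) \<le> ennreal ((1 - q) ^ (N - card I))"
      unfolding E_def using I' q
      by (intro emeasure_min_norm_point_from_subset_le P.prob_space_axioms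
        borel_measurable_mu_n_coord[OF \<mu>(2)]) auto
    then show "measure ?Q (E I) \<le> (1 - q) ^ (N - Suc n)"
      using I' q1 by (simp add: Q.emeasure_eq_measure)
  qed
  also have "\<dots> = real (N choose Suc n) * (1 - q) ^ (N - Suc n)"
    using n_subsets[of "{..<N}" "Suc n"] by (simp add: \<I>_def)
  finally show ?thesis .
qed

text \<open>The Bochner integral defining the expected measure would be the junk value 0 if the
  integrand were not measurable, so Fubini needs the joint measurability of membership in the hull.\<close>
lemma expected_hull_measure_ge:
  assumes \<mu>: "prob_space \<mu>" "sets \<mu> = sets borel" and "n < N"
    and G: "G \<in> sets (mu_n \<mu> n)" and "0 \<le> p"
    and p: "\<And>y. y \<in> G \<Longrightarrow> measure (PiM {..<N} (\<lambda>_. mu_n \<mu> n))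
      {X\<in>space (PiM {..<N} (\<lambda>_. mu_n \<mu> n)). y \<notin> K_N n N X} \<le> 1 - p"
  shows "p * measure (mu_n \<mu> n) G \<le> expected_hull_measure \<mu> n N"
proof -
  let ?P = "mu_n \<mu> n"
  let ?Q = "PiM {..<N} (\<lambda>_. mu_n \<mu> n)"
  interpret P: prob_space ?P by (rule prob_space_mu_n[OF \<mu>(1)])
  interpret Q: prob_space ?Q by (intro prob_space_PiM P.prob_space_axioms)
  interpret QP: pair_prob_space ?Q ?P ..
  have Nne: "{..<N} \<noteq> {}" "0 < N" using assms(3) by (auto simp: lessThan_empty_iff)
  define S where "S = {z \<in> space (?Q \<Otimes>\<^sub>M ?P). snd z \<in> K_N n N (fst z)}"
  have coord: "(\<lambda>z. fst z j i - snd z i) \<in> borel_measurable (?Q \<Otimes>\<^sub>M ?P)" if "j < N" "i < n" for j i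
  proof -
    note c = borel_measurable_mu_n_coord[OF \<mu>(2) that(2)]
    have "(\<lambda>X. (\<lambda>x. x i) (X j)) \<in> borel_measurable ?Q"
      using that c by (intro measurable_compose[OF measurable_component_singleton]) auto
    from measurable_compose[OF measurable_fst this] measurable_compose[OF measurable_snd c]
    show ?thesis by (intro borel_measurable_diff) auto
  qed
  have Sm: "S \<in> sets (?Q \<Otimes>\<^sub>M ?P)"
  proof -
    \<comment> \<open>Joint measurability in samples and point is read off from
      \<open>hull_sq\<close>, a countable infimum of functions measurable on the product.\<close>
    have "S = {z \<in> space (?Q \<Otimes>\<^sub>M ?P). hull_sq n {..<N} (\<lambda>j i. fst z j i - snd z i) = 0}"
      unfolding S_def using K_N_iff_hull_sq[OF _ Nne(2), of _ n] space_mu_n[OF \<mu>(2)]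
      by (auto simp: space_pair_measure)
    moreover have "(\<lambda>z. hull_sq n {..<N} (\<lambda>j i. fst z j i - snd z i)) \<in> borel_measurable (?Q \<Otimes>\<^sub>M ?P)"
      using Nne by (intro borel_measurable_hull_sq coord) auto
    ultimately show ?thesis by simp
  qed
  have Ksub: "K_N n N X \<subseteq> space ?P" for X using space_mu_n[OF \<mu>(2)] by (auto simp: K_N_def)
  have sec1: "Pair X -` S = K_N n N X" if "X \<in> space ?Q" for X
    using that Ksub by (auto simp: S_def space_pair_measure)
  have sec2: "(\<lambda>X. (X, y)) -` S = {X\<in>space ?Q. y \<in> K_N n N X}" if "y \<in> space ?P" for y
    using that by (auto simp: S_def space_pair_measure)
  have m1: "(\<lambda>X. emeasure ?P (K_N n N X)) \<in> borel_measurable ?Q"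
    using P.measurable_emeasure_Pair[OF Sm] by (rule measurable_cong[THEN iffD1, rotated]) (simp add: sec1)
  have "ennreal (p * measure ?P G) = (\<integral>\<^sup>+y. ennreal p * indicator G y \<partial>?P)"
    using G \<open>0 \<le> p\<close> by (simp add: nn_integral_cmult_indicator P.emeasure_eq_measure ennreal_mult)
  also have "\<dots> \<le> (\<integral>\<^sup>+y. emeasure ?Q ((\<lambda>X. (X, y)) -` S) \<partial>?P)"
  proof (intro nn_integral_mono)
    fix y assume y: "y \<in> space ?P"
    show "ennreal p * indicator G y \<le> emeasure ?Q ((\<lambda>X. (X, y)) -` S)"
    proof (cases "y \<in> G")
      case True
      have ev: "{X\<in>space ?Q. y \<in> K_N n N X} \<in> Q.events"
        using sets_Pair2[OF Sm, of y] sec2[OF y] by simp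
      have "measure ?Q {X\<in>space ?Q. y \<notin> K_N n N X} = 1 - measure ?Q {X\<in>space ?Q. y \<in> K_N n N X}"
        using Q.prob_neg[OF ev] by simp
      then have "p \<le> measure ?Q {X\<in>space ?Q. y \<in> K_N n N X}" using p[OF True] by simp
      then show ?thesis using True sec2[OF y] by (simp add: Q.emeasure_eq_measure ennreal_leI)
    qed simp
  qed
  also have "\<dots> = emeasure (?Q \<Otimes>\<^sub>M ?P) S" using QP.emeasure_pair_measure_alt2[OF Sm] by simp
  also have "\<dots> = (\<integral>\<^sup>+X. emeasure ?P (Pair X -` S) \<partial>?Q)" by (rule P.emeasure_pair_measure_alt[OF Sm])
  also have "\<dots> = (\<integral>\<^sup>+X. emeasure ?P (K_N n N X) \<partial>?Q)"
    by (intro nn_integral_cong) (simp add: sec1)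
  also have "\<dots> = (\<integral>\<^sup>+X. ennreal (measure ?P (K_N n N X)) \<partial>?Q)"
    by (simp add: P.emeasure_eq_measure)
  also have "\<dots> = ennreal (expected_hull_measure \<mu> n N)"
    unfolding expected_hull_measure_def
  proof (rule nn_integral_eq_integral)
    have "(\<lambda>X. measure ?P (K_N n N X)) \<in> borel_measurable ?Q"
      unfolding measure_def using m1 by measurable
    then show "integrable ?Q (\<lambda>X. measure ?P (K_N n N X))"
      by (intro Q.integrable_const_bound[of _ 1]) auto
  qed simp
  finally show ?thesis
    by (subst (asm) ennreal_le_iff) (auto simp: expected_hull_measure_def intro!: integral_nonneg_AE)
qed

subsection \<open>Sums of independent centred variables\<close>

text \<open>Induction on \<open>I\<close>, adding one variable to the sum \<open>S\<close> of the
  others. The odd mixed terms of the fourth power contain a factor of mean 0, so only 6 times the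
  product of the two second moments is left; \<open>3 \<le> K\<close> is exactly what fits it into
  the mixed term \<open>2 * K * (A * B)\<close> of \<open>K * (A + B)\<^sup>2\<close>.\<close>

lemma (in prob_space) indep_centered_bounded_sum_moments:
  fixes X :: "'i \<Rightarrow> 'a \<Rightarrow> real"
  assumes "finite I" and "indep_vars (\<lambda>_. borel) X I"
    and "\<And>i \<omega>. i \<in> I \<Longrightarrow> \<bar>X i \<omega>\<bar> \<le> C i" and "\<And>i. i \<in> I \<Longrightarrow> expectation (X i) = 0"
  shows "expectation (\<lambda>\<omega>. \<Sum>i\<in>I. X i \<omega>) = 0"
    and "expectation (\<lambda>\<omega>. (\<Sum>i\<in>I. X i \<omega>)\<^sup>2) = (\<Sum>i\<in>I. expectation (\<lambda>\<omega>. (X i \<omega>)\<^sup>2))"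
    and "\<lbrakk>3 \<le> K; \<And>i. i \<in> I \<Longrightarrow> expectation (\<lambda>\<omega>. X i \<omega> ^ 4) \<le> K * (expectation (\<lambda>\<omega>. (X i \<omega>)\<^sup>2))\<^sup>2\<rbrakk>
      \<Longrightarrow> expectation (\<lambda>\<omega>. (\<Sum>i\<in>I. X i \<omega>) ^ 4)
        \<le> K * (expectation (\<lambda>\<omega>. (\<Sum>i\<in>I. X i \<omega>)\<^sup>2))\<^sup>2"
  using assms
proof (induction I rule: finite_induct)
  case empty
  { case 1 show ?case by simp }
  { case 2 show ?case by simp }
  { case 3 then show ?case by simp }
next
  case (insert k I)
  have main: "expectation (\<lambda>\<omega>. \<Sum>i\<in>insert k I. X i \<omega>) = 0 \<and>
    expectation (\<lambda>\<omega>. (\<Sum>i\<in>insert k I. X i \<omega>)\<^sup>2)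
      = (\<Sum>i\<in>insert k I. expectation (\<lambda>\<omega>. (X i \<omega>)\<^sup>2)) \<and>
    ((3 \<le> K \<and> (\<forall>i\<in>insert k I. expectation (\<lambda>\<omega>. X i \<omega> ^ 4) \<le> K * (expectation (\<lambda>\<omega>. (X i \<omega>)\<^sup>2))\<^sup>2)) \<longrightarrow>
      expectation (\<lambda>\<omega>. (\<Sum>i\<in>insert k I. X i \<omega>) ^ 4)
        \<le> K * (expectation (\<lambda>\<omega>. (\<Sum>i\<in>insert k I. X i \<omega>)\<^sup>2))\<^sup>2)"
    if indep: "indep_vars (\<lambda>_. borel) X (insert k I)"
      and bd: "\<And>i \<omega>. i \<in> insert k I \<Longrightarrow> \<bar>X i \<omega>\<bar> \<le> C i"
      and mean: "\<And>i. i \<in> insert k I \<Longrightarrow> expectation (X i) = 0"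
  proof -
    define S where "S \<omega> = (\<Sum>i\<in>I. X i \<omega>)" for \<omega>
    have indepI: "indep_vars (\<lambda>_. borel) X I" using indep by (rule indep_vars_subset) auto
    have IH1: "expectation S = 0" unfolding S_def using insert.IH(1)[OF indepI] bd mean by blast
    have IH2: "expectation (\<lambda>\<omega>. (S \<omega>)\<^sup>2) = (\<Sum>i\<in>I. expectation (\<lambda>\<omega>. (X i \<omega>)\<^sup>2))"
      unfolding S_def using insert.IH(2)[OF indepI] bd mean by blast
    have rv: "random_variable borel (X i)" if "i \<in> insert k I" for i
      using indep that by (auto simp: indep_vars_def2)
    have [measurable]: "random_variable borel (X k)" using rv by simp
    have [measurable]: "random_variable borel S"
      unfolding S_def using rv by (intro borel_measurable_sum) auto
    have Sb: "\<bar>S \<omega>\<bar> \<le> (\<Sum>i\<in>I. C i)" for \<omega>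
      unfolding S_def using bd by (intro order_trans[OF sum_abs] sum_mono) auto
    have Xb: "\<bar>X k \<omega>\<bar> \<le> C k" for \<omega> using bd by simp
    have intS: "integrable M (\<lambda>\<omega>. S \<omega> ^ a)" for a
      by (rule integrable_const_bound[of _ "(\<Sum>i\<in>I. C i) ^ a"])
        (auto simp: power_abs intro!: power_mono Sb)
    have intX: "integrable M (\<lambda>\<omega>. X k \<omega> ^ a)" for a
      by (rule integrable_const_bound[of _ "C k ^ a"])
        (auto simp: power_abs intro!: power_mono Xb)
    have iv: "indep_var borel (X k) borel S"
      using indep_vars_sum[OF insert.hyps indep] by (simp add: S_def[abs_def])
    have ip: "indep_var borel (\<lambda>\<omega>. X k \<omega> ^ a) borel (\<lambda>\<omega>. S \<omega> ^ b)" for a b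
      using indep_var_compose[OF iv, of "\<lambda>x. x ^ a" borel "\<lambda>x. x ^ b" borel] by (simp add: comp_def)
    have pE: "expectation (\<lambda>\<omega>. X k \<omega> ^ a * S \<omega> ^ b) = expectation (\<lambda>\<omega>. X k \<omega> ^ a) * expectation (\<lambda>\<omega>. S \<omega> ^ b)"
      and pI: "integrable M (\<lambda>\<omega>. X k \<omega> ^ a * S \<omega> ^ b)" for a b
      using indep_var_lebesgue_integral[OF ip intX intS] indep_var_integrable[OF ip intX intS] by auto
    have mX: "expectation (X k) = 0" using mean by simp
    have split: "(\<Sum>i\<in>insert k I. X i \<omega>) = X k \<omega> + S \<omega>" for \<omega>
      using insert.hyps by (simp add: S_def)
    have i1: "integrable M (X k)" "integrable M S" using intX[of 1] intS[of 1] by simp_all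
    have e1: "expectation (\<lambda>\<omega>. X k \<omega> + S \<omega>) = 0" using i1 mX IH1 by simp
    have "expectation (\<lambda>\<omega>. (X k \<omega> + S \<omega>)\<^sup>2)
        = expectation (\<lambda>\<omega>. X k \<omega> ^ 2 + 2 * (X k \<omega> ^ 1 * S \<omega> ^ 1) + S \<omega> ^ 2)"
      by (intro Bochner_Integration.integral_cong) (auto simp: power2_eq_square algebra_simps)
    also have "\<dots> = expectation (\<lambda>\<omega>. (X k \<omega>)\<^sup>2) + 2 * expectation (\<lambda>\<omega>. X k \<omega> ^ 1 * S \<omega> ^ 1)
        + expectation (\<lambda>\<omega>. (S \<omega>)\<^sup>2)"
      using pI[of 1 1] intX[of 2] intS[of 2] by simp
    finally have e2: "expectation (\<lambda>\<omega>. (X k \<omega> + S \<omega>)\<^sup>2)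
        = expectation (\<lambda>\<omega>. (X k \<omega>)\<^sup>2) + expectation (\<lambda>\<omega>. (S \<omega>)\<^sup>2)"
      using pE[of 1 1] mX by simp
    have e4: "expectation (\<lambda>\<omega>. (X k \<omega> + S \<omega>) ^ 4) = expectation (\<lambda>\<omega>. X k \<omega> ^ 4)
        + 6 * (expectation (\<lambda>\<omega>. (X k \<omega>)\<^sup>2) * expectation (\<lambda>\<omega>. (S \<omega>)\<^sup>2)) + expectation (\<lambda>\<omega>. S \<omega> ^ 4)"
    proof -
      have poly: "(x + s) ^ 4 = x ^ 4 + (4 * (x ^ 3 * s ^ 1) + (6 * (x ^ 2 * s ^ 2) + (4 * (x ^ 1 * s ^ 3) + s ^ 4)))"
        for x s :: real by algebra
      have "expectation (\<lambda>\<omega>. (X k \<omega> + S \<omega>) ^ 4) = expectation (\<lambda>\<omega>. X k \<omega> ^ 4)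
        + (4 * expectation (\<lambda>\<omega>. X k \<omega> ^ 3 * S \<omega> ^ 1) + (6 * expectation (\<lambda>\<omega>. X k \<omega> ^ 2 * S \<omega> ^ 2)
        + (4 * expectation (\<lambda>\<omega>. X k \<omega> ^ 1 * S \<omega> ^ 3) + expectation (\<lambda>\<omega>. S \<omega> ^ 4))))"
        unfolding poly using intX intS pI[of 3 1] pI[of 2 2] pI[of 1 3] by simp
      then show ?thesis unfolding pE using mX IH1 by simp
    qed
    have "expectation (\<lambda>\<omega>. (X k \<omega> + S \<omega>) ^ 4) \<le> K * (expectation (\<lambda>\<omega>. (X k \<omega> + S \<omega>)\<^sup>2))\<^sup>2"
      if K: "3 \<le> K" and 4: "\<forall>i\<in>insert k I. expectation (\<lambda>\<omega>. X i \<omega> ^ 4) \<le> K * (expectation (\<lambda>\<omega>. (X i \<omega>)\<^sup>2))\<^sup>2"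
    proof -
      define A B where "A = expectation (\<lambda>\<omega>. (X k \<omega>)\<^sup>2)" and "B = expectation (\<lambda>\<omega>. (S \<omega>)\<^sup>2)"
      have "0 \<le> A" "0 \<le> B" by (auto simp: A_def B_def)
      then have "6 * (A * B) \<le> 2 * K * (A * B)" using K by (intro mult_right_mono) auto
      moreover have "expectation (\<lambda>\<omega>. X k \<omega> ^ 4) \<le> K * A\<^sup>2" using 4 by (simp add: A_def)
      moreover have "expectation (\<lambda>\<omega>. S \<omega> ^ 4) \<le> K * B\<^sup>2"
        using insert.IH(3)[OF K _ indepI] 4 bd mean by (simp add: B_def S_def)
      moreover have "K * (A + B)\<^sup>2 = K * A\<^sup>2 + 2 * K * (A * B) + K * B\<^sup>2"
        by (simp add: power2_eq_square algebra_simps)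
      ultimately show ?thesis unfolding e4 e2 A_def[symmetric] B_def[symmetric] by linarith
    qed
    then show ?thesis unfolding split using e1 e2 IH2 insert.hyps by simp
  qed
  { case 1 then show ?case using main by blast }
  { case 2 then show ?case using main by blast }
  { case 3 then show ?case using main by blast }
qed

text \<open>Taking means bounds the probability of the half-line below in terms of the first, second and
  fourth moments.\<close>
lemma quartic_le_indicator:
  fixes K s :: real
  assumes "3 \<le> K"
  shows "K * s + s\<^sup>2 - s ^ 4 / (2 * K) \<le> 3 * K\<^sup>2 * indicator {0..} s"
proof (cases "0 \<le> s")
  case True
  have "0 \<le> (s\<^sup>2 - 2 * K)\<^sup>2 / (4 * K)" using assms by simp
  also have "\<dots> = s ^ 4 / (4 * K) - s\<^sup>2 + K"
    using assms by (simp add: field_simps power2_eq_square power4_eq_xxxx)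
  finally have 1: "s\<^sup>2 - s ^ 4 / (4 * K) \<le> K" by simp
  \<comment> \<open>One half of the quartic term has absorbed \<open>s\<^sup>2\<close>, the other
    half absorbs \<open>K * s\<close>; together they leave \<open>K + 2 * K\<^sup>2\<close>, at most
    \<open>3 * K\<^sup>2\<close>.\<close>
  have 2: "K * s - s ^ 4 / (4 * K) \<le> 2 * K\<^sup>2"
  proof (cases "s \<le> 2 * K")
    case True
    then have "K * s \<le> 2 * K\<^sup>2" using assms by (simp add: power2_eq_square)
    moreover have "0 \<le> s ^ 4 / (4 * K)" using assms by simp
    ultimately show ?thesis by linarith
  next
    case False
    have "(2 * K) ^ 3 \<le> s ^ 3" using False assms by (intro power_mono) auto
    then have "(2 * K) ^ 3 * s \<le> s ^ 4"
      using mult_right_mono[OF _ True, of "(2 * K) ^ 3" "s ^ 3"]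
      by (simp add: power3_eq_cube power4_eq_xxxx mult.assoc)
    then have "(2 * K) ^ 3 * s / (4 * K) \<le> s ^ 4 / (4 * K)" using assms by (intro divide_right_mono) auto
    moreover have "(2 * K) ^ 3 * s / (4 * K) = 2 * K\<^sup>2 * s"
      using assms by (simp add: field_simps power3_eq_cube power2_eq_square)
    moreover have "K * s \<le> 2 * K\<^sup>2 * s"
      using assms True by (intro mult_right_mono) (auto simp: power2_eq_square)
    ultimately show ?thesis by (smt (verit) zero_le_power2)
  qed
  have "K \<le> K\<^sup>2" using assms by (simp add: power2_eq_square)
  moreover have "s ^ 4 / (2 * K) = s ^ 4 / (4 * K) + s ^ 4 / (4 * K)" by simp
  ultimately have "K * s + s\<^sup>2 - s ^ 4 / (2 * K) \<le> 3 * K\<^sup>2" using 1 2 by linarith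
  then show ?thesis using True by simp
next
  case False
  define r where "r = - s"
  have r: "0 < r" using False by (simp add: r_def)
  \<comment> \<open>This is the claim for \<open>s = - r\<close> after division by
    \<open>r\<close>.\<close>
  have "r \<le> K + r ^ 3 / (2 * K)"
  proof (cases "r \<le> K")
    case True
    moreover have "0 \<le> r ^ 3 / (2 * K)" using r assms by simp
    ultimately show ?thesis by linarith
  next
    case False
    have "2 * K \<le> K * K" using assms by simp
    also have "\<dots> \<le> r * r" using False assms by (intro mult_mono) auto
    finally have "r * (2 * K) \<le> r * (r * r)" using r by (intro mult_left_mono) auto
    then have "r \<le> r ^ 3 / (2 * K)" using assms by (simp add: field_simps power3_eq_cube)
    then show ?thesis using assms by linarith
  qed
  then have "r * r \<le> r * (K + r ^ 3 / (2 * K))" using r by (intro mult_left_mono) auto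
  then have "K * s + s\<^sup>2 - s ^ 4 / (2 * K) \<le> 0"
    by (simp add: r_def power2_eq_square power3_eq_cube power4_eq_xxxx algebra_simps)
  then show ?thesis using False by simp
qed

text \<open>\<open>quartic_le_indicator\<close> is applied to \<open>S\<close> divided by its
  standard deviation: the linear term has mean 0, the square mean 1, and the quartic term costs at
  most \<open>1 / 2\<close>. If the variance vanishes, \<open>S\<close> is 0 almost surely.\<close>

lemma (in prob_space) prob_nonneg_ge_of_fourth_moment:
  fixes S :: "'a \<Rightarrow> real"
  assumes [measurable]: "random_variable borel S" and bd: "\<And>\<omega>. \<bar>S \<omega>\<bar> \<le> C"
    and "expectation S = 0" and K: "3 \<le> K"
    and S4: "expectation (\<lambda>\<omega>. S \<omega> ^ 4) \<le> K * (expectation (\<lambda>\<omega>. (S \<omega>)\<^sup>2))\<^sup>2"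
  shows "1 / (6 * K\<^sup>2) \<le> prob {\<omega>\<in>space M. 0 \<le> S \<omega>}"
proof -
  have int: "integrable M (\<lambda>\<omega>. S \<omega> ^ a)" for a
    by (rule integrable_const_bound[of _ "C ^ a"]) (auto simp: power_abs intro!: power_mono bd)
  define v where "v = expectation (\<lambda>\<omega>. (S \<omega>)\<^sup>2)"
  have "0 \<le> v" by (simp add: v_def)
  show ?thesis
  proof (cases "v = 0")
    case True
    then have "AE \<omega> in M. (S \<omega>)\<^sup>2 = 0"
      using integral_nonneg_eq_0_iff_AE[OF int[of 2]] by (simp add: v_def)
    then have "AE \<omega> in M. \<omega> \<in> {\<omega>\<in>space M. 0 \<le> S \<omega>}" by (auto elim!: AE_mp)
    then have "prob {\<omega>\<in>space M. 0 \<le> S \<omega>} = 1" by (intro prob_eq_1[THEN iffD2]) auto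
    moreover have "1 \<le> K\<^sup>2" using K by (simp add: one_le_power)
    ultimately show ?thesis by (simp add: divide_le_eq)
  next
    case False
    then have v: "0 < v" using \<open>0 \<le> v\<close> by simp
    define d where "d = sqrt v"
    have d: "0 < d" "d\<^sup>2 = v" using v by (auto simp: d_def)
    have d4: "d ^ 4 = v\<^sup>2" unfolding d(2)[symmetric] by (simp add: power2_eq_square power4_eq_xxxx)
    have "1 / 2 \<le> 1 - expectation (\<lambda>\<omega>. S \<omega> ^ 4) / v\<^sup>2 / (2 * K)"
    proof -
      have "expectation (\<lambda>\<omega>. S \<omega> ^ 4) / v\<^sup>2 \<le> K" using S4 v by (simp add: v_def[symmetric] field_simps)
      then have "expectation (\<lambda>\<omega>. S \<omega> ^ 4) / v\<^sup>2 / (2 * K) \<le> K / (2 * K)"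
        using K by (intro divide_right_mono) auto
      then show ?thesis using K by simp
    qed
    also have "\<dots> = expectation (\<lambda>\<omega>. K * (S \<omega> / d) + (S \<omega> / d)\<^sup>2 - (S \<omega> / d) ^ 4 / (2 * K))"
      using int[of 1] int[of 2] int[of 4] assms(3) d d4 v
      by (simp add: power_divide v_def[symmetric])
    also have "\<dots> \<le> expectation (\<lambda>\<omega>. 3 * K\<^sup>2 * indicator {\<omega>\<in>space M. 0 \<le> S \<omega>} \<omega>)"
    proof (rule integral_mono)
      show "integrable M (\<lambda>\<omega>. K * (S \<omega> / d) + (S \<omega> / d)\<^sup>2 - (S \<omega> / d) ^ 4 / (2 * K))"
        using int[of 1] int[of 2] int[of 4] by (simp add: power_divide)
      show "integrable M (\<lambda>\<omega>. 3 * K\<^sup>2 * indicator {\<omega>\<in>space M. 0 \<le> S \<omega>} \<omega>)"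
        by (intro integrable_mult_right integrable_real_indicator) (auto simp: emeasure_eq_measure)
    next
      fix \<omega> assume "\<omega> \<in> space M"
      then have "indicator {\<omega>\<in>space M. 0 \<le> S \<omega>} \<omega> = (indicator {0..} (S \<omega> / d) :: real)"
        using d by (auto simp: indicator_def zero_le_divide_iff)
      then show "K * (S \<omega> / d) + (S \<omega> / d)\<^sup>2 - (S \<omega> / d) ^ 4 / (2 * K)
          \<le> 3 * K\<^sup>2 * indicator {\<omega>\<in>space M. 0 \<le> S \<omega>} \<omega>"
        using quartic_le_indicator[OF K, of "S \<omega> / d"] by simp
    qed
    also have "\<dots> = 3 * K\<^sup>2 * prob {\<omega>\<in>space M. 0 \<le> S \<omega>}" by simp
    finally show ?thesis using K by (simp add: field_simps)
  qed
qed

lemma (in prob_space) second_moment_tail: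
  fixes S :: "'a \<Rightarrow> real"
  assumes [measurable]: "random_variable borel S" and "integrable M (\<lambda>\<omega>. (S \<omega>)\<^sup>2)" and "0 < a"
  shows "prob {\<omega>\<in>space M. a < S \<omega>} \<le> expectation (\<lambda>\<omega>. (S \<omega>)\<^sup>2) / a\<^sup>2"
proof -
  have "prob {\<omega>\<in>space M. a < S \<omega>} \<le> prob {\<omega>\<in>space M. \<bar>S \<omega>\<bar> \<ge> a}"
    by (intro finite_measure_mono) auto
  also have "\<dots> \<le> expectation (\<lambda>\<omega>. (S \<omega>)\<^sup>2) / a\<^sup>2"
    using assms by (intro second_moment_method) auto
  finally show ?thesis .
qed

section \<open>Product measures: independent coordinates, product densities, a weak law\<close>

lemma indep_vars_PiM_coordinates:
  assumes "finite I" "\<And>i. prob_space (M i)"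
    and "\<And>i. i \<in> I \<Longrightarrow> f i \<in> measurable (M i) N"
  shows "prob_space.indep_vars (PiM I M) (\<lambda>_. N) (\<lambda>i x. f i (x i)) I"
proof -
  interpret P: prob_space "PiM I M" by (intro prob_space_PiM assms)
  have "P.indep_vars M (\<lambda>i x. x i) I"
  proof (cases "I = {}")
    case True
    then show ?thesis unfolding P.indep_vars_def P.indep_sets_def by simp
  next
    case False
    have "distr (PiM I M) (PiM I M) (\<lambda>x. \<lambda>i\<in>I. x i) = distr (PiM I M) (PiM I M) (\<lambda>x. x)"
      by (intro distr_cong) (auto simp: space_PiM PiE_iff extensional_restrict)
    also have "\<dots> = PiM I M" by (rule distr_id2) simp
    also have "\<dots> = PiM I (\<lambda>i. distr (PiM I M) (M i) (\<lambda>x. x i))"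
      by (intro PiM_cong distr_PiM_component[symmetric] assms) auto
    finally show ?thesis using False by (subst P.indep_vars_iff_distr_eq_PiM') auto
  qed
  then show ?thesis using assms(3) by (rule P.indep_vars_compose2)
qed

lemma integral_PiM_coordinate:
  fixes f :: "'a \<Rightarrow> real"
  assumes "finite I" "\<And>i. prob_space (M i)" "k \<in> I" "f \<in> borel_measurable (M k)"
  shows "(\<integral>x. f (x k) \<partial>PiM I M) = (\<integral>x. f x \<partial>M k)"
  using integral_distr[of "\<lambda>x. x k" "PiM I M" "M k" f] distr_PiM_component[of I M k] assms by simp

lemma PiM_density:
  assumes "finite I" "prob_space \<mu>"
    and [measurable]: "\<And>i. g i \<in> borel_measurable \<mu>"
    and "\<And>i. (\<integral>\<^sup>+x. g i x \<partial>\<mu>) = 1"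
  shows "PiM I (\<lambda>i. density \<mu> (g i)) = density (PiM I (\<lambda>_. \<mu>)) (\<lambda>x. \<Prod>i\<in>I. g i (x i))"
proof -
  interpret \<mu>: prob_space \<mu> by fact
  have pd: "prob_space (density \<mu> (g i))" for i
    using assms(4)[of i] by (intro prob_spaceI) (simp add: emeasure_density cong: nn_integral_cong)
  interpret d: product_prob_space "\<lambda>i. density \<mu> (g i)" I
    using pd by (simp add: product_prob_space_def product_prob_space_axioms_def product_sigma_finite_def
      prob_space_imp_sigma_finite)
  interpret m: product_prob_space "\<lambda>_. \<mu>" I by standard
  have [measurable]: "(\<lambda>x. \<Prod>i\<in>I. g i (x i)) \<in> borel_measurable (PiM I (\<lambda>_. \<mu>))"
    by (intro borel_measurable_prod_ennreal measurable_compose[OF measurable_component_singleton]) auto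
  show ?thesis
  proof (rule d.PiM_eqI[symmetric])
    show "sets (density (PiM I (\<lambda>_. \<mu>)) (\<lambda>x. \<Prod>i\<in>I. g i (x i))) = sets (PiM I (\<lambda>i. density \<mu> (g i)))"
      by (auto intro!: sets_PiM_cong)
    fix A assume A: "\<And>i. i \<in> I \<Longrightarrow> A i \<in> sets (density \<mu> (g i))"
    have AP: "PiE I A \<in> sets (PiM I (\<lambda>_. \<mu>))" using A assms(1) by (intro sets_PiM_I_finite) auto
    have "emeasure (density (PiM I (\<lambda>_. \<mu>)) (\<lambda>x. \<Prod>i\<in>I. g i (x i))) (PiE I A)
        = (\<integral>\<^sup>+x. (\<Prod>i\<in>I. g i (x i)) * indicator (PiE I A) x \<partial>PiM I (\<lambda>_. \<mu>))"
      using AP by (simp add: emeasure_density)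
    also have "\<dots> = (\<integral>\<^sup>+x. (\<Prod>i\<in>I. g i (x i) * indicator (A i) (x i)) \<partial>PiM I (\<lambda>_. \<mu>))"
    proof (intro nn_integral_cong)
      fix x assume x: "x \<in> space (PiM I (\<lambda>_. \<mu>))"
      have "indicator (PiE I A) x = (\<Prod>i\<in>I. indicator (A i) (x i) :: ennreal)"
      proof (cases "x \<in> PiE I A")
        case True then show ?thesis by (auto simp: PiE_iff intro!: prod.neutral[symmetric])
      next
        case False
        then obtain i where "i \<in> I" "x i \<notin> A i" using x by (auto simp: space_PiM PiE_iff)
        then show ?thesis using False assms(1) by (auto intro!: prod_zero[symmetric] bexI[of _ i])
      qed
      then show "(\<Prod>i\<in>I. g i (x i)) * indicator (PiE I A) x = (\<Prod>i\<in>I. g i (x i) * indicator (A i) (x i))"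
        by (simp add: prod.distrib)
    qed
    also have "\<dots> = (\<Prod>i\<in>I. \<integral>\<^sup>+x. g i x * indicator (A i) x \<partial>\<mu>)"
      using A assms(1) by (intro m.product_nn_integral_prod) auto
    also have "\<dots> = (\<Prod>i\<in>I. emeasure (density \<mu> (g i)) (A i))"
      using A by (intro prod.cong) (auto simp: emeasure_density)
    finally show "emeasure (density (PiM I (\<lambda>_. \<mu>)) (\<lambda>x. \<Prod>i\<in>I. g i (x i))) (PiE I A)
      = (\<Prod>i\<in>I. emeasure (density \<mu> (g i)) (A i))" .
  qed fact
qed

text \<open>Only integrability of \<open>f\<close> is assumed, so its variance may be infinite. The
  sum is split at a truncation level: Chebyshev handles the bounded part, Markov the nonnegative
  remainder.\<close>

lemma weak_law_upper_tail:
  fixes f :: "'a \<Rightarrow> real"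
  assumes "prob_space \<mu>" and [measurable]: "f \<in> borel_measurable \<mu>" and f0: "\<And>x. 0 \<le> f x"
    and int: "integrable \<mu> f" and "0 < e" "0 < d"
  shows "\<exists>n0. \<forall>n\<ge>n0. measure (PiM {..<n} (\<lambda>_. \<mu>)) {x\<in>space (PiM {..<n} (\<lambda>_. \<mu>)).
    real n * ((\<integral>x. f x \<partial>\<mu>) + e) < (\<Sum>i<n. f (x i))} \<le> d"
proof -
  interpret \<mu>: prob_space \<mu> by fact
  have "(\<lambda>m. \<integral>x. min (f x) (real m) \<partial>\<mu>) \<longlonglongrightarrow> (\<integral>x. f x \<partial>\<mu>)"
  proof (rule integral_dominated_convergence[where w = f])
    show "AE x in \<mu>. (\<lambda>m. min (f x) (real m)) \<longlonglongrightarrow> f x"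
    proof (rule AE_I2)
      fix x
      have "eventually (\<lambda>m. min (f x) (real m) = f x) sequentially"
        using eventually_ge_at_top[of "nat \<lceil>f x\<rceil>"] by eventually_elim linarith
      then show "(\<lambda>m. min (f x) (real m)) \<longlonglongrightarrow> f x" by (rule tendsto_eventually)
    qed
    show "AE x in \<mu>. norm (min (f x) (real m)) \<le> f x" for m using f0 by auto
  qed (use int in auto)
  then have "\<forall>\<^sub>F m in sequentially. (\<integral>x. f x \<partial>\<mu>) - d * e / 4 < (\<integral>x. min (f x) (real m) \<partial>\<mu>)"
    using assms(5,6) by (intro order_tendstoD) auto
  \<comment> \<open>The truncation loses less than \<open>d * e / 4\<close> in the mean, so Markov
    at level \<open>real n * e / 2\<close> gives \<open>d / 2\<close>.\<close>
  then obtain m :: nat where m: "(\<integral>x. f x \<partial>\<mu>) - d * e / 4 < (\<integral>x. min (f x) (real m) \<partial>\<mu>)"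
    by (auto simp: eventually_sequentially)
  define h where "h x = min (f x) (real m)" for x
  have hb: "0 \<le> h x" "h x \<le> real m" "h x \<le> f x" for x using f0 by (auto simp: h_def)
  have [measurable]: "h \<in> borel_measurable \<mu>" by (simp add: h_def[abs_def])
  have inth: "integrable \<mu> h" by (rule \<mu>.integrable_const_bound[of _ "real m"]) (auto simp: hb)
  define A where "A = (\<integral>x. h x \<partial>\<mu>)"
  have A: "0 \<le> A" "A \<le> real m"
    using \<mu>.integral_le_const[OF inth, of "real m"] hb by (auto simp: A_def)
  have Af: "(\<integral>x. f x \<partial>\<mu>) - d * e / 4 < A" using m by (simp add: A_def h_def)
  \<comment> \<open>The size that brings the Chebyshev bound
    \<open>4 * real m ^ 2 / (real n * e\<^sup>2)\<close> down to \<open>d / 2\<close>.\<close>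
  obtain n0 :: nat where n0: "8 * real m ^ 2 / (d * e ^ 2) < real n0" using reals_Archimedean2 by blast
  show ?thesis
  proof (intro exI[of _ "Suc n0"] allI impI)
    fix n assume "Suc n0 \<le> n"
    then have n: "0 < n" "n0 \<le> n" by auto
    let ?P = "PiM {..<n} (\<lambda>_. \<mu>)"
    interpret P: prob_space ?P by (intro prob_space_PiM \<mu>.prob_space_axioms)
    have [measurable]: "(\<lambda>x. x i) \<in> measurable ?P \<mu>" if "i < n" for i
      using that by (intro measurable_component_singleton) auto
    define S where "S x = (\<Sum>i<n. h (x i) - A)" for x
    define R where "R x = (\<Sum>i<n. f (x i) - h (x i))" for x
    have [measurable]: "S \<in> borel_measurable ?P" "R \<in> borel_measurable ?P"
      unfolding S_def[abs_def] R_def[abs_def]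
      by (intro borel_measurable_sum borel_measurable_diff measurable_compose[OF measurable_component_singleton];
        simp)+
    have ind: "P.indep_vars (\<lambda>_. borel) (\<lambda>i x. h (x i) - A) {..<n}"
      by (rule indep_vars_PiM_coordinates[where f = "\<lambda>_ x. h x - A"]) (auto intro: \<mu>.prob_space_axioms)
    have bd: "\<bar>h x - A\<bar> \<le> real m" for x using hb[of x] A by auto
    have mean: "P.expectation (\<lambda>x. h (x i) - A) = 0" if "i < n" for i
      using integral_PiM_coordinate[of "{..<n}" "\<lambda>_. \<mu>" i "\<lambda>x. h x - A"] that inth
      by (simp add: \<mu>.prob_space_axioms A_def \<mu>.prob_space)
    have "P.expectation (\<lambda>x. (S x)\<^sup>2) = (\<Sum>i<n. P.expectation (\<lambda>x. (h (x i) - A)\<^sup>2))"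
      unfolding S_def
      by (rule P.indep_centered_bounded_sum_moments(2)[OF _ ind, where C = "\<lambda>_. real m"])
        (auto simp: bd mean)
    also have "\<dots> \<le> (\<Sum>i<n. real m ^ 2)"
    proof (rule sum_mono)
      fix i assume i: "i \<in> {..<n}"
      have sq: "(h x - A)\<^sup>2 \<le> real m ^ 2" for x
        using power_mono[OF bd[of x], of 2] by simp
      have "integrable ?P (\<lambda>x. (h (x i) - A)\<^sup>2)"
        by (rule P.integrable_const_bound[of _ "real m ^ 2"]) (use sq i in auto)
      then show "P.expectation (\<lambda>x. (h (x i) - A)\<^sup>2) \<le> real m ^ 2"
        by (rule P.integral_le_const) (use sq in auto)
    qed
    finally have S2: "P.expectation (\<lambda>x. (S x)\<^sup>2) \<le> real n * real m ^ 2" by simp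
    have Sb: "\<bar>S x\<bar> \<le> real n * real m" for x
    proof -
      have "\<bar>S x\<bar> \<le> (\<Sum>i<n. real m)"
        unfolding S_def by (intro order_trans[OF sum_abs] sum_mono bd)
      then show ?thesis by simp
    qed
    have "P.prob {x\<in>space ?P. real n * e / 2 < S x} \<le> P.expectation (\<lambda>x. (S x)\<^sup>2) / (real n * e / 2)\<^sup>2"
    proof (rule P.second_moment_tail)
      have "(S x)\<^sup>2 \<le> (real n * real m)\<^sup>2" for x using power_mono[OF Sb[of x], of 2] by simp
      then show "integrable ?P (\<lambda>x. (S x)\<^sup>2)"
        by (intro P.integrable_const_bound[of _ "(real n * real m)\<^sup>2"]) auto
    qed (use n assms in auto)
    also have "\<dots> \<le> real n * real m ^ 2 / (real n * e / 2)\<^sup>2"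
      using S2 by (intro divide_right_mono) auto
    also have "\<dots> = 4 * real m ^ 2 / (real n * e\<^sup>2)"
      using n assms(5) by (simp add: field_simps power2_eq_square)
    also have "\<dots> \<le> d / 2"
    proof -
      have "8 * real m ^ 2 / (d * e ^ 2) \<le> real n" using n0 n by linarith
      then have "8 * real m ^ 2 \<le> real n * (d * e\<^sup>2)" using assms(5,6) by (simp add: pos_divide_le_eq)
      then show ?thesis using n assms(5,6) by (simp add: pos_divide_le_eq algebra_simps)
    qed
    finally have 1: "P.prob {x\<in>space ?P. real n * e / 2 < S x} \<le> d / 2" .
    have intR: "integrable ?P (\<lambda>x. f (x i) - h (x i))" if "i < n" for i
    proof -
      have "integrable (distr ?P \<mu> (\<lambda>x. x i)) (\<lambda>x. f x - h x)"
        using int inth that \<mu>.prob_space_axioms by (subst distr_PiM_component) auto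
      then show ?thesis using that by (subst (asm) integrable_distr_eq) auto
    qed
    have ER: "P.expectation R = real n * ((\<integral>x. f x \<partial>\<mu>) - A)"
    proof -
      have "P.expectation R = (\<Sum>i<n. P.expectation (\<lambda>x. f (x i) - h (x i)))"
        unfolding R_def[abs_def] using intR by (intro Bochner_Integration.integral_sum) auto
      also have "\<dots> = (\<Sum>i<n. (\<integral>x. f x \<partial>\<mu>) - A)"
      proof (rule sum.cong[OF refl])
        fix i assume "i \<in> {..<n}"
        then show "P.expectation (\<lambda>x. f (x i) - h (x i)) = (\<integral>x. f x \<partial>\<mu>) - A"
          using integral_PiM_coordinate[of "{..<n}" "\<lambda>_. \<mu>" i "\<lambda>x. f x - h x"] int inth
          by (simp add: \<mu>.prob_space_axioms A_def)
      qed
      finally show ?thesis by simp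
    qed
    have "P.prob {x\<in>space ?P. real n * e / 2 \<le> R x} \<le> P.expectation R / (real n * e / 2)"
    proof (rule integral_Markov_inequality_measure[where A = "space ?P"])
      show "integrable ?P R" unfolding R_def[abs_def] using intR by (intro Bochner_Integration.integrable_sum) auto
      show "AE x in ?P. 0 \<le> R x" unfolding R_def using hb by (auto intro!: sum_nonneg)
    qed (use n assms in auto)
    also have "\<dots> \<le> (real n * (d * e / 4)) / (real n * e / 2)"
      unfolding ER using Af n assms(5) by (intro divide_right_mono mult_left_mono) auto
    also have "\<dots> = d / 2" using n assms(5) by (simp add: field_simps)
    finally have 2: "P.prob {x\<in>space ?P. real n * e / 2 \<le> R x} \<le> d / 2" .
    have SR: "(\<Sum>i<n. f (x i)) = S x + R x + real n * A" for x
      by (simp add: S_def R_def sum_subtractf)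
    have "{x\<in>space ?P. real n * ((\<integral>x. f x \<partial>\<mu>) + e) < (\<Sum>i<n. f (x i))}
      \<subseteq> {x\<in>space ?P. real n * e / 2 < S x} \<union> {x\<in>space ?P. real n * e / 2 \<le> R x}"
    proof
      fix x assume x: "x \<in> {x\<in>space ?P. real n * ((\<integral>x. f x \<partial>\<mu>) + e) < (\<Sum>i<n. f (x i))}"
      have "A \<le> (\<integral>x. f x \<partial>\<mu>)" unfolding A_def using hb int inth by (intro integral_mono) auto
      then have "real n * A \<le> real n * (\<integral>x. f x \<partial>\<mu>)" by (intro mult_left_mono) auto
      then show "x \<in> {x\<in>space ?P. real n * e / 2 < S x} \<union> {x\<in>space ?P. real n * e / 2 \<le> R x}"
        using x SR[of x] by (auto simp: distrib_left)
    qed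
    then have "P.prob {x\<in>space ?P. real n * ((\<integral>x. f x \<partial>\<mu>) + e) < (\<Sum>i<n. f (x i))}
      \<le> P.prob ({x\<in>space ?P. real n * e / 2 < S x} \<union> {x\<in>space ?P. real n * e / 2 \<le> R x})"
      by (intro P.finite_measure_mono) auto
    also have "\<dots> \<le> P.prob {x\<in>space ?P. real n * e / 2 < S x} + P.prob {x\<in>space ?P. real n * e / 2 \<le> R x}"
      by (intro measure_Un_le) auto
    finally show "P.prob {x\<in>space ?P. real n * ((\<integral>x. f x \<partial>\<mu>) + e) < (\<Sum>i<n. f (x i))} \<le> d"
      using 1 2 by simp
  qed
qed

text \<open>A change of measure for one coordinate: \<open>g\<close> is a density with respect to \<open>\<mu>\<close> carried by
  points where \<open>\<sigma> x - z\<close> dominates a bounded variable \<open>b\<close> that is centred under \<open>g\<close>; the number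
  \<open>a\<close> is the exponential cost of the change of measure, up to the fluctuation \<open>t b\<close>.\<close>
definition tilt_witness ::
  "real measure \<Rightarrow> real \<Rightarrow> real \<Rightarrow> real \<Rightarrow> real \<Rightarrow> real \<Rightarrow> real \<Rightarrow> (real \<Rightarrow> real) \<Rightarrow> (real \<Rightarrow> real) \<Rightarrow> real \<Rightarrow> bool"
  where "tilt_witness \<mu> C K t0 \<sigma> z a g b t \<longleftrightarrow>
    g \<in> borel_measurable borel \<and> b \<in> borel_measurable borel \<and> (\<forall>x. 0 \<le> g x) \<and>
    (\<integral>\<^sup>+x. ennreal (g x) \<partial>\<mu>) = 1 \<and> (\<forall>x. \<bar>b x\<bar> \<le> C) \<and> (\<integral>x. g x * b x \<partial>\<mu>) = 0 \<and>
    (\<integral>x. g x * b x ^ 4 \<partial>\<mu>) \<le> K * (\<integral>x. g x * (b x)\<^sup>2 \<partial>\<mu>)\<^sup>2 \<and> \<bar>t\<bar> \<le> t0 \<and>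
    (\<forall>x. 0 < g x \<longrightarrow> b x \<le> \<sigma> * x - z \<and> g x \<le> exp (a + t * b x))"

text \<open>Under the product of the densities, the weighted sum \<open>S\<close> of the
  \<open>b i\<close> is nonnegative with probability at least \<open>1 / (6 * K\<^sup>2)\<close>,
  while the fluctuation \<open>V\<close> of the log-density exceeds \<open>\<eta> * real n\<close>
  with at most half that probability, by the assumed lower bound on \<open>n\<close>. When both
  behave well, the point lies in the half-space and the density is at most \<open>L\<close>, so the
  original measure loses no more than the factor \<open>L\<close>.\<close>

lemma halfspace_prob_ge:
  fixes a u y :: "nat \<Rightarrow> real"
  assumes \<mu>: "prob_space \<mu>" "sets \<mu> = sets borel"
    and K: "3 \<le> K" and "0 < \<eta>" and n: "0 < n" "12 * K\<^sup>2 * (t0\<^sup>2 * C\<^sup>2) \<le> \<eta>\<^sup>2 * real n"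
    and W: "\<And>i. i < n \<Longrightarrow> \<exists>g b t. tilt_witness \<mu> C K t0 (if 0 \<le> u i then 1 else - 1) \<bar>y i\<bar> (a i) g b t"
  shows "exp (- (\<Sum>i<n. a i) - \<eta> * real n) / (12 * K\<^sup>2)
    \<le> measure (mu_n \<mu> n) {x\<in>space (mu_n \<mu> n). 0 \<le> (\<Sum>i<n. u i * (x i - y i))}"
proof -
  interpret \<mu>: prob_space \<mu> by fact
  obtain g0 b t where w: "\<And>i. i < n \<Longrightarrow>
      tilt_witness \<mu> C K t0 (if 0 \<le> u i then 1 else - 1) \<bar>y i\<bar> (a i) (g0 i) (b i) (t i)"
    using W by metis
  \<comment> \<open>Padded by the trivial density for \<open>i \<ge> n\<close>, because
    \<open>PiM_density\<close> asks for a probability density at every index.\<close>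
  define g where "g i x = (if i < n then g0 i x else 1)" for i x
  have wit: "tilt_witness \<mu> C K t0 (if 0 \<le> u i then 1 else - 1) \<bar>y i\<bar> (a i) (g i) (b i) (t i)" if "i < n" for i
    using w[OF that] that by (simp add: g_def[abs_def])
  have gm: "g i \<in> borel_measurable borel" for i
    using wit[of i] by (cases "i < n") (auto simp: tilt_witness_def g_def[abs_def])
  then have [measurable]: "g i \<in> borel_measurable \<mu>" for i using \<mu>(2) by (simp cong: measurable_cong_sets)
  have bm: "b i \<in> borel_measurable borel" if "i < n" for i using wit[OF that] by (auto simp: tilt_witness_def)
  have g_nn: "0 \<le> g i x" for i x using wit[of i] by (cases "i < n") (auto simp: tilt_witness_def g_def)
  have g1: "(\<integral>\<^sup>+x. ennreal (g i x) \<partial>\<mu>) = 1" for i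
    using wit[of i] by (cases "i < n") (auto simp: tilt_witness_def g_def \<mu>.emeasure_space_1)
  have bC: "\<bar>b i x\<bar> \<le> C" if "i < n" for i x using wit[OF that] by (auto simp: tilt_witness_def)
  define \<nu> where "\<nu> i = density \<mu> (\<lambda>x. ennreal (g i x))" for i
  have p\<nu>: "prob_space (\<nu> i)" for i
    using g1[of i] unfolding \<nu>_def by (intro prob_spaceI) (simp add: emeasure_density cong: nn_integral_cong)
  have s\<nu>: "sets (\<nu> i) = sets borel" for i using \<mu>(2) by (simp add: \<nu>_def)
  have [measurable]: "b i \<in> borel_measurable (\<nu> i)" if "i < n" for i
    using bm[OF that] s\<nu>[of i] by (simp cong: measurable_cong_sets)
  have int\<nu>: "(\<integral>x. f x \<partial>\<nu> i) = (\<integral>x. g i x * f x \<partial>\<mu>)" if "f \<in> borel_measurable borel" for i and f :: "real \<Rightarrow> real"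
    unfolding \<nu>_def using that \<mu>(2) g_nn by (subst integral_density) (auto cong: measurable_cong_sets)
  let ?N = "PiM {..<n} \<nu>"
  let ?P = "PiM {..<n} (\<lambda>_. \<mu>)"
  interpret N: prob_space ?N by (intro prob_space_PiM p\<nu>)
  interpret P: prob_space ?P by (intro prob_space_PiM \<mu>(1))
  have Neq: "?N = density ?P (\<lambda>x. \<Prod>i<n. ennreal (g i (x i)))"
    unfolding \<nu>_def using g1 by (intro PiM_density \<mu>(1)) auto
  have setsNP: "sets ?N = sets ?P" unfolding Neq by simp
  have spaceNP: "space ?N = space ?P" using setsNP by (rule sets_eq_imp_space_eq)
  have coordP: "(\<lambda>x. f (x i)) \<in> borel_measurable ?P" if "f \<in> borel_measurable borel" "i < n" for i and f :: "real \<Rightarrow> real"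
    using that \<mu>(2) by (intro measurable_compose[OF measurable_component_singleton]) (auto cong: measurable_cong_sets)
  have lin: "(\<lambda>x. \<Sum>i<n. c i * b i (x i)) \<in> borel_measurable ?P" for c
    by (intro borel_measurable_sum borel_measurable_times borel_measurable_const coordP bm) auto
  have linN: "(\<lambda>x. \<Sum>i<n. c i * b i (x i)) \<in> borel_measurable ?N" for c
    using lin[of c] setsNP by (simp cong: measurable_cong_sets)
  \<comment> \<open>The coefficients stay arbitrary because this serves both \<open>S\<close>, with
    \<open>\<bar>u i\<bar>\<close>, and \<open>V\<close>, with \<open>t i\<close>.\<close>
  have mom: "N.expectation (\<lambda>x. \<Sum>i<n. c i * b i (x i)) = 0 \<and>
    N.expectation (\<lambda>x. (\<Sum>i<n. c i * b i (x i))\<^sup>2) = (\<Sum>i<n. N.expectation (\<lambda>x. (c i * b i (x i))\<^sup>2)) \<and>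
    N.expectation (\<lambda>x. (\<Sum>i<n. c i * b i (x i)) ^ 4) \<le> K * (N.expectation (\<lambda>x. (\<Sum>i<n. c i * b i (x i))\<^sup>2))\<^sup>2"
    for c
  proof -
    have ind: "N.indep_vars (\<lambda>_. borel) (\<lambda>i x. c i * b i (x i)) {..<n}"
      by (rule indep_vars_PiM_coordinates[where f = "\<lambda>i x. c i * b i x"]) (auto intro: p\<nu>)
    have bd: "\<bar>c i * b i (x i)\<bar> \<le> \<bar>c i\<bar> * C" if "i \<in> {..<n}" for i and x :: "nat \<Rightarrow> real"
      using bC[of i "x i"] that by (auto simp: abs_mult intro!: mult_left_mono)
    have E: "N.expectation (\<lambda>x. f (b i (x i))) = (\<integral>x. g i x * f (b i x) \<partial>\<mu>)"
      if i: "i < n" and f: "f \<in> borel_measurable borel" for i and f :: "real \<Rightarrow> real"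
      using int\<nu>[of "\<lambda>x. f (b i x)" i] measurable_compose[OF bm[OF i] f] i
        integral_PiM_coordinate[of "{..<n}" \<nu> i "\<lambda>x. f (b i x)"] p\<nu> s\<nu>[of i]
      by (simp cong: measurable_cong_sets)
    have m0: "N.expectation (\<lambda>x. c i * b i (x i)) = 0" if "i \<in> {..<n}" for i
      using E[of i "\<lambda>x. x"] that wit[of i] by (simp add: tilt_witness_def)
    have m4: "N.expectation (\<lambda>x. (c i * b i (x i)) ^ 4) \<le> K * (N.expectation (\<lambda>x. (c i * b i (x i))\<^sup>2))\<^sup>2"
      if i: "i \<in> {..<n}" for i
    proof -
      have "N.expectation (\<lambda>x. (c i * b i (x i)) ^ 4) = c i ^ 4 * (\<integral>x. g i x * b i x ^ 4 \<partial>\<mu>)"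
        using E[of i "\<lambda>x. x ^ 4"] i by (simp add: power_mult_distrib)
      also have "\<dots> \<le> c i ^ 4 * (K * (\<integral>x. g i x * (b i x)\<^sup>2 \<partial>\<mu>)\<^sup>2)"
        using wit[of i] i by (intro mult_left_mono) (auto simp: tilt_witness_def)
      also have "\<dots> = K * ((c i)\<^sup>2 * (\<integral>x. g i x * (b i x)\<^sup>2 \<partial>\<mu>))\<^sup>2"
        by (simp add: power2_eq_square power4_eq_xxxx)
      also have "(c i)\<^sup>2 * (\<integral>x. g i x * (b i x)\<^sup>2 \<partial>\<mu>) = N.expectation (\<lambda>x. (c i * b i (x i))\<^sup>2)"
        using E[of i "\<lambda>x. x\<^sup>2"] i by (simp add: power_mult_distrib)
      finally show ?thesis .
    qed
    note moments = N.indep_centered_bounded_sum_moments[OF finite_lessThan ind, of "\<lambda>i. \<bar>c i\<bar> * C"]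
    show ?thesis
      by (intro conjI moments(1,2,3) bd m0 m4 K) auto
  qed
  define S where "S x = (\<Sum>i<n. \<bar>u i\<bar> * b i (x i))" for x
  define V where "V x = (\<Sum>i<n. t i * b i (x i))" for x
  have SmP[measurable]: "S \<in> borel_measurable ?P" "V \<in> borel_measurable ?P"
    unfolding S_def[abs_def] V_def[abs_def] by (rule lin)+
  have SmN[measurable]: "S \<in> borel_measurable ?N" "V \<in> borel_measurable ?N"
    unfolding S_def[abs_def] V_def[abs_def] by (rule linN)+
  have Sbd: "\<bar>S x\<bar> \<le> (\<Sum>i<n. \<bar>u i\<bar> * C)" for x
    unfolding S_def using bC by (intro order_trans[OF sum_abs] sum_mono) (auto simp: abs_mult intro!: mult_left_mono)
  have 1: "1 / (6 * K\<^sup>2) \<le> N.prob {x\<in>space ?N. 0 \<le> S x}"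
    using mom[of "\<lambda>i. \<bar>u i\<bar>"] by (intro N.prob_nonneg_ge_of_fourth_moment[OF SmN(1) Sbd _ K]) (auto simp: S_def)
  have tb: "\<bar>t i * b i x\<bar> \<le> t0 * C" if "i < n" for i x
    using bC[OF that, of x] wit[OF that] unfolding abs_mult by (intro mult_mono) (auto simp: tilt_witness_def)
  have tb2: "(t i * b i x)\<^sup>2 \<le> t0\<^sup>2 * C\<^sup>2" if "i < n" for i x
    using power_mono[OF tb[OF that, of x], of 2] by (simp add: power_mult_distrib)
  have Vbd: "\<bar>V x\<bar> \<le> (\<Sum>i<n. t0 * C)" for x
    unfolding V_def using tb by (intro order_trans[OF sum_abs] sum_mono) auto
  have "(V x)\<^sup>2 \<le> (\<Sum>i<n. t0 * C)\<^sup>2" for x using power_mono[OF Vbd[of x], of 2] by simp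
  then have intV: "integrable ?N (\<lambda>x. (V x)\<^sup>2)"
    by (intro N.integrable_const_bound[of _ "(\<Sum>i<n. t0 * C)\<^sup>2"]) auto
  have "N.expectation (\<lambda>x. (V x)\<^sup>2) = (\<Sum>i<n. N.expectation (\<lambda>x. (t i * b i (x i))\<^sup>2))"
    using mom[of t] by (simp add: V_def)
  also have "\<dots> \<le> (\<Sum>i<n. t0\<^sup>2 * C\<^sup>2)"
  proof (rule sum_mono)
    fix i assume i: "i \<in> {..<n}"
    have "(\<lambda>x. b i (x i)) \<in> borel_measurable ?N"
      using coordP[OF bm, of i] i setsNP by (simp cong: measurable_cong_sets)
    then have "integrable ?N (\<lambda>x. (t i * b i (x i))\<^sup>2)"
      using tb2 i by (intro N.integrable_const_bound[of _ "t0\<^sup>2 * C\<^sup>2"]) auto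
    then show "N.expectation (\<lambda>x. (t i * b i (x i))\<^sup>2) \<le> t0\<^sup>2 * C\<^sup>2"
      using tb2 i by (intro N.integral_le_const) auto
  qed
  finally have V2: "N.expectation (\<lambda>x. (V x)\<^sup>2) \<le> real n * (t0\<^sup>2 * C\<^sup>2)" by simp
  have "N.prob {x\<in>space ?N. \<eta> * real n < V x} \<le> N.expectation (\<lambda>x. (V x)\<^sup>2) / (\<eta> * real n)\<^sup>2"
    using \<open>0 < \<eta>\<close> n by (intro N.second_moment_tail intV) auto
  also have "\<dots> \<le> real n * (t0\<^sup>2 * C\<^sup>2) / (\<eta> * real n)\<^sup>2" using V2 by (intro divide_right_mono) auto
  also have "\<dots> = t0\<^sup>2 * C\<^sup>2 / (\<eta>\<^sup>2 * real n)" using n by (simp add: power2_eq_square)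
  also have "\<dots> \<le> 1 / (12 * K\<^sup>2)"
    using n K \<open>0 < \<eta>\<close> by (simp add: pos_divide_le_eq pos_le_divide_eq mult_ac)
  finally have 2: "N.prob {x\<in>space ?N. \<eta> * real n < V x} \<le> 1 / (12 * K\<^sup>2)" .
  define A where "A = {x\<in>space ?P. 0 \<le> S x \<and> V x \<le> \<eta> * real n}"
  have AmP: "A \<in> sets ?P" unfolding A_def by measurable
  have AmN: "A \<in> sets ?N" by (subst setsNP) (rule AmP)
  have VmN: "{x\<in>space ?N. \<eta> * real n < V x} \<in> sets ?N" by measurable
  have "N.prob {x\<in>space ?N. 0 \<le> S x} \<le> N.prob (A \<union> {x\<in>space ?N. \<eta> * real n < V x})"
    using AmN VmN by (intro N.finite_measure_mono sets.Un) (auto simp: A_def spaceNP)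
  also have "\<dots> \<le> N.prob A + N.prob {x\<in>space ?N. \<eta> * real n < V x}"
    using AmN VmN by (rule measure_Un_le)
  finally have 3: "1 / (12 * K\<^sup>2) \<le> N.prob A" using 1 2 by simp
  define H where "H = {x\<in>space ?P. 0 \<le> (\<Sum>i<n. u i * (x i - y i))}"
  have "(\<lambda>x. \<Sum>i<n. u i * (x i - y i)) \<in> borel_measurable ?P"
    by (intro borel_measurable_sum borel_measurable_times borel_measurable_const coordP[of "\<lambda>x. x - y _"]) auto
  then have Hm: "H \<in> sets ?P" unfolding H_def by measurable
  define L where "L = exp ((\<Sum>i<n. a i) + \<eta> * real n)"
  have "emeasure ?N A = (\<integral>\<^sup>+x. (\<Prod>i<n. ennreal (g i (x i))) * indicator A x \<partial>?P)"
    unfolding Neq using AmP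
    by (intro emeasure_density borel_measurable_prod_ennreal measurable_compose[OF measurable_component_singleton]) auto
  also have "\<dots> \<le> (\<integral>\<^sup>+x. ennreal L * indicator H x \<partial>?P)"
  proof (intro nn_integral_mono)
    fix x assume x: "x \<in> space ?P"
    show "(\<Prod>i<n. ennreal (g i (x i))) * indicator A x \<le> ennreal L * indicator H x"
    proof (cases "x \<in> A \<and> (\<forall>i<n. 0 < g i (x i))")
      case True
      \<comment> \<open>Replacing \<open>y i\<close> by \<open>\<bar>y i\<bar>\<close> only shrinks
        the half-space, whatever the sign of \<open>u i\<close>.\<close>
      have "\<bar>u i\<bar> * b i (x i) \<le> u i * (x i - y i)" if i: "i < n" for i
      proof -
        have "b i (x i) \<le> (if 0 \<le> u i then 1 else - 1) * x i - \<bar>y i\<bar>"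
          using wit[OF i] True i by (auto simp: tilt_witness_def)
        then have "\<bar>u i\<bar> * b i (x i) \<le> \<bar>u i\<bar> * ((if 0 \<le> u i then 1 else - 1) * x i - \<bar>y i\<bar>)"
          by (intro mult_left_mono) auto
        also have "\<dots> = u i * x i - \<bar>u i * y i\<bar>" by (auto simp: algebra_simps abs_mult)
        also have "\<dots> \<le> u i * (x i - y i)" by (simp add: right_diff_distrib)
        finally show ?thesis .
      qed
      then have "S x \<le> (\<Sum>i<n. u i * (x i - y i))" unfolding S_def by (intro sum_mono) auto
      then have xH: "x \<in> H" using True x by (auto simp: A_def H_def)
      have "(\<Prod>i<n. g i (x i)) \<le> (\<Prod>i<n. exp (a i + t i * b i (x i)))"
        using wit True by (intro prod_mono) (auto simp: tilt_witness_def intro: less_imp_le)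
      also have "\<dots> = exp ((\<Sum>i<n. a i) + V x)" by (simp add: exp_sum[symmetric] sum.distrib V_def)
      also have "\<dots> \<le> L" unfolding L_def using True by (auto simp: A_def)
      finally have "ennreal (\<Prod>i<n. g i (x i)) \<le> ennreal L" by (rule ennreal_leI)
      then show ?thesis using xH True g_nn by (simp add: prod_ennreal)
    next
      case False
      then show ?thesis
      proof (cases "x \<in> A")
        case True
        then obtain i where "i < n" "\<not> 0 < g i (x i)" using False by auto
        then have "i < n" "g i (x i) = 0" using g_nn[of i "x i"] by auto
        then have "(\<Prod>i<n. ennreal (g i (x i))) = 0" by (auto intro!: prod_zero bexI[of _ i])
        then show ?thesis by (simp only: mult_zero_left zero_le)
      qed simp
    qed
  qed
  also have "\<dots> = ennreal L * emeasure ?P H" using Hm by (rule nn_integral_cmult_indicator)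
  finally have "ennreal (N.prob A) \<le> ennreal (L * P.prob H)"
    by (simp add: N.emeasure_eq_measure P.emeasure_eq_measure ennreal_mult' L_def)
  then have "N.prob A \<le> L * P.prob H" by (simp add: L_def)
  with 3 have "1 / (12 * K\<^sup>2) \<le> L * P.prob H" by simp
  then have "exp (- (\<Sum>i<n. a i) - \<eta> * real n) * (1 / (12 * K\<^sup>2))
      \<le> exp (- (\<Sum>i<n. a i) - \<eta> * real n) * (L * P.prob H)" by (intro mult_left_mono) auto
  also have "\<dots> = P.prob H" by (simp add: L_def flip: mult.assoc exp_add)
  finally show ?thesis by (simp add: mu_n_def H_def)
qed

subsection \<open>Truncated moment generating functions\<close>

lemma abs_exp_taylor2_le: "\<bar>exp a - 1 - a\<bar> \<le> a\<^sup>2 * exp \<bar>a\<bar>" for a :: real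
proof -
  obtain s where s: "\<bar>s\<bar> \<le> \<bar>a\<bar>" "exp a = (\<Sum>m<2. a ^ m / fact m) + exp s / fact 2 * a ^ 2"
    using Maclaurin_exp_le[of a 2] by auto
  have "exp a - 1 - a = exp s / 2 * a\<^sup>2" using s(2) by (simp add: numeral_2_eq_2)
  then have "\<bar>exp a - 1 - a\<bar> = \<bar>exp s / 2 * a\<^sup>2\<bar>" by (rule arg_cong)
  also have "\<dots> = a\<^sup>2 * (exp s / 2)" by (simp add: abs_mult)
  also have "\<dots> \<le> a\<^sup>2 * exp \<bar>a\<bar>"
  proof (rule mult_left_mono)
    have "exp s \<le> exp \<bar>a\<bar>" using s(1) by auto
    then show "exp s / 2 \<le> exp \<bar>a\<bar>" using exp_gt_zero[of "\<bar>a\<bar>"] by linarith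
  qed simp
  finally show ?thesis .
qed

text \<open>Differentiation under the integral through a remainder of second order that is uniform
  in \<open>x\<close>, since \<open>d\<close> is bounded. The factor \<open>k\<close> leaves room
  for a truncating indicator.\<close>

lemma (in prob_space) exp_integral_DERIV:
  fixes k d :: "'a \<Rightarrow> real"
  assumes [measurable]: "k \<in> borel_measurable M" "d \<in> borel_measurable M"
    and k: "\<And>x. \<bar>k x\<bar> \<le> 1" and d: "\<And>x. \<bar>d x\<bar> \<le> R"
  shows "((\<lambda>t. \<integral>x. k x * exp (t * d x) \<partial>M) has_real_derivative (\<integral>x. k x * d x * exp (t * d x) \<partial>M)) (at t)"
proof -
  have R: "0 \<le> R" using d[of undefined] by linarith
  have eb: "exp (t * d x) \<le> exp (\<bar>t\<bar> * R)" for t x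
  proof -
    have "t * d x \<le> \<bar>t\<bar> * \<bar>d x\<bar>" by (metis abs_ge_self abs_mult)
    also have "\<dots> \<le> \<bar>t\<bar> * R" using d by (intro mult_left_mono) auto
    finally show ?thesis by simp
  qed
  have ke: "\<bar>k x * exp (t * d x)\<bar> \<le> exp (\<bar>t\<bar> * R)" for t x
    using mult_mono[OF k[of x] eb[of t x]] by (simp add: abs_mult)
  have kde: "\<bar>k x * d x * exp (t * d x)\<bar> \<le> R * exp (\<bar>t\<bar> * R)" for t x
    using mult_mono[OF d[of x] ke[of x t] R] by (simp add: abs_mult mult_ac)
  have i1: "integrable M (\<lambda>x. k x * exp (t * d x))" for t
    by (rule integrable_const_bound[of _ "exp (\<bar>t\<bar> * R)"]) (use ke in auto)
  have i2: "integrable M (\<lambda>x. k x * d x * exp (t * d x))" for t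
    by (rule integrable_const_bound[of _ "R * exp (\<bar>t\<bar> * R)"]) (use kde in auto)
  \<comment> \<open>The first factor bounds \<open>k x * exp (t * d x)\<close>; the second bounds
    the Taylor remainder of \<open>exp (s * d x)\<close>, divided by \<open>s\<^sup>2\<close>, for
    \<open>\<bar>s\<bar> \<le> 1\<close>.\<close>
  define B where "B = exp (\<bar>t\<bar> * R) * (R\<^sup>2 * exp R)"
  define F where "F t = (\<integral>x. k x * exp (t * d x) \<partial>M)" for t
  define A where "A = (\<integral>x. k x * d x * exp (t * d x) \<partial>M)"
  have bound: "\<bar>F (t + s) - F t - s * A\<bar> \<le> B * s\<^sup>2" if s: "\<bar>s\<bar> \<le> 1" for s
  proof -
    have "F (t + s) - F t - s * A
        = (\<integral>x. k x * exp ((t + s) * d x) - k x * exp (t * d x) - s * (k x * d x * exp (t * d x)) \<partial>M)"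
      unfolding F_def A_def using i1 i2 by simp
    also have "\<dots> = (\<integral>x. k x * exp (t * d x) * (exp (s * d x) - 1 - s * d x) \<partial>M)"
      by (intro Bochner_Integration.integral_cong refl) (simp add: distrib_right exp_add algebra_simps)
    also have "\<bar>\<dots>\<bar> \<le> (\<integral>x. \<bar>k x * exp (t * d x) * (exp (s * d x) - 1 - s * d x)\<bar> \<partial>M)"
      by (rule integral_abs_bound)
    also have "\<dots> \<le> B * s\<^sup>2"
    proof -
      have p: "\<bar>k x * exp (t * d x) * (exp (s * d x) - 1 - s * d x)\<bar> \<le> B * s\<^sup>2" for x
      proof -
        have "\<bar>s * d x\<bar> \<le> 1 * R" unfolding abs_mult using s d by (intro mult_mono) auto
        then have e: "exp \<bar>s * d x\<bar> \<le> exp R" by simp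
        have "(s * d x)\<^sup>2 \<le> s\<^sup>2 * R\<^sup>2"
          using power_mono[OF d[of x], of 2] by (simp add: power_mult_distrib mult_left_mono)
        then have "(s * d x)\<^sup>2 * exp \<bar>s * d x\<bar> \<le> s\<^sup>2 * R\<^sup>2 * exp R" using e by (intro mult_mono) auto
        then have "\<bar>exp (s * d x) - 1 - s * d x\<bar> \<le> s\<^sup>2 * R\<^sup>2 * exp R"
          using abs_exp_taylor2_le[of "s * d x"] by linarith
        then have "\<bar>k x * exp (t * d x)\<bar> * \<bar>exp (s * d x) - 1 - s * d x\<bar>
            \<le> exp (\<bar>t\<bar> * R) * (s\<^sup>2 * R\<^sup>2 * exp R)"
          using ke[of x t] by (intro mult_mono) auto
        then show ?thesis unfolding abs_mult[of "k x * exp (t * d x)"] B_def by (simp add: mult_ac)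
      qed
      have "integrable M (\<lambda>x. \<bar>k x * exp (t * d x) * (exp (s * d x) - 1 - s * d x)\<bar>)"
        by (rule integrable_const_bound[of _ "B * s\<^sup>2"]) (use p in auto)
      then show ?thesis by (rule integral_le_const) (use p in auto)
    qed
    finally show ?thesis .
  qed
  have "((\<lambda>s. (F (t + s) - F t) / s - A) \<longlongrightarrow> 0) (at 0)"
  proof (rule Lim_null_comparison[where g = "\<lambda>s. B * \<bar>s\<bar>"])
    have "\<forall>\<^sub>F s in at 0. s \<noteq> (0::real) \<and> \<bar>s\<bar> \<le> 1"
      unfolding eventually_at by (intro exI[of _ 1]) auto
    then show "\<forall>\<^sub>F s in at 0. norm ((F (t + s) - F t) / s - A) \<le> B * \<bar>s\<bar>"
    proof eventually_elim
      case (elim s)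
      have "(F (t + s) - F t) / s - A = (F (t + s) - F t - s * A) / s" using elim by (simp add: field_simps)
      then have "\<bar>(F (t + s) - F t) / s - A\<bar> = \<bar>F (t + s) - F t - s * A\<bar> / \<bar>s\<bar>" by simp
      also have "\<dots> \<le> B * s\<^sup>2 / \<bar>s\<bar>" using bound[of s] elim by (intro divide_right_mono) auto
      also have "B * s\<^sup>2 / \<bar>s\<bar> = B * \<bar>s\<bar>" using elim by (simp add: power2_eq_square abs_if)
      finally show ?case by simp
    qed
    show "((\<lambda>s. B * \<bar>s\<bar>) \<longlongrightarrow> 0) (at 0)" by (auto intro!: tendsto_eq_intros)
  qed
  then have "((\<lambda>s. (F (t + s) - F t) / s) \<longlongrightarrow> A) (at 0)" by (rule LIM_zero_cancel)
  then show ?thesis unfolding DERIV_def F_def A_def .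
qed

text \<open>The truncated measure is not renormalised, so this is finite for every \<open>t\<close>
  and increases with \<open>M\<close>, and \<open>mgf\<close> is its supremum.\<close>

definition trunc_mgf :: "real measure \<Rightarrow> real \<Rightarrow> real \<Rightarrow> real" where
  "trunc_mgf \<mu> M t = (\<integral>x. indicator {-M..M} x * exp (t * x) \<partial>\<mu>)"

lemma integrable_trunc_exp:
  assumes "prob_space \<mu>" "sets \<mu> = sets borel"
  shows "integrable \<mu> (\<lambda>x. indicator {-M..M} x * exp (t * x) :: real)"
proof -
  interpret prob_space \<mu> by fact
  note [measurable_cong] = assms(2)
  have "\<bar>indicator {-M..M} x * exp (t * x)\<bar> \<le> exp (\<bar>t\<bar> * \<bar>M\<bar>)" for x
  proof (cases "x \<in> {-M..M}")
    case True
    have "t * x \<le> \<bar>t\<bar> * \<bar>x\<bar>" by (metis abs_ge_self abs_mult)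
    also have "\<dots> \<le> \<bar>t\<bar> * \<bar>M\<bar>" using True by (intro mult_left_mono) auto
    finally show ?thesis using True by simp
  qed simp
  then show ?thesis
    by (intro integrable_const_bound[of _ "exp (\<bar>t\<bar> * \<bar>M\<bar>)"]) auto
qed

lemma trunc_mgf_mono:
  assumes "prob_space \<mu>" "sets \<mu> = sets borel" "M \<le> M'"
  shows "trunc_mgf \<mu> M t \<le> trunc_mgf \<mu> M' t"
  unfolding trunc_mgf_def using assms
  by (intro integral_mono integrable_trunc_exp) (auto simp: indicator_def)

lemma trunc_mgf_pos:
  assumes "prob_space \<mu>" "sets \<mu> = sets borel" "0 < measure \<mu> {-M..M}"
  shows "0 < trunc_mgf \<mu> M t"
proof -
  interpret prob_space \<mu> by fact
  note [measurable_cong] = assms(2)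
  have "0 < measure \<mu> {-M..M} * exp (- (\<bar>t\<bar> * \<bar>M\<bar>))" using assms by simp
  also have "\<dots> = (\<integral>x. indicator {-M..M} x * exp (- (\<bar>t\<bar> * \<bar>M\<bar>)) \<partial>\<mu>)" using assms by simp
  also have "\<dots> \<le> trunc_mgf \<mu> M t" unfolding trunc_mgf_def
  proof (rule integral_mono[OF _ integrable_trunc_exp[OF assms(1,2)]])
    show "integrable \<mu> (\<lambda>x. indicator {-M..M} x * exp (- (\<bar>t\<bar> * \<bar>M\<bar>)) :: real)"
      using assms(2) by (intro integrable_mult_left integrable_real_indicator) (auto simp: emeasure_eq_measure)
    fix x
    show "indicator {-M..M} x * exp (- (\<bar>t\<bar> * \<bar>M\<bar>)) \<le> indicator {-M..M} x * exp (t * x)"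
    proof (cases "x \<in> {-M..M}")
      case True
      have "- (t * x) \<le> \<bar>t\<bar> * \<bar>x\<bar>" by (metis abs_ge_minus_self abs_mult)
      also have "\<dots> \<le> \<bar>t\<bar> * \<bar>M\<bar>" using True by (intro mult_left_mono) auto
      finally show ?thesis using True by simp
    qed simp
  qed
  finally show ?thesis .
qed

lemma isCont_trunc_mgf:
  assumes "prob_space \<mu>" "sets \<mu> = sets borel"
  shows "isCont (trunc_mgf \<mu> M) t"
proof -
  interpret prob_space \<mu> by fact
  note [measurable_cong] = assms(2)
  \<comment> \<open>The second indicator changes nothing where the first is 1 and makes the exponent
    bounded, as \<open>exp_integral_DERIV\<close> requires.\<close>
  have "trunc_mgf \<mu> M = (\<lambda>t. \<integral>x. indicator {-M..M} x * exp (t * (indicator {-M..M} x * x)) \<partial>\<mu>)"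
    unfolding trunc_mgf_def by (intro ext Bochner_Integration.integral_cong) (auto simp: indicator_def)
  moreover have "isCont (\<lambda>t. \<integral>x. indicator {-M..M} x * exp (t * (indicator {-M..M} x * x)) \<partial>\<mu>) t"
    by (rule DERIV_isCont[OF exp_integral_DERIV[where R = "\<bar>M\<bar>"]]) (auto simp: indicator_def)
  ultimately show ?thesis by simp
qed

text \<open>Monotone convergence, valid also where \<open>mgf\<close> is infinite. The offset
  \<open>k\<close> lets the sequence start at a truncation that already carries mass.\<close>

lemma mgf_eq_SUP_trunc_mgf:
  assumes "prob_space \<mu>" "sets \<mu> = sets borel"
  shows "mgf \<mu> t = (SUP j::nat. ennreal (trunc_mgf \<mu> (real (k + j)) t))"
proof -
  note [measurable_cong] = assms(2)
  have e: "ennreal (trunc_mgf \<mu> M t) = (\<integral>\<^sup>+x. ennreal (indicator {-M..M} x * exp (t * x)) \<partial>\<mu>)" for M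
    unfolding trunc_mgf_def using integrable_trunc_exp[OF assms]
    by (intro nn_integral_eq_integral[symmetric]) auto
  have "mgf \<mu> t = (\<integral>\<^sup>+x. (SUP j::nat. ennreal (indicator {-real (k + j)..real (k + j)} x * exp (t * x))) \<partial>\<mu>)"
    unfolding mgf_def
  proof (rule nn_integral_cong)
    fix x
    show "ennreal (exp (t * x)) = (SUP j::nat. ennreal (indicator {-real (k + j)..real (k + j)} x * exp (t * x)))"
    proof (rule antisym)
      obtain j :: nat where "\<bar>x\<bar> \<le> real j" using real_arch_simple by blast
      then have "ennreal (exp (t * x)) \<le> ennreal (indicator {-real (k + j)..real (k + j)} x * exp (t * x))"
        by (auto simp: indicator_def)
      then show "ennreal (exp (t * x)) \<le> (SUP j::nat. ennreal (indicator {-real (k + j)..real (k + j)} x * exp (t * x)))"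
        by (rule SUP_upper2[OF UNIV_I])
    qed (auto intro!: SUP_least ennreal_leI simp: indicator_def)
  qed
  also have "\<dots> = (SUP j::nat. ennreal (trunc_mgf \<mu> (real (k + j)) t))"
    unfolding e
    by (intro nn_integral_monotone_convergence_SUP)
      (auto simp: incseq_def le_fun_def indicator_def intro!: ennreal_leI)
  finally show ?thesis .
qed

text \<open>A Dini-type argument: truncation costs arbitrarily little, uniformly over compact sets of
  slopes and positions, even where the moment generating function is infinite.\<close>
lemma trunc_legendre_le:
  assumes \<mu>: "prob_space \<mu>" "sets \<mu> = sets borel"
    and L: "\<And>s y. \<lbrakk>0 \<le> y; y \<le> x0; mgf \<mu> s < \<infinity>\<rbrakk> \<Longrightarrow> s * y - ln (enn2real (mgf \<mu> s)) \<le> L y"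
    and pos: "0 < measure \<mu> {-real k..real k}" and "0 < \<eta>"
  shows "\<exists>m::nat. k \<le> m \<and> (\<forall>t y. \<bar>t\<bar> \<le> t0 \<longrightarrow> 0 \<le> y \<longrightarrow> y \<le> x0 \<longrightarrow> t * y - ln (trunc_mgf \<mu> (real m) t) \<le> L y + \<eta>)"
proof (rule ccontr)
  assume "\<not> ?thesis"
  then have "\<forall>j::nat. \<exists>p. \<bar>fst p\<bar> \<le> t0 \<and> 0 \<le> snd p \<and> snd p \<le> x0 \<and>
      L (snd p) + \<eta> < fst p * snd p - ln (trunc_mgf \<mu> (real (k + j)) (fst p))"
    by (metis fst_conv snd_conv le_add1 not_le)
  then obtain p where p: "\<And>j::nat. \<bar>fst (p j)\<bar> \<le> t0 \<and> 0 \<le> snd (p j) \<and> snd (p j) \<le> x0 \<and>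
      L (snd (p j)) + \<eta> < fst (p j) * snd (p j) - ln (trunc_mgf \<mu> (real (k + j)) (fst (p j)))"
    by metis
  interpret \<mu>: prob_space \<mu> by fact
  have zpos: "0 < trunc_mgf \<mu> (real (k + j)) t" for j t
  proof (rule trunc_mgf_pos[OF \<mu>])
    have "measure \<mu> {-real k..real k} \<le> measure \<mu> {-real (k + j)..real (k + j)}"
      using \<mu>(2) by (intro \<mu>.finite_measure_mono) auto
    then show "0 < measure \<mu> {-real (k + j)..real (k + j)}" using pos by linarith
  qed
  have "compact ({-t0..t0} \<times> {0..x0})" by (intro compact_Times compact_Icc)
  moreover have "\<forall>j. p j \<in> {-t0..t0} \<times> {0..x0}" using p by (auto simp: mem_Times_iff abs_le_iff minus_le_iff)
  ultimately obtain l r where r: "strict_mono r" "(p \<circ> r) \<longlonglongrightarrow> l"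
    unfolding compact_def by metis
  define t where "t = fst l"
  define y where "y = snd l"
  have tl: "(\<lambda>i. fst (p (r i))) \<longlonglongrightarrow> t" and yl: "(\<lambda>i. snd (p (r i))) \<longlonglongrightarrow> y"
    using tendsto_fst[OF r(2)] tendsto_snd[OF r(2)] by (auto simp: t_def y_def comp_def)
  \<comment> \<open>\<open>L\<close> need not be continuous, so it is first bounded below by
    \<open>s * y - ln (enn2real (mgf \<mu> s))\<close>, which is continuous in \<open>y\<close>.
    Monotonicity in the truncation level allows \<open>j\<close> to stay fixed while the subsequence
    runs to its limit.\<close>
  have key: "s * y - ln (enn2real (mgf \<mu> s)) + \<eta> \<le> t * y - ln (trunc_mgf \<mu> (real (k + j)) t)"
    if s: "mgf \<mu> s < \<infinity>" for s j
  proof (rule LIMSEQ_le)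
    show "(\<lambda>i. s * snd (p (r i)) - ln (enn2real (mgf \<mu> s)) + \<eta>) \<longlonglongrightarrow> s * y - ln (enn2real (mgf \<mu> s)) + \<eta>"
      by (intro tendsto_intros yl)
    have "(\<lambda>i. trunc_mgf \<mu> (real (k + j)) (fst (p (r i)))) \<longlonglongrightarrow> trunc_mgf \<mu> (real (k + j)) t"
      by (rule isCont_tendsto_compose[OF isCont_trunc_mgf[OF \<mu>] tl])
    then show "(\<lambda>i. fst (p (r i)) * snd (p (r i)) - ln (trunc_mgf \<mu> (real (k + j)) (fst (p (r i)))))
        \<longlonglongrightarrow> t * y - ln (trunc_mgf \<mu> (real (k + j)) t)"
      using zpos[of j t] by (intro tendsto_intros tl yl) auto
    show "\<exists>N. \<forall>i\<ge>N. s * snd (p (r i)) - ln (enn2real (mgf \<mu> s)) + \<eta>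
        \<le> fst (p (r i)) * snd (p (r i)) - ln (trunc_mgf \<mu> (real (k + j)) (fst (p (r i))))"
    proof (intro exI[of _ j] allI impI)
      fix i assume "j \<le> i"
      then have ji: "j \<le> r i" using seq_suble[OF r(1), of i] by linarith
      have "ln (trunc_mgf \<mu> (real (k + j)) (fst (p (r i)))) \<le> ln (trunc_mgf \<mu> (real (k + r i)) (fst (p (r i))))"
        using zpos ji by (subst ln_le_cancel_iff) (auto intro!: trunc_mgf_mono[OF \<mu>] simp del: of_nat_add)
      moreover have "s * snd (p (r i)) - ln (enn2real (mgf \<mu> s)) \<le> L (snd (p (r i)))"
        using p[of "r i"] s by (intro L) auto
      ultimately show "s * snd (p (r i)) - ln (enn2real (mgf \<mu> s)) + \<eta>
        \<le> fst (p (r i)) * snd (p (r i)) - ln (trunc_mgf \<mu> (real (k + j)) (fst (p (r i))))"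
        using p[of "r i"] by linarith
    qed
  qed
  \<comment> \<open>Taking \<open>s = 0\<close> in \<open>key\<close> bounds all truncations at the
    limit slope \<open>t\<close>, so \<open>mgf\<close> is finite there and \<open>s = t\<close>
    becomes admissible.\<close>
  have mgf0: "mgf \<mu> 0 = 1" by (simp add: mgf_def \<mu>.emeasure_space_1)
  have "trunc_mgf \<mu> (real (k + j)) t \<le> exp (t * y)" for j
  proof -
    have "ln (trunc_mgf \<mu> (real (k + j)) t) \<le> t * y" using key[of 0 j] mgf0 \<open>0 < \<eta>\<close> by simp
    then show ?thesis using zpos[of j t] by (metis exp_le_cancel_iff exp_ln)
  qed
  then have "mgf \<mu> t \<le> ennreal (exp (t * y))"
    unfolding mgf_eq_SUP_trunc_mgf[OF \<mu>, of t k] by (intro SUP_least ennreal_leI)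
  then have fin: "mgf \<mu> t < \<infinity>" by (rule le_less_trans) simp
  define m where "m = enn2real (mgf \<mu> t)"
  have m: "mgf \<mu> t = ennreal m" using fin by (simp add: m_def less_top)
  have "ennreal (trunc_mgf \<mu> (real (k + 0)) t) \<le> ennreal m"
    unfolding m[symmetric] mgf_eq_SUP_trunc_mgf[OF \<mu>, of t k] by (rule SUP_upper[OF UNIV_I])
  moreover have "0 \<le> m" by (simp add: m_def)
  ultimately have "trunc_mgf \<mu> (real (k + 0)) t \<le> m" by (subst (asm) ennreal_le_iff)
  then have mpos: "0 < m" using zpos[of 0 t] by linarith
  \<comment> \<open>With \<open>s = t\<close> every truncation stays below \<open>mgf\<close> by the
    fixed factor \<open>exp (- \<eta>)\<close>, although \<open>mgf\<close> is their
    supremum.\<close>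
  have "trunc_mgf \<mu> (real (k + j)) t \<le> m * exp (- \<eta>)" for j
  proof -
    have "ln (trunc_mgf \<mu> (real (k + j)) t) \<le> ln m - \<eta>" using key[OF fin, of j] by (simp add: m_def)
    then have "exp (ln (trunc_mgf \<mu> (real (k + j)) t)) \<le> exp (ln m - \<eta>)" by simp
    then show ?thesis using zpos[of j t] mpos by (simp add: exp_diff exp_minus divide_inverse)
  qed
  then have "ennreal m \<le> ennreal (m * exp (- \<eta>))"
    unfolding m[symmetric] mgf_eq_SUP_trunc_mgf[OF \<mu>, of t k] by (intro SUP_least ennreal_leI)
  then have "m \<le> m * exp (- \<eta>)" using mpos by (subst (asm) ennreal_le_iff) auto
  then show False using mpos \<open>0 < \<eta>\<close> by simp
qed

subsection \<open>One-dimensional changes of measure\<close>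

lemma tilt_witness_cost_mono:
  assumes "tilt_witness \<mu> C K t0 \<sigma> z a g b t" "a \<le> a'"
  shows "tilt_witness \<mu> C K t0 \<sigma> z a' g b t"
proof -
  have "g x \<le> exp (a' + t * b x)" if "0 < g x" for x
  proof -
    have "g x \<le> exp (a + t * b x)" using assms(1) that by (auto simp: tilt_witness_def)
    also have "\<dots> \<le> exp (a' + t * b x)" using assms(2) by simp
    finally show ?thesis .
  qed
  then show ?thesis using assms(1) by (auto simp: tilt_witness_def)
qed

lemma
  fixes f :: "real \<Rightarrow> real" and h :: "real \<Rightarrow> ennreal"
  assumes "sets \<mu> = sets borel" "distr \<mu> borel uminus = \<mu>"
  shows integral_reflect_even: "f \<in> borel_measurable borel \<Longrightarrow> (\<integral>x. f (- x) \<partial>\<mu>) = (\<integral>x. f x \<partial>\<mu>)"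
    and nn_integral_reflect_even: "h \<in> borel_measurable borel \<Longrightarrow> (\<integral>\<^sup>+x. h (- x) \<partial>\<mu>) = (\<integral>\<^sup>+x. h x \<partial>\<mu>)"
    and measure_reflect_even: "A \<in> sets borel \<Longrightarrow> measure \<mu> (uminus -` A) = measure \<mu> A"
proof -
  have m: "uminus \<in> measurable \<mu> borel"
    using assms(1) by (auto cong: measurable_cong_sets)
  show "(\<integral>x. f (- x) \<partial>\<mu>) = (\<integral>x. f x \<partial>\<mu>)" if "f \<in> borel_measurable borel"
    using integral_distr[OF m that] assms(2) by simp
  show "(\<integral>\<^sup>+x. h (- x) \<partial>\<mu>) = (\<integral>\<^sup>+x. h x \<partial>\<mu>)" if "h \<in> borel_measurable borel"
    using nn_integral_distr[OF m, of h] that assms by (simp cong: measurable_cong_sets)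
  show "measure \<mu> (uminus -` A) = measure \<mu> A" if "A \<in> sets borel"
    using measure_distr[OF m that] assms(2) sets_eq_imp_space_eq[OF assms(1)] by simp
qed

lemma tilt_witness_reflect:
  assumes \<mu>: "sets \<mu> = sets borel" "distr \<mu> borel uminus = \<mu>"
    and w: "tilt_witness \<mu> C K t0 1 z a g b t"
  shows "tilt_witness \<mu> C K t0 (- 1) z a (\<lambda>x. g (- x)) (\<lambda>x. b (- x)) t"
proof -
  have [measurable]: "g \<in> borel_measurable borel" "b \<in> borel_measurable borel"
    using w by (auto simp: tilt_witness_def)
  have "(\<integral>x. g (- x) * b (- x) ^ m \<partial>\<mu>) = (\<integral>x. g x * b x ^ m \<partial>\<mu>)" for m
    using integral_reflect_even[OF \<mu>, of "\<lambda>x. g x * b x ^ m"] by simp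
  note e = this[of 1] this[of 2] this[of 4]
  have "(\<integral>\<^sup>+x. ennreal (g (- x)) \<partial>\<mu>) = (\<integral>\<^sup>+x. ennreal (g x) \<partial>\<mu>)"
    using nn_integral_reflect_even[OF \<mu>, of "\<lambda>x. ennreal (g x)"] by simp
  moreover have "b (- x) \<le> - 1 * x - z \<and> g (- x) \<le> exp (a + t * b (- x))" if "0 < g (- x)" for x
  proof -
    have "b (- x) \<le> 1 * (- x) - z \<and> g (- x) \<le> exp (a + t * b (- x))"
      using w that by (simp only: tilt_witness_def)
    then show ?thesis by simp
  qed
  ultimately show ?thesis using w e unfolding tilt_witness_def by simp
qed

text \<open>On the tail \<open>x - z\<close> is nonnegative, so \<open>b = 0\<close> will do; every
  moment condition then holds trivially, and the constant density costs exactly the logarithm of the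
  tail.\<close>

lemma tilt_witness_conditioning:
  assumes "prob_space \<mu>" "sets \<mu> = sets borel" "0 < measure \<mu> {z..}" "0 \<le> C" "0 \<le> K" "0 \<le> t0"
  shows "tilt_witness \<mu> C K t0 1 z (- ln (measure \<mu> {z..})) (\<lambda>x. indicator {z..} x / measure \<mu> {z..}) (\<lambda>_. 0) 0"
proof -
  interpret prob_space \<mu> by fact
  have "(\<integral>\<^sup>+x. ennreal (indicator {z..} x / measure \<mu> {z..}) \<partial>\<mu>)
      = (\<integral>\<^sup>+x. ennreal (1 / measure \<mu> {z..}) * indicator {z..} x \<partial>\<mu>)"
    by (intro nn_integral_cong) (auto simp: indicator_def)
  also have "\<dots> = ennreal (1 / measure \<mu> {z..}) * emeasure \<mu> {z..}"
    using assms(2) by (intro nn_integral_cmult_indicator) auto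
  also have "\<dots> = 1" using assms(3)
    by (simp add: emeasure_eq_measure ennreal_mult[symmetric])
  finally show ?thesis
    using assms by (auto simp: tilt_witness_def exp_minus inverse_eq_divide split: split_indicator)
qed

text \<open>The slope \<open>t\<close> minimises the moment generating function \<open>F\<close> of
  the truncated \<open>x - z\<close>: stationarity says that \<open>b\<close> is centred under the
  tilted law, and the cost is \<open>- ln (F t)\<close>. Mass \<open>p\<close> beyond
  \<open>x1\<close> on both sides confines the minimiser to \<open>{-t0..t0}\<close>. The hypothesis
  on \<open>K\<close> compares the trivial bound \<open>C ^ 4\<close> on the fourth moment with the
  lower bound \<open>gb2\<close> on the second.\<close>

lemma tilt_witness_exponential:
  assumes \<mu>: "prob_space \<mu>" "sets \<mu> = sets borel"
    and z: "0 \<le> z" "z \<le> x0" and x: "x0 < x1"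
    and p: "0 < p" "p \<le> measure \<mu> {x1..M}" "p \<le> measure \<mu> {-M..-x1}"
    and t0: "0 < t0" "1 < p * exp (t0 * (x1 - x0))"
    and K: "(M + x0) ^ 4 \<le> K * (exp (- 2 * t0 * (M + x0)) * (p * (x1 - x0)\<^sup>2))\<^sup>2"
  shows "\<exists>g b t. \<bar>t\<bar> \<le> t0 \<and> tilt_witness \<mu> (M + x0) K t0 1 z (t * z - ln (trunc_mgf \<mu> M t)) g b t"
proof -
  interpret prob_space \<mu> by fact
  note [measurable_cong] = \<mu>(2)
  define C where "C = M + x0"
  have "{x1..M} \<noteq> {}" using p by (metis less_le_trans measure_empty less_irrefl)
  then have x1M: "x1 \<le> M" by auto
  have C0: "0 < C" using x1M x z by (simp add: C_def)
  define k where "k x = (indicator {-M..M} x :: real)" for x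
  define b where "b x = k x * (x - z)" for x
  define F where "F t = (\<integral>x. k x * exp (t * b x) \<partial>\<mu>)" for t
  have [measurable]: "k \<in> borel_measurable borel" "b \<in> borel_measurable borel"
    by (simp_all add: k_def[abs_def] b_def[abs_def])
  have k01: "0 \<le> k x" "k x \<le> 1" for x by (auto simp: k_def indicator_def)
  have bC: "\<bar>b x\<bar> \<le> C" for x using z x1M x by (auto simp: b_def k_def C_def indicator_def)
  have Fder: "(F has_real_derivative (\<integral>x. k x * b x * exp (t * b x) \<partial>\<mu>)) (at t)" for t
    unfolding F_def[abs_def] by (rule exp_integral_DERIV[where R = C]) (use bC in \<open>auto simp: k_def indicator_def\<close>)
  have eb: "t * b x \<le> \<bar>t\<bar> * C" "- (\<bar>t\<bar> * C) \<le> t * b x" for t x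
  proof -
    have "\<bar>t * b x\<bar> \<le> \<bar>t\<bar> * C" unfolding abs_mult using bC by (intro mult_left_mono) auto
    then show "t * b x \<le> \<bar>t\<bar> * C" "- (\<bar>t\<bar> * C) \<le> t * b x" by linarith+
  qed
  have kint: "integrable \<mu> (\<lambda>x. k x * f x)" if "f \<in> borel_measurable borel" "\<And>x. \<bar>f x\<bar> \<le> B" for f and B :: real
  proof (rule integrable_const_bound[of _ B])
    have "\<bar>k x * f x\<bar> \<le> 1 * B" for x unfolding abs_mult using k01[of x] that(2) by (intro mult_mono) auto
    then show "AE x in \<mu>. norm (k x * f x) \<le> B" by simp
  qed (use that in measurable)
  have Fint: "integrable \<mu> (\<lambda>x. k x * exp (t * b x))" for t
    by (rule kint[of "\<lambda>x. exp (t * b x)" "exp (\<bar>t\<bar> * C)"]) (use eb in auto)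
  have lower: "q * B \<le> (\<integral>x. f x \<partial>\<mu>)"
    if "A \<in> sets borel" "q \<le> measure \<mu> A" "0 \<le> B" "integrable \<mu> f" "\<And>x. 0 \<le> f x" "\<And>x. x \<in> A \<Longrightarrow> B \<le> f x"
    for q B A and f :: "real \<Rightarrow> real"
  proof -
    have "q * B \<le> measure \<mu> A * B" using that by (intro mult_right_mono) auto
    also have "\<dots> = (\<integral>x. indicator A x * B \<partial>\<mu>)" using that(1) \<mu>(2) sets_eq_imp_space_eq[OF \<mu>(2)] by simp
    also have "\<dots> \<le> (\<integral>x. f x \<partial>\<mu>)"
      using that \<mu>(2) by (intro integral_mono integrable_mult_left integrable_real_indicator)
        (auto simp: emeasure_eq_measure split: split_indicator)
    finally show ?thesis .
  qed
  \<comment> \<open>\<open>F\<close> exceeds 1 at both ends and is at most 1 at 0, so its minimum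
    over the interval is interior.\<close>
  have Fend: "1 < F t0" "1 < F (- t0)"
  proof -
    have "p * exp (t0 * (x1 - x0)) \<le> F t0" unfolding F_def
    proof (rule lower[OF _ p(2) _ Fint])
      fix x assume x': "x \<in> {x1..M}"
      then have "k x = 1" using x z by (auto simp: k_def)
      then show "exp (t0 * (x1 - x0)) \<le> k x * exp (t0 * b x)" using x' z t0 by (auto simp: b_def)
    qed (use k01 in auto)
    then show "1 < F t0" using t0 by linarith
    have "p * exp (t0 * (x1 - x0)) \<le> F (- t0)" unfolding F_def
    proof (rule lower[OF _ p(3) _ Fint])
      fix x assume x': "x \<in> {-M..-x1}"
      then have "k x = 1" using x z by (auto simp: k_def)
      then show "exp (t0 * (x1 - x0)) \<le> k x * exp (- t0 * b x)"
        using x' z x t0 mult_left_mono[of "x1 - x0" "z - x" t0] by (auto simp: b_def algebra_simps)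
    qed (use k01 in auto)
    then show "1 < F (- t0)" using t0 by linarith
  qed
  have F0: "F 0 \<le> 1" unfolding F_def using k01 Fint[of 0] by (intro integral_le_const) auto
  have "\<exists>t\<in>{-t0..t0}. \<forall>s\<in>{-t0..t0}. F t \<le> F s"
    using t0 by (intro continuous_attains_inf) (auto intro!: continuous_at_imp_continuous_on DERIV_isCont[OF Fder])
  then obtain t where t: "t \<in> {-t0..t0}" "\<And>s. s \<in> {-t0..t0} \<Longrightarrow> F t \<le> F s" by blast
  have "F t \<le> 1" using t(2)[of 0] F0 t0 by simp
  then have "t \<noteq> t0" "t \<noteq> - t0" using Fend by auto
  then have tin: "- t0 < t" "t < t0" using t(1) by auto
  have Ader: "(\<integral>x. k x * b x * exp (t * b x) \<partial>\<mu>) = 0"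
  proof (rule DERIV_local_min[OF Fder])
    show "0 < min (t0 - t) (t + t0)" using tin by simp
    show "\<forall>s. \<bar>t - s\<bar> < min (t0 - t) (t + t0) \<longrightarrow> F t \<le> F s" using t(2) by (auto simp: abs_less_iff)
  qed
  have Fpos: "0 < F t"
  proof -
    have "p * exp (- (\<bar>t\<bar> * C)) \<le> F t" unfolding F_def
    proof (rule lower[OF _ p(2) _ Fint])
      fix x assume "x \<in> {x1..M}"
      then have "k x = 1" using x z by (auto simp: k_def)
      then show "exp (- (\<bar>t\<bar> * C)) \<le> k x * exp (t * b x)" using eb(2)[of t x] by simp
    qed (use k01 in auto)
    then show ?thesis using p by (smt (verit) exp_gt_zero mult_pos_pos)
  qed
  have Ftr: "F t = exp (- (t * z)) * trunc_mgf \<mu> M t"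
  proof -
    have "F t = (\<integral>x. exp (- (t * z)) * (indicator {-M..M} x * exp (t * x)) \<partial>\<mu>)"
      unfolding F_def
      by (intro Bochner_Integration.integral_cong)
        (auto simp: k_def b_def indicator_def right_diff_distrib exp_diff exp_minus divide_inverse)
    then show ?thesis by (simp add: trunc_mgf_def)
  qed
  define a where "a = t * z - ln (trunc_mgf \<mu> M t)"
  have trpos: "0 < trunc_mgf \<mu> M t" using Fpos Ftr by (simp add: zero_less_mult_iff)
  have aF: "a = - ln (F t)" unfolding Ftr a_def using trpos by (subst ln_mult) auto
  define g where "g x = k x * exp (t * b x) / F t" for x
  have [measurable]: "g \<in> borel_measurable borel" by (simp add: g_def[abs_def])
  have g0: "0 \<le> g x" for x using k01[of x] Fpos by (simp add: g_def)
  have gint: "integrable \<mu> g" using Fint[of t] by (simp add: g_def[abs_def])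
  have g1: "(\<integral>x. g x \<partial>\<mu>) = 1" using Fpos by (simp add: g_def F_def[symmetric])
  have gn1: "(\<integral>\<^sup>+x. ennreal (g x) \<partial>\<mu>) = 1"
    using nn_integral_eq_integral[OF gint] g0 g1 by simp
  have tt0: "\<bar>t\<bar> \<le> t0" using tin by auto
  have bp: "\<bar>b x ^ m\<bar> \<le> C ^ m" for x m using power_mono[OF bC[of x], of m] by (simp add: power_abs)
  have gbint: "integrable \<mu> (\<lambda>x. g x * b x ^ m)" for m
  proof (rule Bochner_Integration.integrable_bound[OF integrable_mult_right[OF gint, of "C ^ m"]])
    have "\<bar>g x * b x ^ m\<bar> \<le> \<bar>C ^ m * g x\<bar>" for x
      using mult_left_mono[OF bp[of x m] g0[of x]] g0[of x] C0 by (simp add: abs_mult mult.commute)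
    then show "AE x in \<mu>. norm (g x * b x ^ m) \<le> norm (C ^ m * g x)" by simp
  qed measurable
  have gb: "(\<integral>x. g x * b x \<partial>\<mu>) = 0"
  proof -
    have "(\<integral>x. g x * b x \<partial>\<mu>) = (\<integral>x. k x * b x * exp (t * b x) / F t \<partial>\<mu>)"
      by (intro Bochner_Integration.integral_cong) (auto simp: g_def)
    then show ?thesis using Ader by simp
  qed
  have gb4: "(\<integral>x. g x * b x ^ 4 \<partial>\<mu>) \<le> C ^ 4"
  proof -
    have "(\<integral>x. g x * b x ^ 4 \<partial>\<mu>) \<le> (\<integral>x. g x * C ^ 4 \<partial>\<mu>)"
    proof (rule integral_mono[OF gbint])
      show "integrable \<mu> (\<lambda>x. g x * C ^ 4)" using gint by simp
      show "g x * b x ^ 4 \<le> g x * C ^ 4" for x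
        using bp[of x 4] by (intro mult_left_mono g0) (simp add: abs_le_iff)
    qed
    then show ?thesis using g1 by simp
  qed
  have FC: "F t \<le> exp (t0 * C)"
  proof -
    have "1 \<le> exp (t0 * C)" using t0 C0 by simp
    then show ?thesis using \<open>F t \<le> 1\<close> by linarith
  qed
  \<comment> \<open>Only \<open>{x1..M}\<close> is counted: there \<open>b\<close> is at least
    \<open>x1 - x0\<close>, and the density is at least \<open>exp (- (t0 * C))\<close> divided by a
    normaliser of at most \<open>exp (t0 * C)\<close>.\<close>
  have gb2: "exp (- 2 * t0 * C) * (p * (x1 - x0)\<^sup>2) \<le> (\<integral>x. g x * (b x)\<^sup>2 \<partial>\<mu>)"
  proof -
    have "p * (exp (- 2 * t0 * C) * (x1 - x0)\<^sup>2) \<le> (\<integral>x. g x * (b x)\<^sup>2 \<partial>\<mu>)"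
    proof (rule lower[OF _ p(2) _ gbint])
      fix x assume x': "x \<in> {x1..M}"
      then have k1: "k x = 1" using x z by (auto simp: k_def)
      have "(x1 - x0)\<^sup>2 \<le> (b x)\<^sup>2" using x' k1 x z by (intro power_mono) (auto simp: b_def)
      moreover have "exp (- 2 * t0 * C) \<le> g x"
      proof -
        have "- (t0 * C) \<le> - (\<bar>t\<bar> * C)" using tt0 C0 by (simp add: mult_right_mono)
        then have "exp (- (t0 * C)) \<le> exp (t * b x)" using eb(2)[of t x] by simp
        moreover have "exp (- 2 * t0 * C) * F t \<le> exp (- 2 * t0 * C) * exp (t0 * C)"
          using FC by (intro mult_left_mono) auto
        moreover have "exp (- 2 * t0 * C) * exp (t0 * C) = exp (- (t0 * C))" by (simp flip: exp_add)
        ultimately have "exp (- 2 * t0 * C) * F t \<le> exp (t * b x)" by linarith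
        then show ?thesis using Fpos k1 by (simp add: g_def pos_le_divide_eq)
      qed
      ultimately show "exp (- 2 * t0 * C) * (x1 - x0)\<^sup>2 \<le> g x * (b x)\<^sup>2"
        using g0 by (intro mult_mono) auto
    qed (use g0 in auto)
    then show ?thesis by (simp add: mult_ac)
  qed
  have Kpos: "0 \<le> K"
  proof (rule ccontr)
    assume "\<not> 0 \<le> K"
    then have "K * (exp (- 2 * t0 * (M + x0)) * (p * (x1 - x0)\<^sup>2))\<^sup>2 \<le> 0"
      by (intro mult_nonpos_nonneg) auto
    moreover have "0 < (M + x0) ^ 4" using C0 by (simp add: C_def)
    ultimately show False using K by linarith
  qed
  have "C ^ 4 \<le> K * (exp (- 2 * t0 * C) * (p * (x1 - x0)\<^sup>2))\<^sup>2" using K by (simp add: C_def)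
  also have "\<dots> \<le> K * (\<integral>x. g x * (b x)\<^sup>2 \<partial>\<mu>)\<^sup>2"
    using gb2 p(1) Kpos by (intro mult_left_mono power_mono) auto
  finally have K4: "(\<integral>x. g x * b x ^ 4 \<partial>\<mu>) \<le> K * (\<integral>x. g x * (b x)\<^sup>2 \<partial>\<mu>)\<^sup>2" using gb4 by linarith
  have "b x \<le> 1 * x - z \<and> g x \<le> exp (a + t * b x)" if "0 < g x" for x
  proof -
    have "k x \<noteq> 0" using that by (auto simp: g_def)
    then have "k x = 1" by (auto simp: k_def indicator_def split: if_splits)
    then show ?thesis using Fpos by (simp add: g_def aF exp_diff b_def)
  qed
  then have "tilt_witness \<mu> C K t0 1 z a g b t"
    unfolding tilt_witness_def using g0 gn1 bC gb K4 tt0 by simp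
  then show ?thesis unfolding C_def a_def using tt0 by blast
qed

subsection \<open>The rate function of an even measure\<close>

text \<open>The point is that \<open>C\<close>, \<open>K\<close> and \<open>t0\<close> precede
  \<open>z\<close>. They are fixed in the order mass \<open>p\<close>, slope bound
  \<open>t0\<close>, truncation \<open>M\<close>, ratio \<open>K\<close>: the truncation must serve
  all slopes up to \<open>t0\<close>, and enlarging \<open>M\<close> keeps \<open>p\<close> and
  \<open>t0\<close> valid. The factor \<open>1 + \<eta>\<close> pays for conditioning, the summand
  \<open>\<eta>\<close> for truncation.\<close>

lemma exists_uniform_tilt_witness:
  assumes \<mu>: "prob_space \<mu>" "sets \<mu> = sets borel" "distr \<mu> borel uminus = \<mu>"
    and x: "0 \<le> x0" "x0 < x1" "0 < measure \<mu> {x1..}"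
    and L: "\<And>s y. \<lbrakk>0 \<le> y; y \<le> x0; mgf \<mu> s < \<infinity>\<rbrakk> \<Longrightarrow> s * y - ln (enn2real (mgf \<mu> s)) \<le> L y"
    and L0: "\<And>y. 0 \<le> L y" and "0 < \<eta>"
    and tail: "\<And>z. \<lbrakk>x0 < z; z \<in> D\<rbrakk> \<Longrightarrow> 0 < measure \<mu> {z..} \<and> - ln (measure \<mu> {z..}) \<le> (1 + \<eta>) * L z"
  shows "\<exists>C K t0. 3 \<le> K \<and> (\<forall>z \<sigma>. 0 \<le> z \<longrightarrow> z \<in> D \<longrightarrow> \<sigma> = 1 \<or> \<sigma> = - 1 \<longrightarrow>
    (\<exists>g b t. tilt_witness \<mu> C K t0 \<sigma> z ((1 + \<eta>) * L z + \<eta>) g b t))"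
proof -
  interpret prob_space \<mu> by fact
  have "(\<lambda>k. measure \<mu> {x1..real k}) \<longlonglongrightarrow> measure \<mu> (\<Union>k. {x1..real k})"
  proof (rule finite_Lim_measure_incseq)
    show "range (\<lambda>k. {x1..real k}) \<subseteq> sets \<mu>" unfolding \<mu>(2) by auto
    show "incseq (\<lambda>k. {x1..real k})" by (auto simp: incseq_def)
  qed
  moreover have "(\<Union>k. {x1..real k}) = {x1..}" by (auto simp: real_arch_simple)
  ultimately have "\<forall>\<^sub>F k in sequentially. 0 < measure \<mu> {x1..real k}"
    using x(3) by (intro order_tendstoD) auto
  then obtain k :: nat where k: "0 < measure \<mu> {x1..real k}" by (auto simp: eventually_sequentially)
  define p where "p = measure \<mu> {x1..real k}"
  have p: "0 < p" "p \<le> 1" using k by (auto simp: p_def)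
  \<comment> \<open>Chosen so that \<open>p * exp (t0 * (x1 - x0))\<close> equals
    \<open>exp 1\<close>, hence exceeds 1.\<close>
  define t0 where "t0 = (1 - ln p) / (x1 - x0)"
  have "ln p \<le> 0" using p by simp
  then have t0: "0 < t0" using x by (simp add: t0_def)
  have "p * exp (t0 * (x1 - x0)) = p * (exp 1 / p)" using x p by (simp add: t0_def exp_diff)
  then have t0': "1 < p * exp (t0 * (x1 - x0))" using p by simp
  have "measure \<mu> {x1..real k} \<le> measure \<mu> {-real k..real k}"
    using \<mu>(2) x by (intro finite_measure_mono) auto
  then have "0 < measure \<mu> {-real k..real k}" using k by linarith
  from trunc_legendre_le[where ?x0.0 = x0 and L = L and ?t0.0 = t0, OF \<mu>(1,2) L this \<open>0 < \<eta>\<close>] obtain m :: nat where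
    m: "k \<le> m" "\<And>t y. \<lbrakk>\<bar>t\<bar> \<le> t0; 0 \<le> y; y \<le> x0\<rbrakk> \<Longrightarrow> t * y - ln (trunc_mgf \<mu> (real m) t) \<le> L y + \<eta>"
    by blast
  define M where "M = real m"
  have pM: "p \<le> measure \<mu> {x1..M}"
    unfolding p_def M_def using \<mu>(2) m(1) by (intro finite_measure_mono) auto
  have "uminus -` {x1..M} = {-M..-x1}" by auto
  then have pM': "p \<le> measure \<mu> {-M..-x1}" using pM measure_reflect_even[OF \<mu>(2,3), of "{x1..M}"] by simp
  define v where "v = (exp (- 2 * t0 * (M + x0)) * (p * (x1 - x0)\<^sup>2))\<^sup>2"
  have v: "0 < v" using p x by (auto simp: v_def)
  define K where "K = max 3 ((M + x0) ^ 4 / v)"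
  have K: "3 \<le> K" "(M + x0) ^ 4 \<le> K * v"
  proof -
    show "3 \<le> K" by (simp add: K_def)
    have "(M + x0) ^ 4 / v \<le> K" by (simp add: K_def)
    then show "(M + x0) ^ 4 \<le> K * v" using v by (simp add: pos_divide_le_eq)
  qed
  have C0: "0 \<le> M + x0" using x by (simp add: M_def)
  have pos: "\<exists>g b t. tilt_witness \<mu> (M + x0) K t0 1 z ((1 + \<eta>) * L z + \<eta>) g b t" if z: "0 \<le> z" "z \<in> D" for z
  proof (cases "z \<le> x0")
    case True
    obtain g b t where w: "\<bar>t\<bar> \<le> t0" "tilt_witness \<mu> (M + x0) K t0 1 z (t * z - ln (trunc_mgf \<mu> M t)) g b t"
      using tilt_witness_exponential[OF \<mu>(1,2) z(1) True x(2) p(1) pM pM' t0 t0'] K(2) unfolding v_def by blast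
    have "t * z - ln (trunc_mgf \<mu> M t) \<le> L z + \<eta>" using m(2)[OF w(1) z(1) True] by (simp add: M_def)
    also have "\<dots> \<le> (1 + \<eta>) * L z + \<eta>" using L0[of z] \<open>0 < \<eta>\<close> by (simp add: distrib_right)
    finally show ?thesis using tilt_witness_cost_mono[OF w(2)] by blast
  next
    case False
    then have t: "0 < measure \<mu> {z..}" "- ln (measure \<mu> {z..}) \<le> (1 + \<eta>) * L z + \<eta>"
      using tail[of z] z \<open>0 < \<eta>\<close> by auto
    show ?thesis
      using tilt_witness_cost_mono[OF tilt_witness_conditioning[OF \<mu>(1,2) t(1) C0, of K t0] t(2)] K(1) t0
      by fastforce
  qed
  show ?thesis
  proof (rule exI[of _ "M + x0"], rule exI[of _ K], rule exI[of _ t0], intro conjI allI impI K(1))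
    fix z \<sigma> :: real assume z: "0 \<le> z" "z \<in> D" and "\<sigma> = 1 \<or> \<sigma> = - 1"
    then show "\<exists>g b t. tilt_witness \<mu> (M + x0) K t0 \<sigma> z ((1 + \<eta>) * L z + \<eta>) g b t"
      using pos[OF z] tilt_witness_reflect[OF \<mu>(2,3)] by blast
  qed
qed

section \<open>Support, finiteness and measurability of the rate function\<close>

lemma measure_atLeast_pos_of_less_xstar:
  assumes "prob_space \<mu>" "sets \<mu> = sets borel" "ereal x < xstar \<mu>"
  shows "0 < measure \<mu> {x..}"
proof -
  interpret prob_space \<mu> by fact
  obtain y where y: "x < y" "0 < measure \<mu> {y..}"
    using assms(3) unfolding xstar_def less_Sup_iff by auto
  have "measure \<mu> {y..} \<le> measure \<mu> {x..}" using y assms(2) by (intro finite_measure_mono) auto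
  then show ?thesis using y by linarith
qed

lemma mgf_uminus:
  assumes "sets \<mu> = sets borel" "distr \<mu> borel uminus = \<mu>"
  shows "mgf \<mu> (- t) = mgf \<mu> t"
  unfolding mgf_def using nn_integral_reflect_even[OF assms, of "\<lambda>x. ennreal (exp (t * x))"] by simp

lemma Lambda_star_uminus:
  assumes "sets \<mu> = sets borel" "distr \<mu> borel uminus = \<mu>"
  shows "Lambda_star \<mu> (- x) = Lambda_star \<mu> x"
proof -
  have "Lambda_star \<mu> x = (SUP t. ereal (t * x) - Lambda \<mu> t)" by (simp add: Lambda_star_def)
  also have "\<dots> = (SUP t\<in>range uminus. ereal (t * x) - Lambda \<mu> t)" by (simp add: surj_uminus)
  also have "\<dots> = (SUP t. ereal (- t * x) - Lambda \<mu> (- t))" by (simp only: image_image)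
  also have "\<dots> = (SUP t. ereal (t * - x) - Lambda \<mu> t)"
    by (simp add: Lambda_def[abs_def] mgf_uminus[OF assms] cong: if_cong)
  also have "\<dots> = Lambda_star \<mu> (- x)" by (simp add: Lambda_star_def)
  finally show ?thesis by simp
qed

lemma Lambda_star_nonneg:
  assumes "prob_space \<mu>"
  shows "0 \<le> Lambda_star \<mu> x"
proof -
  interpret prob_space \<mu> by fact
  have "Lambda \<mu> 0 = 0" by (simp add: Lambda_def mgf_def emeasure_space_1)
  then have "0 = ereal (0 * x) - Lambda \<mu> 0" by (simp add: zero_ereal_def)
  also have "\<dots> \<le> Lambda_star \<mu> x" unfolding Lambda_star_def by (rule SUP_upper[OF UNIV_I])
  finally show ?thesis .
qed

text \<open>The supremum is uncountable, but each function under it is affine or constantly minus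
  infinity, so superlevel sets are unions of open sets.\<close>

lemma borel_measurable_Lambda_star: "Lambda_star \<mu> \<in> borel_measurable borel"
proof (rule borel_measurableI_greater)
  fix y :: ereal
  have "{x\<in>space borel. y < Lambda_star \<mu> x} = (\<Union>t. {x. y < ereal (t * x) - Lambda \<mu> t})"
    by (auto simp: Lambda_star_def less_SUP_iff)
  moreover have "open {x. y < ereal (t * x) - Lambda \<mu> t}" for t
  proof (cases "Lambda \<mu> t")
    case (real r)
    have "open {x. y < ereal (t * x - r)}"
      by (intro open_Collect_less continuous_intros)
    then show ?thesis using real by simp
  qed (auto simp: Lambda_def split: if_splits)
  ultimately show "{x\<in>space borel. y < Lambda_star \<mu> x} \<in> sets borel"
    by (simp add: borel_open open_UN)
qed

text \<open>Mass \<open>p\<close> beyond some \<open>x1 > \<bar>y\<bar>\<close> gives, by evenness,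
  \<open>mgf \<mu> t \<ge> exp (\<bar>t\<bar> * x1) * p\<close>, so no slope yields more than
  \<open>- ln p\<close>.\<close>

lemma Lambda_star_finite:
  assumes \<mu>: "prob_space \<mu>" "sets \<mu> = sets borel" "distr \<mu> borel uminus = \<mu>"
    and "ereal \<bar>y\<bar> < xstar \<mu>"
  shows "Lambda_star \<mu> y < \<infinity>"
proof -
  interpret prob_space \<mu> by fact
  obtain x1 where x1: "\<bar>y\<bar> < x1" "ereal x1 < xstar \<mu>" using ereal_dense2[OF assms(4)] by auto
  define p where "p = measure \<mu> {x1..}"
  have p: "0 < p" unfolding p_def by (rule measure_atLeast_pos_of_less_xstar[OF \<mu>(1,2) x1(2)])
  have pos: "ennreal (exp (t * x1) * p) \<le> mgf \<mu> t" if "0 \<le> t" for t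
  proof -
    have "ennreal (exp (t * x1) * p) = (\<integral>\<^sup>+x. ennreal (exp (t * x1)) * indicator {x1..} x \<partial>\<mu>)"
      using \<mu>(2) by (simp add: nn_integral_cmult_indicator emeasure_eq_measure p_def ennreal_mult)
    also have "\<dots> \<le> mgf \<mu> t" unfolding mgf_def
      using that by (intro nn_integral_mono) (auto split: split_indicator intro!: ennreal_leI mult_left_mono)
    finally show ?thesis .
  qed
  have "ereal (t * y) - Lambda \<mu> t \<le> ereal (- ln p)" for t
  proof (cases "mgf \<mu> t = \<infinity>")
    case True then show ?thesis by (simp add: Lambda_def)
  next
    case False
    have "ennreal (exp (\<bar>t\<bar> * x1) * p) \<le> mgf \<mu> \<bar>t\<bar>" by (rule pos) simp
    also have "mgf \<mu> \<bar>t\<bar> = mgf \<mu> t" using mgf_uminus[OF \<mu>(2,3), of t] by (simp add: abs_if)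
    also have "\<dots> = ennreal (enn2real (mgf \<mu> t))" using False by (simp add: less_top)
    finally have "exp (\<bar>t\<bar> * x1) * p \<le> enn2real (mgf \<mu> t)" by (subst (asm) ennreal_le_iff) auto
    moreover have "0 < exp (\<bar>t\<bar> * x1) * p" using p by simp
    ultimately have "ln (exp (\<bar>t\<bar> * x1) * p) \<le> ln (enn2real (mgf \<mu> t))" by (subst ln_le_cancel_iff) auto
    then have "\<bar>t\<bar> * x1 + ln p \<le> ln (enn2real (mgf \<mu> t))" using p by (simp add: ln_mult)
    moreover have "t * y \<le> \<bar>t\<bar> * x1"
    proof -
      have "t * y \<le> \<bar>t\<bar> * \<bar>y\<bar>" by (metis abs_ge_self abs_mult)
      also have "\<dots> \<le> \<bar>t\<bar> * x1" using x1 by (intro mult_left_mono) auto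
      finally show ?thesis .
    qed
    ultimately show ?thesis using False by (simp add: Lambda_def)
  qed
  then have "Lambda_star \<mu> y \<le> ereal (- ln p)" unfolding Lambda_star_def by (rule SUP_least)
  then show ?thesis by (rule le_less_trans) simp
qed

text \<open>Otherwise the positive half-line is null, by symmetry the negative one too, and the
  variable is almost surely 0.\<close>

lemma xstar_pos:
  assumes \<mu>: "prob_space \<mu>" "sets \<mu> = sets borel" "distr \<mu> borel uminus = \<mu>"
    and var: "prob_space.variance \<mu> (\<lambda>x. x) > 0"
  shows "0 < xstar \<mu>"
proof (rule ccontr)
  assume neg: "\<not> 0 < xstar \<mu>"
  interpret prob_space \<mu> by fact
  note [measurable_cong] = \<mu>(2)
  have null: "measure \<mu> {x..} = 0" if "0 < x" for x
  proof (rule ccontr)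
    assume "measure \<mu> {x..} \<noteq> 0"
    then have "0 < measure \<mu> {x..}" by (simp add: zero_less_measure_iff)
    then have "ereal x \<le> xstar \<mu>" unfolding xstar_def by (intro Sup_upper) auto
    then show False using neg that by (meson ereal_less(2) less_le_trans)
  qed
  have "AE x in \<mu>. \<not> 1 / real (Suc k) \<le> x" for k
    using null[of "1 / real (Suc k)"] \<mu>(2)
    by (intro AE_I'[of "{1 / real (Suc k)..}"]) (auto simp: null_sets_def emeasure_eq_measure)
  then have "AE x in \<mu>. \<forall>k. \<not> 1 / real (Suc k) \<le> x" by (simp add: AE_all_countable)
  then have le: "AE x in \<mu>. x \<le> 0"
  proof eventually_elim
    case (elim x)
    show ?case
    proof (rule ccontr)
      assume "\<not> x \<le> 0"
      then obtain k where "inverse (real (Suc k)) < x" using reals_Archimedean[of x] by auto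
      then show False using elim by (auto simp: inverse_eq_divide intro: less_imp_le)
    qed
  qed
  have "AE x in distr \<mu> borel uminus. x \<le> 0" using le by (simp only: \<mu>(3))
  then have "AE x in \<mu>. - x \<le> 0" by (subst (asm) AE_distr_iff) auto
  with le have z: "AE x in \<mu>. x = 0" by eventually_elim auto
  have m: "expectation (\<lambda>x. x) = 0"
    using z integral_cong_AE[of "\<lambda>x. x" \<mu> "\<lambda>_. 0"] by simp
  have "variance (\<lambda>x. x) = (\<integral>x. 0 \<partial>\<mu>)"
    unfolding m by (intro integral_cong_AE) (use z in auto)
  then show False using var by simp
qed

text \<open>Here the absence of an atom at a finite end point enters. It confines almost every
  coordinate to the region where the rate function is finite.\<close>

lemma AE_abs_less_xstar:
  assumes \<mu>: "prob_space \<mu>" "sets \<mu> = sets borel" "distr \<mu> borel uminus = \<mu>"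
    and "0 < xstar \<mu>" and atom: "xstar \<mu> < \<infinity> \<longrightarrow> measure \<mu> {real_of_ereal (xstar \<mu>)} = 0"
  shows "AE x in \<mu>. ereal \<bar>x\<bar> < xstar \<mu>"
proof (cases "xstar \<mu>")
  case (real X)
  interpret prob_space \<mu> by fact
  note [measurable_cong] = \<mu>(2)
  have "AE x in \<mu>. \<not> X + 1 / real (Suc k) \<le> x" for k
  proof -
    have "\<not> 0 < measure \<mu> {X + 1 / real (Suc k)..}"
    proof
      assume "0 < measure \<mu> {X + 1 / real (Suc k)..}"
      then have "ereal (X + 1 / real (Suc k)) \<le> xstar \<mu>" unfolding xstar_def by (intro Sup_upper) auto
      then show False using real by simp
    qed
    then have "measure \<mu> {X + 1 / real (Suc k)..} = 0" by (simp add: zero_less_measure_iff)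
    then show ?thesis
      using \<mu>(2) by (intro AE_I'[of "{X + 1 / real (Suc k)..}"]) (auto simp: null_sets_def emeasure_eq_measure)
  qed
  then have 1: "AE x in \<mu>. \<forall>k. \<not> X + 1 / real (Suc k) \<le> x" by (simp add: AE_all_countable)
  have 2: "AE x in \<mu>. x \<noteq> X"
    using atom real \<mu>(2) by (intro AE_I'[of "{X}"]) (auto simp: null_sets_def emeasure_eq_measure)
  from 1 2 have lt: "AE x in \<mu>. x < X"
  proof eventually_elim
    case (elim x)
    show ?case
    proof (rule ccontr)
      assume "\<not> x < X"
      then have "0 < x - X" using elim by simp
      then obtain k where "inverse (real (Suc k)) < x - X" using reals_Archimedean[of "x - X"] by auto
      then have "X + 1 / real (Suc k) \<le> x" by (simp add: inverse_eq_divide)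
      then show False using elim by blast
    qed
  qed
  have "AE x in distr \<mu> borel uminus. x < X" using lt by (simp only: \<mu>(3))
  then have "AE x in \<mu>. - x < X" by (subst (asm) AE_distr_iff) auto
  with lt show ?thesis by eventually_elim (auto simp: real)
qed (use assms in auto)

text \<open>Everything is compared in terms of \<open>N\<close>: since \<open>n\<close> is at most
  \<open>ln N / r\<close>, the binomial coefficient is at most exponential in a quadratic polynomial
  of \<open>ln N\<close>, while \<open>q * N\<close> is at least the positive power
  \<open>N powr (1 - r' / r)\<close>. This makes the bound uniform over all admissible
  \<open>N\<close>.\<close>

lemma hull_failure_bound:
  assumes "0 \<le> r'" "r' < r" "0 < d"
  shows "\<exists>n0. \<forall>n\<ge>n0. \<forall>N q. n < N \<longrightarrow> exp (r * real n) \<le> real N \<longrightarrow> exp (- r' * real n) \<le> q \<longrightarrow> q \<le> 1 \<longrightarrow>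
    real (N choose Suc n) * (1 - q) ^ (N - Suc n) \<le> d"
proof -
  define e where "e = 1 - r' / r"
  have r: "0 < r" using assms by linarith
  have e: "0 < e" using assms r by (simp add: e_def)
  have "filterlim (\<lambda>x::real. (ln x / r + 1) * ln x + ln x / r + 1 - x powr e) at_bot at_top"
    using r e by real_asymp
  then have "\<forall>\<^sub>F x in at_top. (ln x / r + 1) * ln x + ln x / r + 1 - x powr e \<le> ln d"
    by (simp add: filterlim_at_bot)
  then obtain x0 where x0: "\<And>x. x0 \<le> x \<Longrightarrow> (ln x / r + 1) * ln x + ln x / r + 1 - x powr e \<le> ln d"
    by (auto simp: eventually_at_top_linorder)
  obtain n0 :: nat where n0: "x0 \<le> real n0" using real_arch_simple by blast
  show ?thesis
  proof (intro exI[of _ n0] allI impI)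
    fix n N :: nat and q :: real
    assume n: "n0 \<le> n" "n < N" and N: "exp (r * real n) \<le> real N"
      and q: "exp (- r' * real n) \<le> q" "q \<le> 1"
    have N0: "0 < real N" "1 \<le> real N" using n by auto
    have lnN: "r * real n \<le> ln (real N)" using N N0 by (simp add: ln_ge_iff)
    then have nle: "real n \<le> ln (real N) / r" using r by (simp add: pos_le_divide_eq mult.commute)
    have lnN0: "0 \<le> ln (real N)" using N0 by simp
    have q0: "0 < q" using q(1) exp_gt_zero[of "- r' * real n"] by linarith
    have "real N powr e \<le> q * real N"
    proof -
      have "r' * real n \<le> r' * (ln (real N) / r)" using nle assms by (intro mult_left_mono) auto
      then have "exp (- (r' / r) * ln (real N)) \<le> q" using q(1) by (intro order_trans[OF _ q(1)]) simp
      then have "exp (- (r' / r) * ln (real N)) * real N \<le> q * real N" by (intro mult_right_mono) auto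
      moreover have "exp (- (r' / r) * ln (real N)) * real N = real N powr e"
      proof -
        have "exp (- (r' / r) * ln (real N)) * real N = exp (- (r' / r) * ln (real N)) * exp (ln (real N))"
          using N0 by simp
        also have "\<dots> = exp (e * ln (real N))" by (simp add: e_def algebra_simps flip: exp_add)
        finally show ?thesis using N0 by (simp add: powr_def)
      qed
      ultimately show ?thesis by simp
    qed
    have "real (N choose Suc n) \<le> real N ^ Suc n"
      using binomial_le_pow[of "Suc n" N] n by (metis Suc_leI of_nat_le_iff of_nat_power)
    also have "\<dots> = exp (real (Suc n) * ln (real N))" using N0 by (simp only: exp_of_nat_mult exp_ln)
    finally have 1: "real (N choose Suc n) \<le> exp (real (Suc n) * ln (real N))" .
    have "1 - q \<le> exp (- q)" using exp_ge_add_one_self[of "- q"] by simp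
    then have "(1 - q) ^ (N - Suc n) \<le> exp (- q) ^ (N - Suc n)" using q by (intro power_mono) auto
    also have "\<dots> = exp (- q * real (N - Suc n))" by (simp flip: exp_of_nat_mult add: mult.commute)
    finally have 2: "(1 - q) ^ (N - Suc n) \<le> exp (- q * real (N - Suc n))" .
    have "real (N choose Suc n) * (1 - q) ^ (N - Suc n)
        \<le> exp (real (Suc n) * ln (real N)) * exp (- q * real (N - Suc n))"
      using 1 2 q by (intro mult_mono) auto
    also have "\<dots> = exp (real (Suc n) * ln (real N) - q * real (N - Suc n))" by (simp flip: exp_add)
    also have "\<dots> \<le> exp (ln d)"
    proof -
      define R where "R = ln (real N) / r"
      \<comment> \<open>The loss from having \<open>N - (n + 1)\<close> rather than \<open>N\<close>
        free samples; it is only of order \<open>ln N\<close>.\<close>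
      define A where "A = q * real (Suc n)"
      define Q where "Q = q * real (N - Suc n)"
      have a: "real (Suc n) * ln (real N) \<le> (R + 1) * ln (real N)"
        using nle lnN0 by (intro mult_right_mono) (auto simp: R_def)
      have Q: "Q = q * real N - A"
        unfolding Q_def A_def using n by (simp add: of_nat_diff algebra_simps)
      have "A \<le> 1 * (R + 1)"
        unfolding A_def R_def using q q0 nle by (intro mult_mono) auto
      then have b: "real N powr e - (R + 1) \<le> Q"
        unfolding Q using \<open>real N powr e \<le> q * real N\<close> by (intro diff_mono) auto
      have "(R + 1) * ln (real N) + R + 1 - real N powr e \<le> ln d"
        unfolding R_def using n0 n by (intro x0) linarith
      then show ?thesis unfolding Q_def[symmetric] exp_le_cancel_iff using a b by linarith
    qed
    also have "\<dots> = d" using assms by simp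
    finally show "real (N choose Suc n) * (1 - q) ^ (N - Suc n) \<le> d" .
  qed
qed

theorem theorem3p9:
  fixes \<mu> :: "real measure" and \<delta> \<epsilon> :: real
  assumes "prob_space \<mu>" and "sets \<mu> = sets borel"
    and "admissible \<mu>"
    and "distr \<mu> borel uminus = \<mu>"
    and "Lambda_star_condition \<mu>"
    and "0 < \<delta>" and "\<delta> < 1/2" and "0 < \<epsilon>" and "\<epsilon> < 1"
  shows "\<exists>n0::nat. \<forall>n\<ge>n0. rho2 \<mu> n \<delta> \<le> ereal (1 + \<epsilon>) * enn2ereal (E_Lambda_star \<mu>)"
proof (cases "E_Lambda_star \<mu> = \<infinity>")
  case True
  then show ?thesis using assms(8) by simp
next
  case False
  note \<mu> = assms(1,2,4)
  interpret prob_space \<mu> by fact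
  note [measurable_cong] = \<mu>(2)
  \<comment> \<open>\<open>real_of_ereal\<close> sends an infinite value to 0, so \<open>L\<close>
    represents the rate function only where that is finite; \<open>Leq\<close> secures this for
    \<open>ereal \<bar>x\<bar> < xstar \<mu>\<close>.\<close>
  define L where "L x = real_of_ereal (Lambda_star \<mu> x)" for x
  define T where "T = enn2real (E_Lambda_star \<mu>)"
  have xpos: "0 < xstar \<mu>" using xstar_pos[OF \<mu>] assms(3) by (simp add: admissible_def)
  have inner: "AE x in \<mu>. ereal \<bar>x\<bar> < xstar \<mu>"
    using assms(3) by (intro AE_abs_less_xstar[OF \<mu> xpos]) (simp add: admissible_def)
  have L0: "0 \<le> L x" for x using Lambda_star_nonneg[OF \<mu>(1)] by (simp add: L_def real_of_ereal_pos)
  have Leq: "Lambda_star \<mu> x = ereal (L x)" if "ereal \<bar>x\<bar> < xstar \<mu>" for x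
    unfolding L_def using Lambda_star_finite[OF \<mu> that] Lambda_star_nonneg[OF \<mu>(1), of x]
    by (cases "Lambda_star \<mu> x") auto
  have Leven: "L \<bar>x\<bar> = L x" for x
    unfolding L_def using Lambda_star_uminus[OF \<mu>(2,3), of x] by (simp add: abs_if)
  have [measurable]: "L \<in> borel_measurable borel"
    unfolding L_def[abs_def] using borel_measurable_Lambda_star[of \<mu>] by measurable
  have Lleg: "s * y - ln (enn2real (mgf \<mu> s)) \<le> L y" if "ereal \<bar>y\<bar> < xstar \<mu>" "mgf \<mu> s < \<infinity>" for s y
  proof -
    have "ereal (s * y) - Lambda \<mu> s \<le> Lambda_star \<mu> y" unfolding Lambda_star_def by (rule SUP_upper[OF UNIV_I])
    moreover have "mgf \<mu> s \<noteq> \<infinity>" using that(2) by auto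
    ultimately show ?thesis using Leq[OF that(1)] by (simp add: Lambda_def)
  qed
  have nnL: "(\<integral>\<^sup>+x. ennreal (L x) \<partial>\<mu>) = ennreal T"
  proof -
    have "(\<integral>\<^sup>+x. ennreal (L x) \<partial>\<mu>) = E_Lambda_star \<mu>"
      unfolding E_Lambda_star_def using inner
      by (intro nn_integral_cong_AE) (auto simp: Leq e2ennreal_ereal elim!: AE_mp)
    then show ?thesis using False by (simp add: T_def less_top)
  qed
  have T0: "0 \<le> T" by (simp add: T_def)
  have intL: "integrable \<mu> L" using nnL L0 by (intro integrableI_nonneg) auto
  have EL: "(\<integral>x. L x \<partial>\<mu>) = T"
    using nn_integral_eq_integral[OF intL] L0 nnL T0 by (simp add: integral_nonneg_AE)

  \<comment> \<open>Division by 0 yields 0, so the lower bound \<open>1 / 2\<close> on the quotient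
    forces \<open>L x > 0\<close>; only then can the upper bound be multiplied out.\<close>
  have near: "\<exists>x0\<ge>0. ereal x0 < xstar \<mu> \<and> (\<forall>x. x0 < x \<longrightarrow> ereal x < xstar \<mu> \<longrightarrow>
      1 / 2 < - ln (measure \<mu> {x..}) / L x \<and> - ln (measure \<mu> {x..}) / L x < 1 + \<eta>)" if "0 < \<eta>" for \<eta>
  proof -
    let ?F = "if xstar \<mu> = \<infinity> then at_top else at_left (real_of_ereal (xstar \<mu>))"
    have lim: "((\<lambda>x. - ln (measure \<mu> {x..}) / L x) \<longlongrightarrow> 1) ?F"
      using assms(5) by (simp add: Lambda_star_condition_def L_def)
    have "\<forall>\<^sub>F x in ?F. 1 / 2 < - ln (measure \<mu> {x..}) / L x" by (rule order_tendstoD(1)[OF lim]) simp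
    moreover have "\<forall>\<^sub>F x in ?F. - ln (measure \<mu> {x..}) / L x < 1 + \<eta>"
      by (rule order_tendstoD(2)[OF lim]) (use that in simp)
    ultimately have ev: "\<forall>\<^sub>F x in ?F. 1 / 2 < - ln (measure \<mu> {x..}) / L x \<and>
        - ln (measure \<mu> {x..}) / L x < 1 + \<eta>" by (rule eventually_conj)
    show ?thesis
    proof (cases "xstar \<mu>")
      case (real X)
      then have X: "0 < X" using xpos by simp
      from ev real obtain b where b: "b < X" "\<And>x. b < x \<Longrightarrow> x < X \<Longrightarrow>
          1 / 2 < - ln (measure \<mu> {x..}) / L x \<and> - ln (measure \<mu> {x..}) / L x < 1 + \<eta>"
        using eventually_at_left[OF X] by auto
      show ?thesis using b X real by (intro exI[of _ "max 0 b"]) auto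
    next
      case PInf
      then obtain b where b: "\<And>x. b \<le> x \<Longrightarrow>
          1 / 2 < - ln (measure \<mu> {x..}) / L x \<and> - ln (measure \<mu> {x..}) / L x < 1 + \<eta>"
        using ev by (auto simp: eventually_at_top_linorder)
      show ?thesis using b PInf by (intro exI[of _ "\<bar>b\<bar>"]) auto
    qed (use xpos in auto)
  qed
  have Lpos: "0 < L x" if "1 / 2 < - ln (measure \<mu> {x..}) / L x" for x
  proof -
    have "L x \<noteq> 0" using that by auto
    then show ?thesis using L0[of x] by simp
  qed

  \<comment> \<open>All slack is a multiple of \<open>\<epsilon> * T\<close>, so \<open>T\<close>
    must be positive. If it were 0, \<open>L\<close> would vanish almost everywhere, yet it is
    positive near the end of the support, where there is mass.\<close>
  have Tpos: "0 < T"
  proof (rule ccontr)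
    assume "\<not> 0 < T"
    then have "(\<integral>x. L x \<partial>\<mu>) = 0" using T0 EL by simp
    then have z: "AE x in \<mu>. L x = 0" using integral_nonneg_eq_0_iff_AE[OF intL] L0 by simp
    obtain x0 where x0: "0 \<le> x0" "ereal x0 < xstar \<mu>"
      "\<And>x. x0 < x \<Longrightarrow> ereal x < xstar \<mu> \<Longrightarrow> 1 / 2 < - ln (measure \<mu> {x..}) / L x"
      using near[of 1] by auto
    obtain x1 where x1: "x0 < x1" "ereal x1 < xstar \<mu>" using ereal_dense2[OF x0(2)] by auto
    have "AE x in \<mu>. x \<notin> {x1..}" using z inner
    proof eventually_elim
      case (elim x)
      show ?case
      proof
        assume "x \<in> {x1..}"
        then have "x0 < x" "\<bar>x\<bar> = x" using x1 x0(1) by auto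
        then show False using Lpos[OF x0(3)[of x]] elim by simp
      qed
    qed
    then have "measure \<mu> {x1..} = 0" using \<mu>(2) by (subst prob_eq_0) auto
    then show False using measure_atLeast_pos_of_less_xstar[OF \<mu>(1,2) x1(2)] by simp
  qed

  \<comment> \<open>Small enough for \<open>cost\<close>: \<open>T + \<eta>\<close> comes from the
    weak law, the factor \<open>1 + \<eta>\<close> from the witnesses, and \<open>2 * \<eta>\<close>
    from their additive cost plus the fluctuation \<open>V\<close>.\<close>
  define \<eta> where "\<eta> = min 1 (\<epsilon> * T / (4 * (T + 4)))"
  have \<eta>: "0 < \<eta>" "\<eta> \<le> 1" "\<eta> * (T + 4) \<le> \<epsilon> * T / 4"
  proof -
    show "0 < \<eta>" "\<eta> \<le> 1" using Tpos assms(8) by (auto simp: \<eta>_def)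
    have "\<eta> \<le> \<epsilon> * T / (4 * (T + 4))" by (simp add: \<eta>_def)
    then show "\<eta> * (T + 4) \<le> \<epsilon> * T / 4" using Tpos by (simp add: field_simps)
  qed
  have cost: "(1 + \<eta>) * (T + \<eta>) + 2 * \<eta> \<le> (1 + \<epsilon> / 4) * T"
  proof -
    have "(1 + \<eta>) * (T + \<eta>) + 2 * \<eta> = T + \<eta> * (T + 3 + \<eta>)" by (simp add: algebra_simps)
    also have "\<eta> * (T + 3 + \<eta>) \<le> \<eta> * (T + 4)" using \<eta> by (intro mult_left_mono) auto
    also have "\<dots> \<le> \<epsilon> * T / 4" by (rule \<eta>(3))
    finally show ?thesis by (simp add: algebra_simps)
  qed
  obtain x0 where x0: "0 \<le> x0" "ereal x0 < xstar \<mu>"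
    "\<And>x. x0 < x \<Longrightarrow> ereal x < xstar \<mu> \<Longrightarrow>
      1 / 2 < - ln (measure \<mu> {x..}) / L x \<and> - ln (measure \<mu> {x..}) / L x < 1 + \<eta>"
    using near[OF \<eta>(1)] by auto
  obtain x1 where x1: "x0 < x1" "ereal x1 < xstar \<mu>" using ereal_dense2[OF x0(2)] by auto
  have "\<exists>C K t0. 3 \<le> K \<and> (\<forall>z \<sigma>. 0 \<le> z \<longrightarrow> z \<in> {z. ereal z < xstar \<mu>} \<longrightarrow> \<sigma> = 1 \<or> \<sigma> = - 1 \<longrightarrow>
    (\<exists>g b t. tilt_witness \<mu> C K t0 \<sigma> z ((1 + \<eta>) * L z + \<eta>) g b t))"
  proof (rule exists_uniform_tilt_witness[OF \<mu> x0(1) x1(1) _ _ L0 \<eta>(1)])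
    show "0 < measure \<mu> {x1..}" by (rule measure_atLeast_pos_of_less_xstar[OF \<mu>(1,2) x1(2)])
    show "s * y - ln (enn2real (mgf \<mu> s)) \<le> L y" if "0 \<le> y" "y \<le> x0" "mgf \<mu> s < \<infinity>" for s y
      using that x0(2) by (intro Lleg) (auto intro: le_less_trans[of _ "ereal x0"])
    show "0 < measure \<mu> {z..} \<and> - ln (measure \<mu> {z..}) \<le> (1 + \<eta>) * L z"
      if "x0 < z" "z \<in> {z. ereal z < xstar \<mu>}" for z
    proof
      have z: "ereal z < xstar \<mu>" using that by simp
      show "0 < measure \<mu> {z..}" by (rule measure_atLeast_pos_of_less_xstar[OF \<mu>(1,2) z])
      have h: "1 / 2 < - ln (measure \<mu> {z..}) / L z" "- ln (measure \<mu> {z..}) / L z < 1 + \<eta>"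
        using x0(3)[OF that(1) z] by auto
      show "- ln (measure \<mu> {z..}) \<le> (1 + \<eta>) * L z"
        using h(2) Lpos[OF h(1)] by (simp only: pos_divide_less_eq less_imp_le)
    qed
  qed
  then obtain C K t0 where K: "3 \<le> K" and
    wit0: "\<forall>z \<sigma>. 0 \<le> z \<longrightarrow> z \<in> {z. ereal z < xstar \<mu>} \<longrightarrow> \<sigma> = 1 \<or> \<sigma> = - 1 \<longrightarrow>
      (\<exists>g b t. tilt_witness \<mu> C K t0 \<sigma> z ((1 + \<eta>) * L z + \<eta>) g b t)" by blast
  have wit: "\<exists>g b t. tilt_witness \<mu> C K t0 \<sigma> z ((1 + \<eta>) * L z + \<eta>) g b t"
    if "0 \<le> z" "ereal z < xstar \<mu>" "\<sigma> = 1 \<or> \<sigma> = - 1" for z \<sigma>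
    using wit0 that by blast

  \<comment> \<open>\<open>exp (- r' * n)\<close> is the depth and \<open>exp (r * n)\<close> the
    number of samples. Of the total slack, \<open>\<epsilon> / 4\<close> pays for
    \<open>cost\<close>, \<open>\<epsilon> / 4\<close> for the constant
    \<open>12 * K\<^sup>2\<close>, and \<open>\<epsilon> / 2\<close> is the gap that
    \<open>hull_failure_bound\<close> exploits.\<close>
  define r' where "r' = (1 + \<epsilon> / 2) * T"
  define r where "r = (1 + \<epsilon>) * T"
  have rr: "0 \<le> r'" "r' < r" using Tpos assms(8) by (auto simp: r_def r'_def)
  obtain n1 where n1: "\<And>n. n1 \<le> n \<Longrightarrow> measure (PiM {..<n} (\<lambda>_. \<mu>)) {x\<in>space (PiM {..<n} (\<lambda>_. \<mu>)).
      real n * (T + \<eta>) < (\<Sum>i<n. L (x i))} \<le> \<delta> / 2"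
    using weak_law_upper_tail[OF \<mu>(1) _ L0 intL \<eta>(1), of "\<delta> / 2"] assms(6) EL by auto
  obtain n2 where n2: "\<And>n N q. \<lbrakk>n2 \<le> n; n < N; exp (r * real n) \<le> real N; exp (- r' * real n) \<le> q; q \<le> 1\<rbrakk>
      \<Longrightarrow> real (N choose Suc n) * (1 - q) ^ (N - Suc n) \<le> \<delta> / 2"
    using hull_failure_bound[OF rr, of "\<delta> / 2"] assms(6) by auto
  \<comment> \<open>\<open>n3\<close> meets the size condition of \<open>halfspace_prob_ge\<close>;
    \<open>n4\<close> absorbs \<open>12 * K\<^sup>2\<close> into the exponent.\<close>
  obtain n3 :: nat where n3: "12 * K\<^sup>2 * (t0\<^sup>2 * C\<^sup>2) / \<eta>\<^sup>2 \<le> real n3" using real_arch_simple by blast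
  obtain n4 :: nat where n4: "ln (12 * K\<^sup>2) / (\<epsilon> / 4 * T) \<le> real n4" using real_arch_simple by blast
  have hull: "1 - \<delta> \<le> expected_hull_measure \<mu> n N"
    if n: "0 < n" "n1 \<le> n" "n2 \<le> n" "n3 \<le> n" "n4 \<le> n" and N: "n < N" "exp (r * real n) \<le> real N" for n N
  proof -
    let ?P = "mu_n \<mu> n"
    interpret P: prob_space ?P by (rule prob_space_mu_n[OF \<mu>(1)])
    have Lm: "(\<lambda>x. \<Sum>i<n. L (x i)) \<in> borel_measurable ?P"
      by (intro borel_measurable_sum measurable_compose[OF borel_measurable_mu_n_coord[OF \<mu>(2)]]) auto
    define G where "G = {y\<in>space ?P. (\<forall>i<n. ereal \<bar>y i\<bar> < xstar \<mu>) \<and> (\<Sum>i<n. L (y i)) \<le> real n * (T + \<eta>)}"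
    have absm: "{y\<in>space ?P. ereal \<bar>y i\<bar> < xstar \<mu>} \<in> sets ?P" if "i < n" for i
    proof -
      note [measurable] = borel_measurable_mu_n_coord[OF \<mu>(2) that]
      show ?thesis by measurable
    qed
    have Sm: "{y\<in>space ?P. (\<Sum>i<n. L (y i)) \<le> real n * (T + \<eta>)} \<in> sets ?P" using Lm by measurable
    have Gm: "G \<in> sets ?P"
    proof -
      have "{y\<in>space ?P. \<forall>i\<in>{..<n}. ereal \<bar>y i\<bar> < xstar \<mu>} \<in> sets ?P"
        using absm by (intro sets.sets_Collect_finite_All) auto
      from sets.Int[OF this Sm] show ?thesis
        by (rule back_subst[of "\<lambda>A. A \<in> sets ?P"]) (auto simp: G_def)
    qed
    have "AE y in ?P. \<forall>i\<in>{..<n}. ereal \<bar>y i\<bar> < xstar \<mu>"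
      unfolding mu_n_def using inner
      by (intro AE_finite_allI AE_PiM_component[where P = "\<lambda>x. ereal \<bar>x\<bar> < xstar \<mu>"] \<mu>(1)) auto
    then have "AE y in ?P. y \<in> G \<longleftrightarrow> y \<in> {y\<in>space ?P. (\<Sum>i<n. L (y i)) \<le> real n * (T + \<eta>)}"
      by eventually_elim (auto simp: G_def)
    then have "measure ?P G = measure ?P {y\<in>space ?P. (\<Sum>i<n. L (y i)) \<le> real n * (T + \<eta>)}"
      using Gm Sm by (rule P.finite_measure_eq_AE)
    moreover have "measure ?P {y\<in>space ?P. \<not> (\<Sum>i<n. L (y i)) \<le> real n * (T + \<eta>)} \<le> \<delta> / 2"
      using n1[OF n(2)] by (simp add: mu_n_def not_le)
    ultimately have PG: "1 - \<delta> / 2 \<le> measure ?P G" using P.prob_neg[OF Sm] by simp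
    define q where "q = exp (- r' * real n)"
    have depth: "q \<le> measure ?P {x\<in>space ?P. (\<Sum>i<n. u i * (x i - y i)) \<le> 0}" if y: "y \<in> G" for y u
    proof -
      have yi: "ereal \<bar>y i\<bar> < xstar \<mu>" if "i < n" for i using y that by (simp add: G_def)
      have nC: "12 * K\<^sup>2 * (t0\<^sup>2 * C\<^sup>2) \<le> \<eta>\<^sup>2 * real n"
      proof -
        have "12 * K\<^sup>2 * (t0\<^sup>2 * C\<^sup>2) / \<eta>\<^sup>2 \<le> real n" using n3 n(4) by linarith
        then show ?thesis using \<eta>(1) by (simp add: pos_divide_le_eq mult.commute)
      qed
      \<comment> \<open>Depth concerns the side where the linear form is at most 0, so
        \<open>halfspace_prob_ge\<close> is applied to the direction \<open>- u\<close>.\<close>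
      have w: "\<exists>g b t. tilt_witness \<mu> C K t0 (if 0 \<le> - u i then 1 else - 1) \<bar>y i\<bar> ((1 + \<eta>) * L (y i) + \<eta>) g b t"
        if "i < n" for i
        using wit[of "\<bar>y i\<bar>" "if 0 \<le> - u i then 1 else - 1"] yi[OF that] by (simp add: Leven)
      have "q \<le> exp (- (\<Sum>i<n. (1 + \<eta>) * L (y i) + \<eta>) - \<eta> * real n) / (12 * K\<^sup>2)"
      proof -
        have "(\<Sum>i<n. (1 + \<eta>) * L (y i) + \<eta>) = (1 + \<eta>) * (\<Sum>i<n. L (y i)) + \<eta> * real n"
          by (simp add: sum.distrib sum_distrib_left)
        also have "\<dots> \<le> (1 + \<eta>) * (real n * (T + \<eta>)) + \<eta> * real n"
          using y \<eta>(1) by (intro add_right_mono mult_left_mono) (auto simp: G_def)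
        finally have "(\<Sum>i<n. (1 + \<eta>) * L (y i) + \<eta>) + \<eta> * real n \<le> real n * ((1 + \<eta>) * (T + \<eta>) + 2 * \<eta>)"
          by (simp add: algebra_simps)
        also have "\<dots> \<le> real n * ((1 + \<epsilon> / 4) * T)" using cost by (intro mult_left_mono) auto
        finally have 1: "(\<Sum>i<n. (1 + \<eta>) * L (y i) + \<eta>) + \<eta> * real n \<le> real n * ((1 + \<epsilon> / 4) * T)" .
        have "ln (12 * K\<^sup>2) / (\<epsilon> / 4 * T) \<le> real n" using n4 n(5) by linarith
        then have 2: "ln (12 * K\<^sup>2) \<le> real n * (\<epsilon> / 4 * T)" using Tpos assms(8) by (simp add: pos_divide_le_eq)
        have Kp: "0 < 12 * K\<^sup>2" using K by simp
        have "real n * ((1 + \<epsilon> / 4) * T) + real n * (\<epsilon> / 4 * T) = r' * real n"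
          by (simp add: r'_def algebra_simps)
        then have "- r' * real n \<le> - (\<Sum>i<n. (1 + \<eta>) * L (y i) + \<eta>) - \<eta> * real n - ln (12 * K\<^sup>2)"
          using 1 2 by simp
        then have "q \<le> exp (- (\<Sum>i<n. (1 + \<eta>) * L (y i) + \<eta>) - \<eta> * real n - ln (12 * K\<^sup>2))"
          unfolding q_def by (simp only: exp_le_cancel_iff)
        then show ?thesis using Kp by (simp only: exp_diff exp_ln)
      qed
      also have "\<dots> \<le> measure ?P {x\<in>space ?P. 0 \<le> (\<Sum>i<n. - u i * (x i - y i))}"
        by (rule halfspace_prob_ge[OF \<mu>(1,2) K \<eta>(1) n(1) nC w])
      also have "{x\<in>space ?P. 0 \<le> (\<Sum>i<n. - u i * (x i - y i))} = {x\<in>space ?P. (\<Sum>i<n. u i * (x i - y i)) \<le> 0}"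
        by (simp add: sum_negf)
      finally show ?thesis .
    qed
    have q1: "q \<le> 1" using rr(1) by (simp add: q_def)
    have "measure (PiM {..<N} (\<lambda>_. ?P)) {X\<in>space (PiM {..<N} (\<lambda>_. ?P)). y \<notin> K_N n N X} \<le> 1 - (1 - \<delta> / 2)"
      if y: "y \<in> G" for y
    proof -
      have "y \<in> space ?P" using y by (simp add: G_def)
      from prob_notin_K_N_le[OF \<mu>(1,2) N(1) this depth[OF y]]
      have "measure (PiM {..<N} (\<lambda>_. ?P)) {X\<in>space (PiM {..<N} (\<lambda>_. ?P)). y \<notin> K_N n N X}
        \<le> real (N choose Suc n) * (1 - q) ^ (N - Suc n)" .
      also have "\<dots> \<le> \<delta> / 2" using n2[OF n(3) N _ q1] by (simp add: q_def)
      finally show ?thesis by simp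
    qed
    then have "(1 - \<delta> / 2) * measure ?P G \<le> expected_hull_measure \<mu> n N"
      using assms(7) by (intro expected_hull_measure_ge[OF \<mu>(1,2) N(1) Gm]) auto
    moreover have "(1 - \<delta> / 2) * (1 - \<delta> / 2) \<le> (1 - \<delta> / 2) * measure ?P G"
      using PG assms(7) by (intro mult_left_mono) auto
    moreover have "1 - \<delta> \<le> (1 - \<delta> / 2) * (1 - \<delta> / 2)" by (simp add: algebra_simps)
    ultimately show ?thesis by linarith
  qed
  have rhs: "ereal (1 + \<epsilon>) * enn2ereal (E_Lambda_star \<mu>) = ereal r"
  proof -
    have "E_Lambda_star \<mu> = ennreal T" using False by (simp add: T_def less_top)
    then show ?thesis using T0 by (simp add: r_def)
  qed
  show ?thesis unfolding rhs
  \<comment> \<open>The \<open>Suc\<close> provides the condition \<open>0 < n\<close> of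
    \<open>hull\<close>.\<close>
  proof (intro exI[of _ "Suc (max (max n1 n2) (max n3 n4))"] allI impI)
    fix n assume "Suc (max (max n1 n2) (max n3 n4)) \<le> n"
    then show "rho2 \<mu> n \<delta> \<le> ereal r"
      unfolding rho2_def using hull[of n] by (intro Inf_lower) auto
  qed
qed

end
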